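(* Let $k>0$, let $f\in\mathcal{C}^1([-\frac12,\frac12])$ be a real-valued function satisfying $f(-x)=-f(x)$ and $f(\frac12)=1$, and let $$u_0(x) = 4k(2x-f(x)), \quad x\in\mathbb{T}.$$ Then a unique solution $u\in C(\mathbb{R}_+,H^1_{\rm per}(\mathbb{T}))$ of the Burgers equation $u_t+2uu_x=u_{xx}$, $x\in\mathbb{T}$, $t\in\mathbb{R}_+$, with $u|_{t=0}=u_0$, is given by $$u(x,t) = p(t)\left(2x - w(\xi(x,t),\tau(t))\right), \quad x\in\mathbb{T},\ t\in\mathbb{R}_+,$$ where $$p(t)=\frac{4k}{1+16kt}, \quad \xi(x,t) = \frac{4kx}{1+16kt}, \quad \tau(t) = \frac{16k^2t}{1+16kt},$$ and $w(\xi,\tau)$ is a unique odd (in $\xi$) solution of the Burgers equation $$w_\tau = 2ww_\xi + w_{\xi\xi}, \quad |\xi|<2(k-\tau),\ \tau\in(0,k), \qquad w|_{\tau=0} = f(\xi/4k), \quad |\xi|\le 2k,$$ subject to the boundary conditions $w=\pm1$ at $\xi=\pm2(k-\tau)$.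
   Context: $\mathbb{T}=[-\frac12,\frac12]$ is the unit circle with periodic boundary conditions; functions are real-valued. $H^1_{\rm per}(\mathbb{T})$ is the Sobolev space of $1$-periodic functions. *)

theory Defs
  imports "HOL-Analysis.Analysis"
begin

definition C1_on :: "(real \<Rightarrow> real) \<Rightarrow> real set \<Rightarrow> bool" where
  "C1_on f S \<longleftrightarrow>
     (\<exists>f'. (\<forall>x\<in>S. (f has_real_derivative f' x) (at x within S)) \<and> continuous_on S f')"

text \<open>
  The circle is the interval [-1/2, 1/2] with its endpoints identified. Functions on it are
  1-periodic functions on the real line; integrals over it are integrals over this interval.
\<close>

definition circ :: "real set" where
  "circ = {- (1/2) .. 1/2}"

definition periodic1 :: "(real \<Rightarrow> real) \<Rightarrow> bool" where
  "periodic1 v \<longleftrightarrow> (\<forall>x. v (x + 1) = v x)"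

definition test_per :: "(real \<Rightarrow> real) \<Rightarrow> bool" where
  "test_per \<phi> \<longleftrightarrow> periodic1 \<phi> \<and> (\<forall>n. (deriv ^^ n) \<phi> differentiable_on UNIV)"

definition L2_per :: "(real \<Rightarrow> real) \<Rightarrow> bool" where
  "L2_per g \<longleftrightarrow>
     set_borel_measurable lborel circ g \<and> set_integrable lborel circ (\<lambda>x. (g x)\<^sup>2)"

definition weak_deriv_per :: "(real \<Rightarrow> real) \<Rightarrow> (real \<Rightarrow> real) \<Rightarrow> bool" where
  "weak_deriv_per v g \<longleftrightarrow> L2_per g \<and>
     (\<forall>\<phi>. test_per \<phi> \<longrightarrow>
        (LINT x:circ|lborel. v x * deriv \<phi> x) = - (LINT x:circ|lborel. g x * \<phi> x))"

text \<open>
  In one dimension every class in the periodic Sobolev space of order one contains exactly one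
  continuous function, and the class is identified with it. Square integrability of the function
  itself is then automatic.
\<close>

definition H1_per :: "(real \<Rightarrow> real) set" where
  "H1_per = {v. periodic1 v \<and> continuous_on UNIV v \<and> (\<exists>g. weak_deriv_per v g)}"

text \<open>
  A weak derivative is unique up to a null set, so the choice below does not affect the norm.
  The value is meaningful only for functions in \<^const>\<open>H1_per\<close>.
\<close>

definition H1_norm :: "(real \<Rightarrow> real) \<Rightarrow> real" where
  "H1_norm v =
     sqrt ((LINT x:circ|lborel. (v x)\<^sup>2)
         + (LINT x:circ|lborel. ((SOME g. weak_deriv_per v g) x)\<^sup>2))"

definition C_Rplus_H1 :: "(real \<Rightarrow> real \<Rightarrow> real) \<Rightarrow> bool" where
  "C_Rplus_H1 u \<longleftrightarrow>
     (\<forall>t\<ge>0. (\<lambda>x. u x t) \<in> H1_per) \<and>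
     (\<forall>t\<ge>0. ((\<lambda>s. H1_norm (\<lambda>x. u x s - u x t)) \<longlongrightarrow> 0) (at t within {0..}))"

text \<open>
  For a function that is merely continuous in time with values in the Sobolev space, the second
  space derivative is only a distribution. The equation \<open>u\<^sub>t + 2 u u\<^sub>x = u\<^sub>x\<^sub>x\<close> is
  therefore read as an identity of distributions on the circle, for every time \<open>t \<ge> 0\<close>
  (with the one-sided time derivative at \<open>t = 0\<close>), with \<open>2 u u\<^sub>x = (u\<^sup>2)\<^sub>x\<close>
  and the space derivatives moved onto the test function.
\<close>

definition burgers_solution :: "(real \<Rightarrow> real) \<Rightarrow> (real \<Rightarrow> real \<Rightarrow> real) \<Rightarrow> bool" where
  "burgers_solution u\<^sub>0 u \<longleftrightarrow>
     C_Rplus_H1 u \<and>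
     (\<forall>\<phi> t. test_per \<phi> \<and> t \<ge> 0 \<longrightarrow>
        ((\<lambda>s. LINT x:circ|lborel. u x s * \<phi> x) has_real_derivative
          (LINT x:circ|lborel. u x t * deriv (deriv \<phi>) x + (u x t)\<^sup>2 * deriv \<phi> x))
        (at t within {0..})) \<and>
     (\<forall>x\<in>circ. u x 0 = u\<^sub>0 x)"

definition shrinking_dom :: "real \<Rightarrow> (real \<times> real) set" where
  "shrinking_dom k = {(\<xi>, \<tau>). 0 < \<tau> \<and> \<tau> < k \<and> \<bar>\<xi>\<bar> < 2 * (k - \<tau>)}"

text \<open>
  The parabolic closure: the lateral boundary and the initial line are added, but not the tip
  \<open>(0, k)\<close>, where the boundary values \<open>1\<close> and \<open>-1\<close> meet.
\<close>

definition shrinking_dom_closed :: "real \<Rightarrow> (real \<times> real) set" where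
  "shrinking_dom_closed k = {(\<xi>, \<tau>). 0 \<le> \<tau> \<and> \<tau> < k \<and> \<bar>\<xi>\<bar> \<le> 2 * (k - \<tau>)}"

text \<open>
  Odd classical solutions: once continuously differentiable in time and twice in space inside the
  domain, and continuous up to the lateral boundary and the initial line.
\<close>

definition shrinking_burgers_solution ::
    "real \<Rightarrow> (real \<Rightarrow> real) \<Rightarrow> (real \<Rightarrow> real \<Rightarrow> real) \<Rightarrow> bool" where
  "shrinking_burgers_solution k f w \<longleftrightarrow>
     continuous_on (shrinking_dom_closed k) (\<lambda>(\<xi>, \<tau>). w \<xi> \<tau>) \<and>
     (\<exists>w\<^sub>\<tau> w\<^sub>\<xi> w\<^sub>\<xi>\<^sub>\<xi>.
        continuous_on (shrinking_dom k) (\<lambda>(\<xi>, \<tau>). w\<^sub>\<tau> \<xi> \<tau>) \<and>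
        continuous_on (shrinking_dom k) (\<lambda>(\<xi>, \<tau>). w\<^sub>\<xi> \<xi> \<tau>) \<and>
        continuous_on (shrinking_dom k) (\<lambda>(\<xi>, \<tau>). w\<^sub>\<xi>\<^sub>\<xi> \<xi> \<tau>) \<and>
        (\<forall>(\<xi>, \<tau>) \<in> shrinking_dom k.
           ((\<lambda>s. w \<xi> s) has_real_derivative w\<^sub>\<tau> \<xi> \<tau>) (at \<tau>) \<and>
           ((\<lambda>y. w y \<tau>) has_real_derivative w\<^sub>\<xi> \<xi> \<tau>) (at \<xi>) \<and>
           ((\<lambda>y. w\<^sub>\<xi> y \<tau>) has_real_derivative w\<^sub>\<xi>\<^sub>\<xi> \<xi> \<tau>) (at \<xi>) \<and>
           w\<^sub>\<tau> \<xi> \<tau> = 2 * w \<xi> \<tau> * w\<^sub>\<xi> \<xi> \<tau> + w\<^sub>\<xi>\<^sub>\<xi> \<xi> \<tau>)) \<and>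
     (\<forall>(\<xi>, \<tau>) \<in> shrinking_dom_closed k. w (- \<xi>) \<tau> = - w \<xi> \<tau>) \<and>
     (\<forall>\<xi>. \<bar>\<xi>\<bar> \<le> 2 * k \<longrightarrow> w \<xi> 0 = f (\<xi> / (4 * k))) \<and>
     (\<forall>\<tau>. 0 < \<tau> \<and> \<tau> < k \<longrightarrow> w (2 * (k - \<tau>)) \<tau> = 1 \<and> w (- (2 * (k - \<tau>))) \<tau> = - 1)"

end

theory Submission
  imports Defs "HOL-Probability.Probability"
begin

text \<open>
  Existence: since \<open>f'\<close> is even, \<open>u\<^sub>0\<close> extends to an odd periodic \<open>C\<^sup>1\<close> function, and the
  Cole--Hopf substitution \<open>u = - \<psi>\<^sub>x / \<psi>\<close> turns the Burgers equation into the heat equation, which is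
  solved by \<open>\<psi>(x, t) = E \<psi>\<^sub>0(x + \<surd>(2t) Z)\<close> with \<open>Z\<close> standard normal. Gaussian integration by parts
  yields \<open>\<psi>\<^sub>t = \<psi>\<^sub>x\<^sub>x\<close> up to \<open>t = 0\<close> and one further derivative for \<open>t > 0\<close> without
  differentiating the kernel.

  Uniqueness of \<open>u\<close>: the Fourier modes of the difference of two solutions solve damped linear equations
  whose forcing is bounded by the \<open>L\<^sup>2\<close> norm of the difference; summing the squared modes shows that
  on a short time interval the squared norm is at most half of its own supremum.

  The function \<open>w\<close> is obtained from \<open>u\<close> by the change of variables in the statement, and it is unique
  by the parabolic maximum principle.
\<close>

subsection \<open>Integrals over the circle\<close>

text \<open>A solution is only continuous in time with values in H^1 and satisfies the equation
  weakly, so neither an energy identity nor the Cole-Hopf substitution applies directly to an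
  arbitrary one. Testing with sines and cosines is possible, hence the Fourier argument: the
  derivative on the nonlinearity costs a factor \<mu> against a damping \<mu>^2, and what remains is
  summable over the modes. Writing the heat solution with a random shift keeps time out of the
  density, so derivatives fall on the datum and continuity at t = 0 is dominated convergence.
  \<open>H1_norm\<close> selects a weak derivative by \<open>SOME\<close>; its value on C^1
  functions becomes accessible once weak derivatives are shown to agree almost everywhere. The
  boundary values of w are the zeros of u at the ends of the circle, forced by oddness and
  periodicity. They clash at the tip, so uniqueness of w is proved on truncations \<tau> \<le> T <
  k. The bound on w_\<xi> used there is available because one of the two compared solutions is the
  constructed one.\<close>

lemmas continuous_on_arith = continuous_on_add continuous_on_diff continuous_on_mult continuous_on_minus
  continuous_on_power continuous_on_const continuous_on_id

lemma circ_facts [simp]: "compact circ" "circ \<in> sets borel" "circ \<noteq> {}"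
  by (auto simp: circ_def)

lemma continuous_on_circ_integrable:
  fixes g :: "real \<Rightarrow> real"
  assumes "continuous_on circ g"
  shows "g integrable_on circ"
  using assms unfolding circ_def by (rule integrable_continuous_interval)

lemma continuous_on_circ_set_integrable:
  fixes g :: "real \<Rightarrow> real"
  assumes "continuous_on circ g"
  shows "set_integrable lborel circ g"
  using assms unfolding circ_def by (rule borel_integrable_atLeastAtMost')

text \<open>Solutions and \<open>H1_norm\<close> are defined by Lebesgue integrals, whereas the
  fundamental theorem of calculus and the rules used below concern \<open>integral\<close>; on
  continuous functions this passes between them.\<close>

lemma circ_LINT:
  fixes g :: "real \<Rightarrow> real"
  assumes "continuous_on circ g"
  shows "(LINT x:circ|lborel. g x) = integral circ g"
  by (rule set_borel_integral_eq_integral(2)[OF continuous_on_circ_set_integrable[OF assms]])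

lemma circ_integral_deriv:
  assumes "\<And>x. (F has_real_derivative g x) (at x)" and "F (1/2) = F (- (1/2))"
  shows "integral circ g = 0"
proof -
  have "(g has_integral (F (1/2) - F (- (1/2)))) circ"
    unfolding circ_def
    by (rule fundamental_theorem_of_calculus)
       (auto simp: has_real_derivative_iff_has_vector_derivative[symmetric]
             intro: has_field_derivative_at_within assms)
  then show ?thesis using assms(2) by (simp add: integral_unique)
qed

lemma DERIV_everywhere_continuous_on:
  assumes "\<And>x. (F has_real_derivative f x) (at x)"
  shows "continuous_on S F"
  by (rule continuous_at_imp_continuous_on) (use assms DERIV_isCont in blast)

lemma circ_integral_by_parts:
  assumes F: "\<And>x. (F has_real_derivative f x) (at x)" and G: "\<And>x. (G has_real_derivative g x) (at x)"
    and cont: "continuous_on circ f" "continuous_on circ g"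
    and per: "F (1/2) * G (1/2) = F (- (1/2)) * G (- (1/2))"
  shows "integral circ (\<lambda>x. F x * g x) = - integral circ (\<lambda>x. f x * G x)"
proof -
  have "continuous_on circ F" "continuous_on circ G"
    using DERIV_everywhere_continuous_on[OF F] DERIV_everywhere_continuous_on[OF G] .
  then have i: "(\<lambda>x. F x * g x) integrable_on circ" "(\<lambda>x. f x * G x) integrable_on circ"
    by (auto intro!: continuous_on_circ_integrable continuous_intros cont)
  have "integral circ (\<lambda>x. f x * G x + F x * g x) = 0"
    by (rule circ_integral_deriv[where F="\<lambda>x. F x * G x"])
       (use per in \<open>auto intro!: derivative_eq_intros F G simp: algebra_simps\<close>)
  then show ?thesis using integral_add[OF i(2) i(1)] by simp
qed

definition ip :: "(real \<Rightarrow> real) \<Rightarrow> (real \<Rightarrow> real) \<Rightarrow> real" where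
  "ip f g = integral circ (\<lambda>x. f x * g x)"

lemma ip_commute: "ip f g = ip g f"
  by (simp add: ip_def mult.commute)

lemma ip_add_left:
  assumes "continuous_on circ f" "continuous_on circ g" "continuous_on circ h"
  shows "ip (\<lambda>x. f x + g x) h = ip f h + ip g h"
  unfolding ip_def distrib_right
  by (intro integral_add continuous_on_circ_integrable continuous_intros assms)

lemma ip_diff_left:
  assumes "continuous_on circ f" "continuous_on circ g" "continuous_on circ h"
  shows "ip (\<lambda>x. f x - g x) h = ip f h - ip g h"
  unfolding ip_def left_diff_distrib
  by (intro integral_diff continuous_on_circ_integrable continuous_intros assms)

lemma ip_add_right:
  assumes "continuous_on circ f" "continuous_on circ g" "continuous_on circ h"
  shows "ip h (\<lambda>x. f x + g x) = ip h f + ip h g"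
  using ip_add_left[OF assms] by (simp add: ip_commute)

lemma ip_diff_right:
  assumes "continuous_on circ f" "continuous_on circ g" "continuous_on circ h"
  shows "ip h (\<lambda>x. f x - g x) = ip h f - ip h g"
  using ip_diff_left[OF assms] by (simp add: ip_commute)

lemma ip_scale_left: "ip (\<lambda>x. c * f x) h = c * ip f h"
  unfolding ip_def mult.assoc by (rule integral_mult_right)

lemma ip_scale_right: "ip h (\<lambda>x. c * f x) = c * ip h f"
  using ip_scale_left by (simp add: ip_commute)

lemma ip_sum_left:
  assumes "\<And>i. i \<in> I \<Longrightarrow> continuous_on circ (f i)" "continuous_on circ h" "finite I"
  shows "ip (\<lambda>x. \<Sum>i\<in>I. f i x) h = (\<Sum>i\<in>I. ip (f i) h)"
  unfolding ip_def sum_distrib_right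
  by (intro integral_sum continuous_on_circ_integrable continuous_intros assms)

lemma ip_nonneg: "0 \<le> ip f f"
  \<comment> \<open>If the square is not integrable, \<open>integral\<close> has the default value
    0, which is nonnegative as well.\<close>
  unfolding ip_def by (cases "(\<lambda>x. f x * f x) integrable_on circ")
    (auto intro: integral_nonneg simp: not_integrable_integral)

lemma ip_self_zero_imp:
  assumes "continuous_on circ f" "ip f f = 0" "x \<in> circ"
  shows "f x = 0"
proof -
  have "(\<lambda>x. f x * f x) integrable_on circ"
    by (intro continuous_on_circ_integrable continuous_intros assms)
  then have "((\<lambda>x. f x * f x) has_integral 0) (cbox (- (1/2)) (1/2))"
    using assms(2) unfolding ip_def circ_def by (simp add: has_integral_iff)
  then have "f x * f x = 0"
    by (rule has_integral_0_cbox_imp_0[rotated 2])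
       (use assms in \<open>auto simp: circ_def intro!: continuous_intros\<close>)
  then show ?thesis by simp
qed

lemma ip_Cauchy_Schwarz:
  assumes "continuous_on circ f" "continuous_on circ g"
  shows "(ip f g)\<^sup>2 \<le> ip f f * ip g g"
proof -
  have *: "0 \<le> ip f f - 2 * t * ip f g + t\<^sup>2 * ip g g" for t
  proof -
    have "0 \<le> ip (\<lambda>x. f x - t * g x) (\<lambda>x. f x - t * g x)" by (rule ip_nonneg)
    also have "\<dots> = ip f f - 2 * t * ip f g + t\<^sup>2 * ip g g"
      using ip_commute[of f g]
      by (simp add: ip_diff_left ip_diff_right ip_scale_left ip_scale_right assms continuous_on_arith
                    power2_eq_square algebra_simps)
    finally show ?thesis .
  qed
  show ?thesis
  proof (cases "ip g g = 0")
    case True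
    have "ip f g = 0"
    proof (rule ccontr)
      assume n: "ip f g \<noteq> 0"
      \<comment> \<open>At this t the expression, which is affine in t here, equals -1.\<close>
      show False using *[of "(ip f f + 1) / (2 * ip f g)"] n True by simp
    qed
    then show ?thesis using True by simp
  next
    case False
    then have "ip g g > 0" using ip_nonneg[of g] by simp
    \<comment> \<open>The quadratic polynomial is smallest at this t.\<close>
    then show ?thesis using *[of "ip f g / ip g g"]
      by (simp add: field_simps power2_eq_square)
  qed
qed

definition nrm :: "(real \<Rightarrow> real) \<Rightarrow> real" where
  "nrm f = sqrt (ip f f)"

lemma nrm_nonneg: "0 \<le> nrm f" and nrm_power2: "(nrm f)\<^sup>2 = ip f f"
  by (simp_all add: nrm_def ip_nonneg)

lemma ip_le_nrm:
  assumes "continuous_on circ f" "continuous_on circ g"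
  shows "\<bar>ip f g\<bar> \<le> nrm f * nrm g"
  using ip_Cauchy_Schwarz[OF assms] unfolding nrm_def
  by (metis real_sqrt_abs real_sqrt_le_mono real_sqrt_mult)

lemma nrm_triangle:
  assumes "continuous_on circ f" "continuous_on circ g"
  shows "nrm (\<lambda>x. f x + g x) \<le> nrm f + nrm g"
proof (rule power2_le_imp_le)
  have "(nrm (\<lambda>x. f x + g x))\<^sup>2 = ip f f + 2 * ip f g + ip g g"
    using ip_commute[of f g]
    by (simp add: nrm_power2 ip_add_left ip_add_right assms continuous_on_arith)
  also have "\<dots> \<le> (nrm f)\<^sup>2 + 2 * (nrm f * nrm g) + (nrm g)\<^sup>2"
    using ip_le_nrm[OF assms] by (simp add: nrm_power2)
  finally show "(nrm (\<lambda>x. f x + g x))\<^sup>2 \<le> (nrm f + nrm g)\<^sup>2"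
    by (simp add: power2_eq_square algebra_simps)
qed (simp add: nrm_nonneg)

lemma nrm_minus_commute: "nrm (\<lambda>x. f x - g x) = nrm (\<lambda>x. g x - f x)"
  unfolding nrm_def ip_def by (rule arg_cong[where f=sqrt], rule integral_cong) (simp add: algebra_simps)

lemma nrm_reverse_triangle:
  assumes f: "continuous_on circ f" and g: "continuous_on circ g"
  shows "\<bar>nrm f - nrm g\<bar> \<le> nrm (\<lambda>x. f x - g x)"
proof -
  have 1: "nrm f \<le> nrm (\<lambda>x. f x - g x) + nrm g"
    using nrm_triangle[OF continuous_on_diff[OF f g] g] by simp
  have 2: "nrm g \<le> nrm (\<lambda>x. f x - g x) + nrm f"
    using nrm_triangle[OF continuous_on_diff[OF g f] f] nrm_minus_commute[of f g] by simp
  show ?thesis using 1 2 by linarith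
qed

lemma nrm_mult_le:
  assumes "continuous_on circ f" "continuous_on circ g" "\<And>x. x \<in> circ \<Longrightarrow> \<bar>g x\<bar> \<le> B" "0 \<le> B"
  shows "nrm (\<lambda>x. f x * g x) \<le> B * nrm f"
proof (rule power2_le_imp_le)
  have "ip (\<lambda>x. f x * g x) (\<lambda>x. f x * g x) \<le> integral circ (\<lambda>x. B\<^sup>2 * (f x * f x))"
    unfolding ip_def
  proof (intro integral_le continuous_on_circ_integrable continuous_intros assms)
    fix x assume "x \<in> circ"
    then have "(g x)\<^sup>2 \<le> B\<^sup>2" using assms(3,4) by (simp add: abs_le_square_iff[symmetric])
    then have "(g x)\<^sup>2 * (f x)\<^sup>2 \<le> B\<^sup>2 * (f x)\<^sup>2" by (rule mult_right_mono) simp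
    then show "f x * g x * (f x * g x) \<le> B\<^sup>2 * (f x * f x)"
      by (simp add: power2_eq_square algebra_simps)
  qed
  then show "(nrm (\<lambda>x. f x * g x))\<^sup>2 \<le> (B * nrm f)\<^sup>2"
    by (simp only: nrm_power2 power_mult_distrib ip_def integral_mult_right)
qed (simp add: assms nrm_nonneg)

subsection \<open>Trigonometric polynomials\<close>

text \<open>The index is an integer because the product formulas produce differences m - n.\<close>

definition cs :: "int \<Rightarrow> real \<Rightarrow> real" where "cs n x = cos (2 * pi * of_int n * x)"
definition sn :: "int \<Rightarrow> real \<Rightarrow> real" where "sn n x = sin (2 * pi * of_int n * x)"

lemma cs_deriv: "(cs n has_real_derivative - (2 * pi * of_int n) * sn n x) (at x)"
  and sn_deriv: "(sn n has_real_derivative (2 * pi * of_int n) * cs n x) (at x)"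
  unfolding cs_def sn_def by (auto intro!: derivative_eq_intros)

lemma cs_continuous [simp]: "continuous_on S (cs n)" and sn_continuous [simp]: "continuous_on S (sn n)"
  unfolding cs_def sn_def by (auto intro!: continuous_intros)

lemma cs_abs_le: "\<bar>cs n x\<bar> \<le> 1" and sn_abs_le: "\<bar>sn n x\<bar> \<le> 1"
  by (auto simp: cs_def sn_def)

lemma cs_periodic: "cs n (x + 1) = cs n x" and sn_periodic: "sn n (x + 1) = sn n x"
proof -
  have e: "2 * pi * of_int n * (x + 1) = 2 * pi * of_int n * x + 2 * of_int n * pi"
    by (simp add: algebra_simps)
  have s: "sin (2 * of_int n * pi) = 0" using sin_zero_iff_int2[of "2 * of_int n * pi"]
    by (metis of_int_mult of_int_numeral)
  have c: "cos (2 * of_int n * pi) = 1" using cos_one_2pi_int[of "2 * of_int n * pi"] by force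
  show "cs n (x + 1) = cs n x" "sn n (x + 1) = sn n x"
    unfolding cs_def sn_def e cos_add sin_add s c by simp_all
qed

lemma cs_0: "cs 0 = (\<lambda>x. 1)" and sn_0: "sn 0 = (\<lambda>x. 0)"
  by (auto simp: cs_def sn_def)

lemma cs_minus: "cs (- n) = cs n" and sn_minus: "sn (- n) = (\<lambda>x. (- 1) * sn n x)"
  by (auto simp: cs_def sn_def)

text \<open>The explicit coefficients, including \<open>(- (1/2))\<close>, give the right-hand sides
  the shape that \<open>integral_lin2\<close> and the introduction rules of \<open>trig\<close>
  match.\<close>

lemma cs_cs: "cs m x * cs n x = (1/2) * cs (m - n) x + (1/2) * cs (m + n) x"
  and sn_sn: "sn m x * sn n x = (1/2) * cs (m - n) x + (- (1/2)) * cs (m + n) x"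
  and sn_cs: "sn m x * cs n x = (1/2) * sn (m + n) x + (1/2) * sn (m - n) x"
  unfolding cs_def sn_def
  by (simp_all add: sin_add sin_diff cos_add cos_diff algebra_simps)

lemma integral_cs: "integral circ (cs n) = (if n = 0 then 1 else 0)"
proof (cases "n = 0")
  case True
  then show ?thesis by (simp add: cs_0 circ_def)
next
  case False
  have "integral circ (cs n) = 0"
  proof (rule circ_integral_deriv[where F = "\<lambda>x. sn n x / (2 * pi * of_int n)"])
    show "((\<lambda>x. sn n x / (2 * pi * of_int n)) has_real_derivative cs n x) (at x)" for x
      using False by (auto intro!: derivative_eq_intros sn_deriv)
    show "sn n (1/2) / (2 * pi * of_int n) = sn n (- (1/2)) / (2 * pi * of_int n)"
      using sn_periodic[of n "- (1/2)"] by simp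
  qed
  then show ?thesis using False by simp
qed

lemma integral_sn: "integral circ (sn n) = 0"
proof (cases "n = 0")
  case True
  then show ?thesis by (simp add: sn_0)
next
  case False
  show ?thesis
  proof (rule circ_integral_deriv[where F = "\<lambda>x. - (cs n x / (2 * pi * of_int n))"])
    show "((\<lambda>x. - (cs n x / (2 * pi * of_int n))) has_real_derivative sn n x) (at x)" for x
      using False by (auto intro!: derivative_eq_intros cs_deriv)
    show "- (cs n (1/2) / (2 * pi * of_int n)) = - (cs n (- (1/2)) / (2 * pi * of_int n))"
      using cs_periodic[of n "- (1/2)"] by simp
  qed
qed

lemma integral_lin2:
  fixes f g :: "real \<Rightarrow> real"
  assumes "continuous_on circ f" "continuous_on circ g"
  shows "integral circ (\<lambda>x. a * f x + b * g x) = a * integral circ f + b * integral circ g"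
proof -
  have "integral circ (\<lambda>x. a * f x + b * g x) = integral circ (\<lambda>x. a * f x) + integral circ (\<lambda>x. b * g x)"
    by (intro integral_add continuous_on_circ_integrable continuous_intros assms)
  then show ?thesis by (simp only: integral_mult_right)
qed

text \<open>With signed indices \<open>cs (- n)\<close> equals \<open>cs n\<close> and
  \<open>sn (- n)\<close> equals minus \<open>sn n\<close>, hence two indicator terms; for m = n = 0
  they add up to 1 for cosines and cancel for sines.\<close>

lemma ip_cs_cs: "ip (cs m) (cs n) = ((if m = n then 1 else 0) + (if m + n = 0 then 1 else 0)) / 2"
  and ip_sn_sn: "ip (sn m) (sn n) = ((if m = n then 1 else 0) - (if m + n = 0 then 1 else 0)) / 2"
  and ip_sn_cs: "ip (sn m) (cs n) = 0"
  unfolding ip_def cs_cs sn_sn sn_cs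
  by (subst integral_lin2; simp add: integral_cs integral_sn)+

text \<open>The linear span as an inductive predicate: linear statements such as orthogonality need
  checking on single sines and cosines only.\<close>

inductive trig :: "(real \<Rightarrow> real) \<Rightarrow> bool" where
  trig_cs: "trig (cs n)"
| trig_sn: "trig (sn n)"
| trig_add: "trig p \<Longrightarrow> trig q \<Longrightarrow> trig (\<lambda>x. p x + q x)"
| trig_scale: "trig p \<Longrightarrow> trig (\<lambda>x. c * p x)"

lemma trig_continuous: "trig p \<Longrightarrow> continuous_on S p"
  by (induction rule: trig.induct) (auto intro!: continuous_intros)

lemma trig_mult_cs:
  assumes "trig p" shows "trig (\<lambda>x. p x * cs n x)"
  using assms
proof induction
  case (trig_add p q)
  show ?case using trig.trig_add[OF trig_add.IH] by (simp add: distrib_right)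
next
  case (trig_scale p c)
  show ?case using trig.trig_scale[OF trig_scale.IH, of c] by (simp add: mult.assoc)
qed (auto simp only: cs_cs sn_cs intro!: trig.intros)

lemma trig_mult_sn:
  assumes "trig p" shows "trig (\<lambda>x. p x * sn n x)"
  using assms
proof induction
  case (trig_cs m)
  show ?case unfolding mult.commute[of "cs m x" for x] sn_cs by (intro trig.intros)
next
  case (trig_sn m)
  show ?case unfolding sn_sn by (intro trig.intros)
next
  case (trig_add p q)
  show ?case using trig.trig_add[OF trig_add.IH] by (simp add: distrib_right)
next
  case (trig_scale p c)
  show ?case using trig.trig_scale[OF trig_scale.IH, of c] by (simp add: mult.assoc)
qed

lemma trig_mult:
  assumes "trig p" "trig q" shows "trig (\<lambda>x. p x * q x)"
  using assms(2)
proof induction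
  case (trig_add q1 q2)
  show ?case using trig.trig_add[OF trig_add.IH] by (simp add: distrib_left)
next
  case (trig_scale q c)
  show ?case using trig.trig_scale[OF trig_scale.IH, of c] by (simp add: mult.left_commute)
qed (auto intro: trig_mult_cs trig_mult_sn assms(1))

lemma trig_const: "trig (\<lambda>x. c)"
  using trig_scale[OF trig_cs[of 0], of c] by (simp add: cs_0)

text \<open>Polynomial functions on the plane are generated by constants and linear functionals, and
  on the unit circle a linear functional is a combination of one cosine and one sine. The rest is
  closure of \<open>trig\<close> under products.\<close>

lemma trig_real_polynomial_function:
  fixes p :: "complex \<Rightarrow> real"
  assumes "real_polynomial_function p"
  shows "trig (\<lambda>x. p (cis (2 * pi * x)))"
  using assms
proof induction
  case (linear f)
  interpret bounded_linear f by fact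
  have "f (cis (2 * pi * x)) = f 1 * cs 1 x + f \<i> * sn 1 x" for x
  proof -
    have "cis (2 * pi * x) = cs 1 x *\<^sub>R 1 + sn 1 x *\<^sub>R \<i>"
      by (auto simp: complex_eq_iff cs_def sn_def)
    then show ?thesis by (simp add: add scale)
  qed
  then show ?case by (simp only:) (intro trig.intros)
qed (auto intro: trig_const trig_add trig_mult)

text \<open>A continuous function on the interval with equal end values descends to the unit circle,
  because \<open>x \<mapsto> cis (2\<pi>x)\<close> is a closed map on the compact interval; there the
  Stone--Weierstrass theorem applies.\<close>

lemma trig_dense:
  assumes cont: "continuous_on circ \<phi>" and ends: "\<phi> (- (1/2)) = \<phi> (1/2)" and e: "e > 0"
  obtains p where "trig p" "\<And>x. x \<in> circ \<Longrightarrow> \<bar>\<phi> x - p x\<bar> < e"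
proof -
  define c where "c = (\<lambda>x::real. cis (2 * pi * x))"
  have cont_c: "continuous_on S c" for S
    unfolding c_def by (intro continuous_intros)
  have c_eq: "\<phi> x = \<phi> y" if "x \<in> circ" "y \<in> circ" "c x = c y" for x y
  proof -
    have "cos (2 * pi * x) = cos (2 * pi * y) \<and> sin (2 * pi * x) = sin (2 * pi * y)"
      using that(3) by (auto simp: c_def complex_eq_iff)
    then have "\<exists>n::int. 2 * pi * x = 2 * pi * y + 2 * pi * n"
      using sin_cos_eq_iff[of "2 * pi * x" "2 * pi * y"] by (auto simp: algebra_simps)
    then obtain n :: int where "2 * pi * x = 2 * pi * (y + n)" by (auto simp: algebra_simps)
    then have n: "x = y + n" by simp
    \<comment> \<open>Two points of an interval of length 1 differ by a nonzero integer only if they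
      are its two ends.\<close>
    then have "n \<in> {-1, 0, 1}" using that(1,2) unfolding circ_def by auto
    moreover have "x = 1/2 \<and> y = - (1/2)" if "n = 1" using n that \<open>x \<in> circ\<close> \<open>y \<in> circ\<close> by (auto simp: circ_def)
    moreover have "x = - (1/2) \<and> y = 1/2" if "n = - 1" using n that \<open>x \<in> circ\<close> \<open>y \<in> circ\<close> by (auto simp: circ_def)
    ultimately show ?thesis using n ends
      by (metis (no_types, lifting) add.right_neutral insertE of_int_0 singletonD)
  qed
  \<comment> \<open>The factor of \<open>\<phi>\<close> through \<open>c\<close>; by
    \<open>c_eq\<close> the chosen preimage does not influence the value.\<close>
  define G where "G = (\<lambda>w. \<phi> (SOME x. x \<in> circ \<and> c x = w))"
  have Gc: "G (c x) = \<phi> x" if "x \<in> circ" for x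
  proof -
    have "(SOME y. y \<in> circ \<and> c y = c x) \<in> circ \<and> c (SOME y. y \<in> circ \<and> c y = c x) = c x"
      by (rule someI[of _ x]) (use that in simp)
    then show ?thesis unfolding G_def using c_eq that by blast
  qed
  have K: "compact (c ` circ)" by (intro compact_continuous_image cont_c circ_facts)
  have "continuous_on (c ` circ) G"
  proof (subst continuous_on_closed_vimage[OF compact_imp_closed[OF K]], intro allI impI)
    fix B :: "real set" assume "closed B"
    then have "closed (\<phi> -` B \<inter> circ)"
      using continuous_on_closed_vimage[of circ \<phi>] cont compact_imp_closed[of circ] by simp
    then have "compact (\<phi> -` B \<inter> circ)"
      using closed_Int_compact[of "\<phi> -` B \<inter> circ" circ] by (simp add: Int_assoc)
    then have "closed (c ` (\<phi> -` B \<inter> circ))"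
      by (intro compact_imp_closed compact_continuous_image cont_c)
    moreover have "G -` B \<inter> c ` circ = c ` (\<phi> -` B \<inter> circ)"
      using Gc by auto
    ultimately show "closed (G -` B \<inter> c ` circ)" by simp
  qed
  from Stone_Weierstrass_real_polynomial_function[OF K this e]
  obtain p where p: "real_polynomial_function p" "\<And>x. x \<in> c ` circ \<Longrightarrow> \<bar>G x - p x\<bar> < e" by blast
  show ?thesis
  proof (rule that[of "\<lambda>x. p (cis (2 * pi * x))"])
    show "trig (\<lambda>x. p (cis (2 * pi * x)))" by (rule trig_real_polynomial_function[OF p(1)])
    show "\<bar>\<phi> x - p (cis (2 * pi * x))\<bar> < e" if "x \<in> circ" for x
      using p(2)[of "c x"] Gc[OF that] that by (simp add: c_def)
  qed
qed

text \<open>The constant mode is left out since only functions of mean zero are expanded; the factor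
  2 compensates for the value 1/2 of the squared norms.\<close>

definition fourier_sum :: "(real \<Rightarrow> real) \<Rightarrow> nat \<Rightarrow> real \<Rightarrow> real" where
  "fourier_sum z N x =
     (\<Sum>n=1..N. 2 * ip z (cs (int n)) * cs (int n) x + 2 * ip z (sn (int n)) * sn (int n) x)"

lemma fourier_sum_continuous: "continuous_on S (fourier_sum z N)"
  unfolding fourier_sum_def by (auto intro!: continuous_intros)

lemma ip_fourier_sum:
  assumes "continuous_on circ g"
  shows "ip (fourier_sum z N) g =
    (\<Sum>n=1..N. 2 * ip z (cs (int n)) * ip (cs (int n)) g + 2 * ip z (sn (int n)) * ip (sn (int n)) g)"
proof -
  have "ip (fourier_sum z N) g = (\<Sum>n=1..N. ip (\<lambda>x. 2 * ip z (cs (int n)) * cs (int n) x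
      + 2 * ip z (sn (int n)) * sn (int n) x) g)"
    unfolding fourier_sum_def
    by (rule ip_sum_left) (auto intro!: continuous_intros assms)
  also have "\<dots> = (\<Sum>n=1..N. 2 * ip z (cs (int n)) * ip (cs (int n)) g + 2 * ip z (sn (int n)) * ip (sn (int n)) g)"
    by (rule sum.cong[OF refl], subst ip_add_left)
       (auto intro!: continuous_intros assms simp: ip_scale_left)
  finally show ?thesis .
qed

lemma ip_fourier_sum_cs:
  assumes "1 \<le> m" "m \<le> N" shows "ip (fourier_sum z N) (cs (int m)) = ip z (cs (int m))"
proof -
  have "ip (fourier_sum z N) (cs (int m)) = (\<Sum>n=1..N. ip z (cs (int n)) * (if n = m then 1 else 0))"
    using assms by (simp add: ip_fourier_sum ip_cs_cs ip_sn_cs)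
  then show ?thesis using assms by (simp add: if_distrib[where f="(*) _"] sum.delta cong: if_cong)
qed

lemma ip_fourier_sum_sn:
  assumes "1 \<le> m" "m \<le> N" shows "ip (fourier_sum z N) (sn (int m)) = ip z (sn (int m))"
proof -
  have "ip (fourier_sum z N) (sn (int m)) = (\<Sum>n=1..N. ip z (sn (int n)) * (if n = m then 1 else 0))"
    using assms by (simp add: ip_fourier_sum ip_sn_sn ip_sn_cs ip_commute[of "cs n" "sn m" for n m])
  then show ?thesis using assms by (simp add: if_distrib[where f="(*) _"] sum.delta cong: if_cong)
qed

text \<open>The partial sum reproduces every mode up to N, so its residual is orthogonal to all
  trigonometric polynomials of degree at most N. \<open>N0\<close> stands for the degree, which
  \<open>trig\<close> does not record.\<close>

lemma fourier_sum_residual_trig: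
  assumes z: "continuous_on circ z" "ip z (cs 0) = 0" and "trig p"
  shows "\<exists>N0. \<forall>N\<ge>N0. ip (\<lambda>x. z x - fourier_sum z N x) p = 0"
proof -
  have res_cs: "ip (\<lambda>x. z x - fourier_sum z N x) (cs (int m)) = 0" if "m \<le> N" for m N
  proof (cases "m = 0")
    case True
    have "ip (fourier_sum z N) (cs 0) = 0"
      by (simp add: ip_fourier_sum ip_cs_cs ip_sn_cs)
    then show ?thesis using True z by (simp add: ip_diff_left fourier_sum_continuous)
  next
    case False
    then show ?thesis using that z by (simp add: ip_diff_left fourier_sum_continuous ip_fourier_sum_cs)
  qed
  have res_sn: "ip (\<lambda>x. z x - fourier_sum z N x) (sn (int m)) = 0" if "m \<le> N" for m N
  proof (cases "m = 0")
    case True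
    then show ?thesis by (simp add: sn_0 ip_def)
  next
    case False
    then show ?thesis using that z by (simp add: ip_diff_left fourier_sum_continuous ip_fourier_sum_sn)
  qed
  show ?thesis using \<open>trig p\<close>
  proof induction
    case (trig_cs n)
    have "cs n = cs (int (nat \<bar>n\<bar>))" by (cases "n \<ge> 0") (auto simp: cs_minus)
    then show ?case using res_cs[of "nat \<bar>n\<bar>"] by metis
  next
    case (trig_sn n)
    show ?case
    proof (cases "n \<ge> 0")
      case True
      then show ?thesis using res_sn[of "nat n"] by auto
    next
      case False
      then have n: "sn n = (\<lambda>x. (- 1) * sn (int (nat (- n))) x)"
        using sn_minus[of "- n"] by simp
      show ?thesis unfolding n ip_scale_right using res_sn[of "nat (- n)"]
        by (intro exI[of _ "nat (- n)"]) simp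
    qed
  next
    case (trig_add p q)
    then obtain N1 N2 where "\<forall>N\<ge>N1. ip (\<lambda>x. z x - fourier_sum z N x) p = 0"
      "\<forall>N\<ge>N2. ip (\<lambda>x. z x - fourier_sum z N x) q = 0" by blast
    then show ?case
      by (intro exI[of _ "max N1 N2"])
         (simp add: ip_add_right trig_continuous trig_add.hyps z(1) fourier_sum_continuous continuous_on_diff)
  next
    case (trig_scale p c)
    then show ?case by (auto simp: ip_scale_right)
  qed
qed

text \<open>Half of Parseval's identity, free of infinite sums. The residual r of a partial sum is
  orthogonal to that sum and, for large N, to an approximating polynomial p, so <r, r> = <r, z - p>
  is at most |r| |z - p|. A uniform error \<open>sqrt e\<close> therefore leaves at most
  \<open>e\<close> in the square.\<close>

lemma fourier_coefficients_bound:
  assumes z: "continuous_on circ z" "z (- (1/2)) = z (1/2)" "ip z (cs 0) = 0"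
    and B: "\<And>N. (\<Sum>n=1..N. (ip z (cs (int n)))\<^sup>2 + (ip z (sn (int n)))\<^sup>2) \<le> B"
  shows "ip z z \<le> 2 * B"
proof (rule field_le_epsilon)
  fix e :: real assume "e > 0"
  then have se: "sqrt e > 0" by simp
  obtain p where p: "trig p" "\<And>x. x \<in> circ \<Longrightarrow> \<bar>z x - p x\<bar> < sqrt e"
    using trig_dense[OF z(1,2) se] by metis
  obtain N where N: "ip (\<lambda>x. z x - fourier_sum z N x) p = 0"
    using fourier_sum_residual_trig[OF z(1,3) p(1)] by blast
  define S where "S = fourier_sum z N"
  define r where "r = (\<lambda>x. z x - S x)"
  note cont = z(1) fourier_sum_continuous[of circ z N, folded S_def] trig_continuous[OF p(1), of circ]
  have cr: "continuous_on circ r" unfolding r_def by (intro continuous_intros cont)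
  have rc: "ip r (cs (int n)) = 0" "ip r (sn (int n)) = 0" if "n \<in> {1..N}" for n
    using that unfolding r_def S_def
    by (simp_all add: ip_diff_left z fourier_sum_continuous ip_fourier_sum_cs ip_fourier_sum_sn)
  have rS: "ip r S = 0"
    by (subst ip_commute)
       (simp add: S_def ip_fourier_sum[OF cr] ip_commute[of "cs n" r for n] ip_commute[of "sn n" r for n] rc)
  have zS: "ip z S = 2 * (\<Sum>n=1..N. (ip z (cs (int n)))\<^sup>2 + (ip z (sn (int n)))\<^sup>2)"
    by (subst ip_commute) (simp add: S_def ip_fourier_sum[OF z(1)] ip_commute[of "cs n" z for n]
        ip_commute[of "sn n" z for n] sum_distrib_left power2_eq_square algebra_simps)
  have rz: "ip r z = ip r r"
    using rS ip_diff_right[OF cont(1) cont(2) cr] by (simp add: r_def)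
  have "ip r r = ip r (\<lambda>x. z x - p x)"
    using N rz ip_diff_right[OF cont(1) cont(3) cr] by (simp add: r_def S_def)
  also have "\<dots> \<le> nrm r * nrm (\<lambda>x. z x - p x)"
    using ip_le_nrm[OF cr continuous_on_diff[OF cont(1) cont(3)]] by simp
  also have "\<dots> \<le> nrm r * sqrt e"
  proof -
    have "nrm (\<lambda>x. 1 * (z x - p x)) \<le> sqrt e * nrm (\<lambda>x. 1)"
      using p(2) by (intro nrm_mult_le continuous_intros cont) (auto intro: less_imp_le simp: less_imp_le[OF \<open>e > 0\<close>])
    moreover have "nrm (\<lambda>x. 1) = 1" by (simp add: nrm_def ip_def circ_def)
    ultimately show ?thesis by (simp add: mult_left_mono nrm_nonneg)
  qed
  finally have "nrm r * nrm r \<le> nrm r * sqrt e" by (simp add: nrm_power2[symmetric] power2_eq_square)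
  then have "nrm r \<le> sqrt e" using nrm_nonneg[of r] se by (cases "nrm r = 0") auto
  then have "ip r r \<le> e"
    using \<open>e > 0\<close> nrm_power2[of r] nrm_nonneg[of r] power_mono[of "nrm r" "sqrt e" 2] by simp
  moreover have "ip z z = ip z r + ip z S"
    using ip_diff_right[OF cont(1) cont(2) cont(1)] by (simp add: r_def)
  ultimately show "ip z z \<le> 2 * B + e"
    using zS B[of N] rz ip_commute[of z r] by simp
qed

subsection \<open>Uniqueness for the periodic Burgers equation\<close>

lemma periodic1_add_int:
  assumes "periodic1 f" shows "f (x + of_int n) = f x"
proof -
  have nat: "f (x + of_nat m) = f x" for m x
    by (induction m) (use assms in \<open>auto simp: periodic1_def add.assoc[symmetric] add.commute[of 1]\<close>)
  show ?thesis
  proof (cases "n \<ge> 0")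
    case True
    then show ?thesis using nat[of x "nat n"] by simp
  next
    case False
    then show ?thesis using nat[of "x + of_int n" "nat (- n)"] by simp
  qed
qed

text \<open>Subtracting the nearest integer works for all periodic functions at once. The last
  conclusion lets an equality of two functions on \<open>circ\<close> be carried to the whole
  line.\<close>

lemma periodic1_reduce:
  assumes "periodic1 f"
  obtains y where "y \<in> circ" "f x = f y" "\<And>g. periodic1 g \<Longrightarrow> g x = g y"
proof (rule that[of "x + of_int (- \<lfloor>x + 1/2\<rfloor>)"])
  have "- (1/2) \<le> x + of_int (- \<lfloor>x + 1/2\<rfloor>)" "x + of_int (- \<lfloor>x + 1/2\<rfloor>) \<le> 1/2"
    unfolding of_int_minus by linarith+
  then show "x + of_int (- \<lfloor>x + 1/2\<rfloor>) \<in> circ" unfolding circ_def by simp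
  show "f x = f (x + of_int (- \<lfloor>x + 1/2\<rfloor>))" by (rule periodic1_add_int[OF assms, symmetric])
  show "g x = g (x + of_int (- \<lfloor>x + 1/2\<rfloor>))" if "periodic1 g" for g
    by (rule periodic1_add_int[OF that, symmetric])
qed

lemma periodic1_ends: "periodic1 f \<Longrightarrow> f (1/2) = f (- (1/2))"
  unfolding periodic1_def by (drule spec[of _ "- (1/2)"]) simp

lemma deriv_cs_sn:
  "deriv (\<lambda>x. a * cs n x + b * sn n x) = (\<lambda>x. (2 * pi * of_int n * b) * cs n x + (- (2 * pi * of_int n) * a) * sn n x)"
  by (rule ext, rule DERIV_imp_deriv) (auto intro!: derivative_eq_intros cs_deriv sn_deriv)

lemma deriv_cs: "deriv (cs n) = (\<lambda>x. - (2 * pi * of_int n) * sn n x)"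
  and deriv_deriv_cs: "deriv (deriv (cs n)) = (\<lambda>x. - ((2 * pi * of_int n)\<^sup>2) * cs n x)"
  using deriv_cs_sn[of 1 n 0] deriv_cs_sn[of 0 n "- (2 * pi * of_int n)"]
  by (simp_all add: power2_eq_square)

lemma deriv_sn: "deriv (sn n) = (\<lambda>x. 2 * pi * of_int n * cs n x)"
  and deriv_deriv_sn: "deriv (deriv (sn n)) = (\<lambda>x. - ((2 * pi * of_int n)\<^sup>2) * sn n x)"
  using deriv_cs_sn[of 0 n 1] deriv_cs_sn[of "2 * pi * of_int n" n 0]
  by (simp_all add: power2_eq_square)

text \<open>The combinations of \<open>cs n\<close> and \<open>sn n\<close> are stable under
  \<open>deriv\<close>, which a single one of the two is not; the induction on the order of the
  derivative therefore runs over arbitrary coefficients.\<close>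

lemma test_per_cs_sn: "test_per (\<lambda>x. a * cs n x + b * sn n x)"
proof -
  have "(deriv ^^ m) (\<lambda>x. a * cs n x + b * sn n x) differentiable_on UNIV" for m
  proof (induction m arbitrary: a b)
    case 0
    have "((\<lambda>x. a * cs n x + b * sn n x) has_real_derivative
        (2 * pi * of_int n * b) * cs n x + (- (2 * pi * of_int n) * a) * sn n x) (at x)" for x
      by (auto intro!: derivative_eq_intros cs_deriv sn_deriv)
    then show ?case
      by (auto simp: differentiable_on_def real_differentiable_def)
  next
    case (Suc m)
    show ?case unfolding funpow_Suc_right o_apply deriv_cs_sn by (rule Suc)
  qed
  then show ?thesis
    by (auto simp: test_per_def periodic1_def cs_periodic sn_periodic)
qed

lemma test_per_cs: "test_per (cs n)" and test_per_sn: "test_per (sn n)"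
  using test_per_cs_sn[of 1 n 0] test_per_cs_sn[of 0 n 1] by simp_all

section \<open>Fourier modes of solutions of the Burgers equation\<close>

lemma burgers_slice:
  assumes "burgers_solution u0 v" "t \<ge> 0"
  shows "periodic1 (\<lambda>x. v x t)" "continuous_on S (\<lambda>x. v x t)"
  using assms continuous_on_subset[of UNIV _ S]
  unfolding burgers_solution_def C_Rplus_H1_def H1_per_def by auto

text \<open>The test function \<open>cs n\<close> is an eigenfunction of the second derivative, so
  the weak equation becomes a damped scalar equation; the sine appears because the space derivative
  of the flux sits on the test function.\<close>

lemma burgers_cs_deriv:
  assumes v: "burgers_solution u0 v" and t: "t \<ge> 0"
  shows "((\<lambda>s. ip (\<lambda>x. v x s) (cs n)) has_real_derivative
      - ((2 * pi * of_int n)\<^sup>2) * ip (\<lambda>x. v x t) (cs n)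
      - (2 * pi * of_int n) * ip (\<lambda>x. (v x t)\<^sup>2) (sn n)) (at t within {0..})"
proof -
  note c = burgers_slice(2)[OF v]
  have D: "((\<lambda>s. LINT x:circ|lborel. v x s * cs n x) has_real_derivative
          (LINT x:circ|lborel. v x t * deriv (deriv (cs n)) x + (v x t)\<^sup>2 * deriv (cs n) x))
        (at t within {0..})"
    using v t test_per_cs[of n] unfolding burgers_solution_def by blast
  have E: "(LINT x:circ|lborel. v x t * deriv (deriv (cs n)) x + (v x t)\<^sup>2 * deriv (cs n) x)
     = - ((2 * pi * of_int n)\<^sup>2) * ip (\<lambda>x. v x t) (cs n)
      - (2 * pi * of_int n) * ip (\<lambda>x. (v x t)\<^sup>2) (sn n)"
  proof -
    have "(LINT x:circ|lborel. v x t * deriv (deriv (cs n)) x + (v x t)\<^sup>2 * deriv (cs n) x)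
      = integral circ (\<lambda>x. - ((2 * pi * of_int n)\<^sup>2) * (v x t * cs n x)
         + (- (2 * pi * of_int n)) * ((v x t)\<^sup>2 * sn n x))"
      unfolding deriv_deriv_cs unfolding deriv_cs
      by (subst circ_LINT) (auto intro!: continuous_intros c t integral_cong)
    then show ?thesis unfolding ip_def
      by (subst (asm) integral_lin2) (auto intro!: continuous_intros c t)
  qed
  have I: "(LINT x:circ|lborel. v x s * cs n x) = ip (\<lambda>x. v x s) (cs n)" if "s \<in> {0..}" for s
    unfolding ip_def by (rule circ_LINT) (use that in \<open>auto intro!: continuous_intros c\<close>)
  show ?thesis
    using has_field_derivative_transform_within[OF D zero_less_one, of "\<lambda>s. ip (\<lambda>x. v x s) (cs n)"] t
    unfolding E by (simp only: I atLeast_iff)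
qed

lemma burgers_sn_deriv:
  assumes v: "burgers_solution u0 v" and t: "t \<ge> 0"
  shows "((\<lambda>s. ip (\<lambda>x. v x s) (sn n)) has_real_derivative
      - ((2 * pi * of_int n)\<^sup>2) * ip (\<lambda>x. v x t) (sn n)
      + (2 * pi * of_int n) * ip (\<lambda>x. (v x t)\<^sup>2) (cs n)) (at t within {0..})"
proof -
  note c = burgers_slice(2)[OF v]
  have D: "((\<lambda>s. LINT x:circ|lborel. v x s * sn n x) has_real_derivative
          (LINT x:circ|lborel. v x t * deriv (deriv (sn n)) x + (v x t)\<^sup>2 * deriv (sn n) x))
        (at t within {0..})"
    using v t test_per_sn[of n] unfolding burgers_solution_def by blast
  have E: "(LINT x:circ|lborel. v x t * deriv (deriv (sn n)) x + (v x t)\<^sup>2 * deriv (sn n) x)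
     = - ((2 * pi * of_int n)\<^sup>2) * ip (\<lambda>x. v x t) (sn n)
      + (2 * pi * of_int n) * ip (\<lambda>x. (v x t)\<^sup>2) (cs n)"
  proof -
    have "(LINT x:circ|lborel. v x t * deriv (deriv (sn n)) x + (v x t)\<^sup>2 * deriv (sn n) x)
      = integral circ (\<lambda>x. - ((2 * pi * of_int n)\<^sup>2) * (v x t * sn n x)
         + (2 * pi * of_int n) * ((v x t)\<^sup>2 * cs n x))"
      unfolding deriv_deriv_sn unfolding deriv_sn
      by (subst circ_LINT) (auto intro!: continuous_intros c t integral_cong)
    then show ?thesis unfolding ip_def
      by (subst (asm) integral_lin2) (auto intro!: continuous_intros c t)
  qed
  have I: "(LINT x:circ|lborel. v x s * sn n x) = ip (\<lambda>x. v x s) (sn n)" if "s \<in> {0..}" for s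
    unfolding ip_def by (rule circ_LINT) (use that in \<open>auto intro!: continuous_intros c\<close>)
  show ?thesis
    using has_field_derivative_transform_within[OF D zero_less_one, of "\<lambda>s. ip (\<lambda>x. v x s) (sn n)"] t
    unfolding E by (simp only: I atLeast_iff)
qed

text \<open>Whatever weak derivative \<open>SOME\<close> selects, its squared integral is
  nonnegative.\<close>

lemma nrm_le_H1_norm:
  assumes "continuous_on circ g" shows "nrm g \<le> H1_norm g"
proof -
  have "(LINT x:circ|lborel. (g x)\<^sup>2) = ip g g"
    unfolding ip_def by (subst circ_LINT) (auto intro!: continuous_intros assms simp: power2_eq_square)
  moreover have "0 \<le> (LINT x:circ|lborel. ((SOME h. weak_deriv_per g h) x)\<^sup>2)"
    unfolding set_lebesgue_integral_def by (rule Bochner_Integration.integral_nonneg) auto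
  ultimately show ?thesis unfolding nrm_def H1_norm_def by simp
qed

text \<open>Used with c = - 1 for the difference of two solutions, whose maximum over time is taken,
  and with c = 1 for the sum, whose norm must be bounded.\<close>

lemma burgers_nrm_continuous:
  assumes v: "burgers_solution u0 v" and w: "burgers_solution u1 w"
  shows "continuous_on {0..} (\<lambda>t. nrm (\<lambda>x. v x t + c * w x t))"
  unfolding continuous_on
proof
  fix t :: real assume "t \<in> {0..}"
  then have t: "t \<ge> 0" by simp
  note cv = burgers_slice(2)[OF v] and cw = burgers_slice(2)[OF w]
  have lim: "((\<lambda>s. H1_norm (\<lambda>x. v x s - v x t) + \<bar>c\<bar> * H1_norm (\<lambda>x. w x s - w x t))
     \<longlongrightarrow> 0 + \<bar>c\<bar> * 0) (at t within {0..})"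
    using v w t unfolding burgers_solution_def C_Rplus_H1_def
    by (intro tendsto_add tendsto_mult tendsto_const) auto
  have bd: "\<bar>nrm (\<lambda>x. v x s + c * w x s) - nrm (\<lambda>x. v x t + c * w x t)\<bar>
     \<le> H1_norm (\<lambda>x. v x s - v x t) + \<bar>c\<bar> * H1_norm (\<lambda>x. w x s - w x t)" if s: "s \<ge> 0" for s
  proof -
    have cont: "continuous_on circ (\<lambda>x. v x s + c * w x s)" "continuous_on circ (\<lambda>x. v x t + c * w x t)"
      "continuous_on circ (\<lambda>x. v x s - v x t)" "continuous_on circ (\<lambda>x. w x s - w x t)"
      by (intro continuous_intros cv cw s t)+
    have "\<bar>nrm (\<lambda>x. v x s + c * w x s) - nrm (\<lambda>x. v x t + c * w x t)\<bar>
      \<le> nrm (\<lambda>x. (v x s + c * w x s) - (v x t + c * w x t))"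
      by (rule nrm_reverse_triangle) (fact cont)+
    also have "(\<lambda>x. (v x s + c * w x s) - (v x t + c * w x t)) = (\<lambda>x. (v x s - v x t) + c * (w x s - w x t))"
      by (auto simp: algebra_simps)
    also have "nrm \<dots> \<le> nrm (\<lambda>x. v x s - v x t) + nrm (\<lambda>x. c * (w x s - w x t))"
      by (rule nrm_triangle) (intro continuous_intros cont)+
    also have "nrm (\<lambda>x. c * (w x s - w x t)) = \<bar>c\<bar> * nrm (\<lambda>x. w x s - w x t)"
      unfolding nrm_def ip_scale_left ip_scale_right
      by (simp add: mult.assoc[symmetric] real_sqrt_mult)
    also have "nrm (\<lambda>x. v x s - v x t) + \<bar>c\<bar> * nrm (\<lambda>x. w x s - w x t)
      \<le> H1_norm (\<lambda>x. v x s - v x t) + \<bar>c\<bar> * H1_norm (\<lambda>x. w x s - w x t)"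
      by (intro add_mono mult_left_mono nrm_le_H1_norm cont) auto
    finally show ?thesis by simp
  qed
  show "((\<lambda>t. nrm (\<lambda>x. v x t + c * w x t)) \<longlongrightarrow> nrm (\<lambda>x. v x t + c * w x t)) (at t within {0..})"
  proof (rule Lim_transform[OF tendsto_const])
    show "((\<lambda>s. nrm (\<lambda>x. v x s + c * w x s) - nrm (\<lambda>x. v x t + c * w x t)) \<longlongrightarrow> 0) (at t within {0..})"
      by (rule Lim_null_comparison[OF _ lim[simplified]])
         (use bd in \<open>auto simp: eventually_at_filter\<close>)
  qed
qed

text \<open>Half of the damping absorbs the forcing, leaving y' \<le> - \<mu>^2 y + 2 A^2 for y =
  c^2 + d^2, and Gronwall's argument gives the bound. It controls y both by 2 A^2 (t - a) and by 2
  A^2 / \<mu>^2.\<close>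

lemma damped_mode_bound:
  fixes c d Fc Fs :: "real \<Rightarrow> real"
  assumes c: "\<And>t. t \<in> {a..b} \<Longrightarrow> (c has_real_derivative - \<mu>\<^sup>2 * c t - \<mu> * Fs t) (at t within {0..})"
    and d: "\<And>t. t \<in> {a..b} \<Longrightarrow> (d has_real_derivative - \<mu>\<^sup>2 * d t + \<mu> * Fc t) (at t within {0..})"
    and F: "\<And>t. t \<in> {a..b} \<Longrightarrow> \<bar>Fc t\<bar> \<le> A" "\<And>t. t \<in> {a..b} \<Longrightarrow> \<bar>Fs t\<bar> \<le> A"
    and init: "c a = 0" "d a = 0" and "0 \<le> a" "\<mu> \<noteq> 0" and t: "t \<in> {a..b}"
  shows "(c t)\<^sup>2 + (d t)\<^sup>2 \<le> 2 * A\<^sup>2 / \<mu>\<^sup>2 * (1 - exp (- \<mu>\<^sup>2 * (t - a)))"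
proof -
  \<comment> \<open>The distance of c^2 + d^2 from the equilibrium of the comparison equation, times
    the integrating factor; it has to be nonincreasing.\<close>
  define g where "g = (\<lambda>t. ((c t)\<^sup>2 + (d t)\<^sup>2 - 2 * A\<^sup>2 / \<mu>\<^sup>2) * exp (\<mu>\<^sup>2 * (t - a)))"
  define g' where "g' = (\<lambda>t. (2 * c t * (- \<mu>\<^sup>2 * c t - \<mu> * Fs t) + 2 * d t * (- \<mu>\<^sup>2 * d t + \<mu> * Fc t)
     + \<mu>\<^sup>2 * ((c t)\<^sup>2 + (d t)\<^sup>2) - 2 * A\<^sup>2) * exp (\<mu>\<^sup>2 * (t - a)))"
  have gd: "(g has_real_derivative g' t) (at t within {0..})" if "t \<in> {a..b}" for t
    unfolding g_def
    by (rule derivative_eq_intros c d refl that)+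
       (use \<open>\<mu> \<noteq> 0\<close> in \<open>simp add: g'_def field_simps power2_eq_square\<close>)
  have g'neg: "g' t \<le> 0" if "t \<in> {a..b}" for t
  proof -
    have "(Fc t)\<^sup>2 \<le> A\<^sup>2" "(Fs t)\<^sup>2 \<le> A\<^sup>2"
      using F[OF that] by (auto simp: abs_le_square_iff[symmetric])
    moreover have "2 * c t * (- \<mu>\<^sup>2 * c t - \<mu> * Fs t) + 2 * d t * (- \<mu>\<^sup>2 * d t + \<mu> * Fc t)
     + \<mu>\<^sup>2 * ((c t)\<^sup>2 + (d t)\<^sup>2) - 2 * A\<^sup>2
     = (Fc t)\<^sup>2 + (Fs t)\<^sup>2 - 2 * A\<^sup>2 - (\<mu> * d t - Fc t)\<^sup>2 - (\<mu> * c t + Fs t)\<^sup>2"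
      by (simp add: power2_eq_square algebra_simps)
    moreover have "(\<mu> * d t - Fc t)\<^sup>2 \<ge> 0" "(\<mu> * c t + Fs t)\<^sup>2 \<ge> 0" by auto
    ultimately have "2 * c t * (- \<mu>\<^sup>2 * c t - \<mu> * Fs t) + 2 * d t * (- \<mu>\<^sup>2 * d t + \<mu> * Fc t)
     + \<mu>\<^sup>2 * ((c t)\<^sup>2 + (d t)\<^sup>2) - 2 * A\<^sup>2 \<le> 0" by linarith
    then show ?thesis unfolding g'_def by (rule mult_nonpos_nonneg) simp
  qed
  have "g t \<le> g a"
  proof (rule DERIV_nonpos_imp_decreasing_open[of a t g])
    show "a \<le> t" using t by simp
    show "\<exists>y. (g has_real_derivative y) (at x) \<and> y \<le> 0" if "a < x" "x < t" for x
    proof -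
      have "at x within {0..} = at x"
        using that \<open>0 \<le> a\<close> by (intro at_within_interior) simp
      then show ?thesis using gd[of x] g'neg[of x] that t by auto
    qed
    show "continuous_on {a..t} g"
      by (rule DERIV_continuous_on[where D=g'], rule DERIV_subset[OF gd]) (use t \<open>0 \<le> a\<close> in auto)
  qed
  then have "((c t)\<^sup>2 + (d t)\<^sup>2 - 2 * A\<^sup>2 / \<mu>\<^sup>2) * exp (\<mu>\<^sup>2 * (t - a)) \<le> - (2 * A\<^sup>2 / \<mu>\<^sup>2)"
    by (simp add: g_def init)
  then have "((c t)\<^sup>2 + (d t)\<^sup>2 - 2 * A\<^sup>2 / \<mu>\<^sup>2) * exp (\<mu>\<^sup>2 * (t - a)) * exp (- \<mu>\<^sup>2 * (t - a))
     \<le> - (2 * A\<^sup>2 / \<mu>\<^sup>2) * exp (- \<mu>\<^sup>2 * (t - a))"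
    by (rule mult_right_mono) simp
  then have "(c t)\<^sup>2 + (d t)\<^sup>2 - 2 * A\<^sup>2 / \<mu>\<^sup>2 \<le> - (2 * A\<^sup>2 / \<mu>\<^sup>2) * exp (- \<mu>\<^sup>2 * (t - a))"
    by (simp add: mult.assoc exp_add[symmetric])
  then show ?thesis by (simp add: algebra_simps)
qed

text \<open>The first K terms add up to at most 1/K, and the tail is compared with the telescoping
  sum of 1/(n-1) - 1/n, which contributes at most another 1/K.\<close>

lemma sum_min_inverse_squares:
  fixes K :: nat assumes "K \<ge> 1"
  shows "(\<Sum>n=1..N. min (1 / (real K)\<^sup>2) (1 / (real n)\<^sup>2)) \<le> 2 / real K"
proof -
  \<comment> \<open>A form strong enough for induction: the unspent part - 1/N of the telescoping
    sum is kept.\<close>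
  have "(\<Sum>n=1..N. min (1 / (real K)\<^sup>2) (1 / (real n)\<^sup>2))
     \<le> (if N \<le> K then real N / (real K)\<^sup>2 else 2 / real K - 1 / real N)"
  proof (induction N)
    case (Suc N)
    show ?case
    proof (cases "Suc N \<le> K")
      case True
      then show ?thesis using Suc by (simp add: add_divide_distrib min.coboundedI1)
    next
      case False
      then have N: "N \<ge> K" "N \<ge> 1" using assms by auto
      have step: "1 / (real (Suc N))\<^sup>2 \<le> 1 / real N - 1 / real (Suc N)"
      proof -
        have "1 / (real (Suc N))\<^sup>2 \<le> 1 / (real N * real (Suc N))"
          using N by (intro divide_left_mono) (auto simp: power2_eq_square intro!: mult_mono)
        also have "\<dots> = 1 / real N - 1 / real (Suc N)"
          using N by (simp add: field_simps)
        finally show ?thesis .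
      qed
      have "(\<Sum>n=1..N. min (1 / (real K)\<^sup>2) (1 / (real n)\<^sup>2)) \<le> 2 / real K - 1 / real N"
      proof (cases "N = K")
        case True
        then show ?thesis using Suc assms by (simp add: power2_eq_square)
      qed (use Suc N in auto)
      moreover have "min (1 / (real K)\<^sup>2) (1 / (real (Suc N))\<^sup>2) \<le> 1 / (real (Suc N))\<^sup>2" by simp
      ultimately show ?thesis using step False by simp
    qed
  qed simp
  also have "\<dots> \<le> 2 / real K"
  proof (cases "N \<le> K")
    case True
    then have "real N / (real K)\<^sup>2 \<le> real K / (real K)\<^sup>2" by (intro divide_right_mono) auto
    then show ?thesis using True assms by (simp add: power2_eq_square field_simps)
  qed simp
  finally show ?thesis .
qed

text \<open>For n = 0 the mode equation has right-hand side 0, so the mean is conserved. This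
  supplies the missing constant mode in the Fourier estimate.\<close>

lemma burgers_mean_zero:
  assumes v: "burgers_solution u0 v" and w: "burgers_solution u0 w" and t: "t \<ge> 0"
  shows "ip (\<lambda>x. v x t - w x t) (cs 0) = 0"
proof -
  have eq: "ip (\<lambda>x. v x s - w x s) (cs 0) = ip (\<lambda>x. v x s) (cs 0) - ip (\<lambda>x. w x s) (cs 0)" if "s \<ge> 0" for s
    using that by (intro ip_diff_left burgers_slice(2)[OF v] burgers_slice(2)[OF w]) auto
  have d: "((\<lambda>s. ip (\<lambda>x. v x s) (cs 0) - ip (\<lambda>x. w x s) (cs 0)) has_real_derivative 0) (at s within {0..})"
    if "s \<in> {0..}" for s
    using DERIV_diff[OF burgers_cs_deriv[OF v, of s 0] burgers_cs_deriv[OF w, of s 0]] that by simp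
  obtain k where k: "\<And>s. s \<in> {0..} \<Longrightarrow> ip (\<lambda>x. v x s) (cs 0) - ip (\<lambda>x. w x s) (cs 0) = k"
    using has_field_derivative_zero_constant[OF _ d] by (metis convex_real_interval(1))
  have "ip (\<lambda>x. v x 0 - w x 0) (cs 0) = 0"
    unfolding ip_def
    by (intro integral_unique has_integral_is_0) (use v w in \<open>simp add: burgers_solution_def\<close>)
  then show ?thesis using k[of t] k[of 0] eq[of t] eq[of 0] t by simp
qed

text \<open>Estimating the nonlinearity by \<open>\<bar>\<langle>v\<^sup>2 - w\<^sup>2, cos\<rangle>\<bar> \<le> \<parallel>v - w\<parallel> \<parallel>v + w\<parallel>\<close> only needs a bound in
  \<open>L\<^sup>2\<close>; summing the modes gains the factor \<open>2 / K\<close> on a time step of length \<open>1 / K\<^sup>2\<close>.\<close>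

lemma burgers_unique_step:
  assumes v: "burgers_solution u0 v" and w: "burgers_solution u0 w"
    and a: "a \<ge> 0" "\<And>x. x \<in> circ \<Longrightarrow> v x a = w x a"
    and K: "K \<ge> 1" "16 * M\<^sup>2 \<le> real K"
    and M: "\<And>t. t \<in> {a..a + 1 / (real K)\<^sup>2} \<Longrightarrow> nrm (\<lambda>x. v x t + w x t) \<le> M"
    and t: "t \<in> {a..a + 1 / (real K)\<^sup>2}" and x: "x \<in> circ"
  shows "v x t = w x t"
proof -
  define I where "I = {a..a + 1 / (real K)\<^sup>2}"
  define z where "z = (\<lambda>t x. v x t - w x t)"
  have I0: "s \<ge> 0" if "s \<in> I" for s using that a by (simp add: I_def)
  note cv = burgers_slice(2)[OF v] and cw = burgers_slice(2)[OF w]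
  have cz: "continuous_on circ (z s)" if "s \<in> I" for s
    unfolding z_def using I0[OF that] by (intro continuous_intros cv cw)
  have "continuous_on I (\<lambda>t. nrm (z t))"
    by (rule continuous_on_subset[where s="{0..}"])
       (use burgers_nrm_continuous[OF v w, of "- 1"] I0 in \<open>auto simp: z_def\<close>)
  moreover have "compact I" "I \<noteq> {}" unfolding I_def by auto
  \<comment> \<open>All forcing on \<open>I\<close> is bounded through the largest norm
    \<open>R\<close>, so the estimate at the maximising time \<open>m\<close> bounds
    \<open>R\<close> by itself.\<close>
  ultimately obtain m where m: "m \<in> I" "\<And>s. s \<in> I \<Longrightarrow> nrm (z s) \<le> nrm (z m)"
    using continuous_attains_sup[of I "\<lambda>t. nrm (z t)"] by blast
  define R where "R = nrm (z m)"
  have R0: "R \<ge> 0" by (simp add: R_def nrm_nonneg)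
  have M0: "M \<ge> 0" using M[of t] t nrm_nonneg order_trans by blast
  have zip: "ip (z s) g = ip (\<lambda>x. v x s) g - ip (\<lambda>x. w x s) g" if "s \<in> I" "continuous_on circ g" for s g
    unfolding z_def using that I0 by (intro ip_diff_left cv cw) auto
  have F: "\<bar>ip (\<lambda>x. (v x s)\<^sup>2) g - ip (\<lambda>x. (w x s)\<^sup>2) g\<bar> \<le> M * R"
    if s: "s \<in> I" and g: "continuous_on circ g" "\<And>x. \<bar>g x\<bar> \<le> 1" for s g
  proof -
    have cvw: "continuous_on circ (\<lambda>x. v x s + w x s)" using I0[OF s] by (intro continuous_intros cv cw)
    have "ip (\<lambda>x. (v x s)\<^sup>2) g - ip (\<lambda>x. (w x s)\<^sup>2) g = ip (\<lambda>x. (v x s)\<^sup>2 - (w x s)\<^sup>2) g"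
      using I0[OF s] by (intro ip_diff_left[symmetric] continuous_intros cv cw g)
    also have "\<dots> = ip (z s) (\<lambda>x. (v x s + w x s) * g x)"
      unfolding ip_def z_def by (rule integral_cong) (simp add: power2_eq_square algebra_simps)
    finally have "\<bar>ip (\<lambda>x. (v x s)\<^sup>2) g - ip (\<lambda>x. (w x s)\<^sup>2) g\<bar> \<le> nrm (z s) * nrm (\<lambda>x. (v x s + w x s) * g x)"
      using ip_le_nrm[OF cz[OF s] continuous_on_mult[OF cvw g(1)]] by simp
    also have "\<dots> \<le> R * (1 * M)"
    proof (rule mult_mono)
      have "nrm (\<lambda>x. (v x s + w x s) * g x) \<le> 1 * nrm (\<lambda>x. v x s + w x s)"
        by (rule nrm_mult_le[OF cvw g(1)]) (use g in auto)
      then show "nrm (\<lambda>x. (v x s + w x s) * g x) \<le> 1 * M" using M[of s] s by (simp add: I_def)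
      show "nrm (z s) \<le> R" using m(2)[OF s] by (simp add: R_def)
    qed (auto simp: nrm_nonneg R0)
    finally show ?thesis by (simp add: mult.commute)
  qed
  have mode: "(ip (z s) (cs (int n)))\<^sup>2 + (ip (z s) (sn (int n)))\<^sup>2
      \<le> 2 * (M * R)\<^sup>2 * min (1 / (real K)\<^sup>2) (1 / (real n)\<^sup>2)" if s: "s \<in> I" and n: "n \<ge> 1" for s n
  proof -
    define L where "L = 2 * pi * real n"
    have "real n \<le> L" using n pi_gt3 unfolding L_def by (simp add: mult_le_cancel_right1)
    then have L: "L > 0" "real n \<le> L" using n by auto
    have za: "ip (z a) g = 0" for g
      unfolding ip_def using a(2) by (intro integral_unique has_integral_is_0) (auto simp: z_def)
    have aI: "a \<in> I" by (simp add: I_def)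
    have "(ip (\<lambda>x. v x s) (cs (int n)) - ip (\<lambda>x. w x s) (cs (int n)))\<^sup>2
        + (ip (\<lambda>x. v x s) (sn (int n)) - ip (\<lambda>x. w x s) (sn (int n)))\<^sup>2
        \<le> 2 * (M * R)\<^sup>2 / L\<^sup>2 * (1 - exp (- L\<^sup>2 * (s - a)))"
    proof (rule damped_mode_bound[where b="a + 1 / (real K)\<^sup>2" and
          Fs = "\<lambda>s. ip (\<lambda>x. (v x s)\<^sup>2) (sn (int n)) - ip (\<lambda>x. (w x s)\<^sup>2) (sn (int n))" and
          Fc = "\<lambda>s. ip (\<lambda>x. (v x s)\<^sup>2) (cs (int n)) - ip (\<lambda>x. (w x s)\<^sup>2) (cs (int n))"])
      fix r assume "r \<in> {a..a + 1 / (real K)\<^sup>2}"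
      then have r: "r \<in> I" by (simp add: I_def)
      show "((\<lambda>s. ip (\<lambda>x. v x s) (cs (int n)) - ip (\<lambda>x. w x s) (cs (int n))) has_real_derivative
        - L\<^sup>2 * (ip (\<lambda>x. v x r) (cs (int n)) - ip (\<lambda>x. w x r) (cs (int n))) -
        L * (ip (\<lambda>x. (v x r)\<^sup>2) (sn (int n)) - ip (\<lambda>x. (w x r)\<^sup>2) (sn (int n)))) (at r within {0..})"
        by (rule DERIV_cong[OF DERIV_diff[OF burgers_cs_deriv[OF v I0[OF r]] burgers_cs_deriv[OF w I0[OF r]]]])
           (simp add: L_def algebra_simps)
      show "((\<lambda>s. ip (\<lambda>x. v x s) (sn (int n)) - ip (\<lambda>x. w x s) (sn (int n))) has_real_derivative
        - L\<^sup>2 * (ip (\<lambda>x. v x r) (sn (int n)) - ip (\<lambda>x. w x r) (sn (int n))) +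
        L * (ip (\<lambda>x. (v x r)\<^sup>2) (cs (int n)) - ip (\<lambda>x. (w x r)\<^sup>2) (cs (int n)))) (at r within {0..})"
        by (rule DERIV_cong[OF DERIV_diff[OF burgers_sn_deriv[OF v I0[OF r]] burgers_sn_deriv[OF w I0[OF r]]]])
           (simp add: L_def algebra_simps)
      show "\<bar>ip (\<lambda>x. (v x r)\<^sup>2) (cs (int n)) - ip (\<lambda>x. (w x r)\<^sup>2) (cs (int n))\<bar> \<le> M * R"
        "\<bar>ip (\<lambda>x. (v x r)\<^sup>2) (sn (int n)) - ip (\<lambda>x. (w x r)\<^sup>2) (sn (int n))\<bar> \<le> M * R"
        by (rule F[OF r]; simp add: cs_abs_le sn_abs_le)+
    qed (use s L a za zip[OF aI] in \<open>auto simp: I_def\<close>)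
    also have "\<dots> = 2 * (M * R)\<^sup>2 * ((1 - exp (- L\<^sup>2 * (s - a))) / L\<^sup>2)" by simp
    also have "\<dots> \<le> 2 * (M * R)\<^sup>2 * min (1 / (real K)\<^sup>2) (1 / (real n)\<^sup>2)"
    proof (intro mult_left_mono min.boundedI)
      \<comment> \<open>Low modes profit from the short time, by 1 - exp (- y) \<le> y, and high
        modes from the damping, by 1 - exp (- y) \<le> 1; the two final bounds cross at n =
        K.\<close>
      have "1 - exp (- L\<^sup>2 * (s - a)) \<le> L\<^sup>2 * (s - a)"
        using exp_ge_add_one_self[of "- L\<^sup>2 * (s - a)"] by simp
      also have "\<dots> \<le> L\<^sup>2 * (1 / (real K)\<^sup>2)"
        using s by (intro mult_left_mono) (auto simp: I_def)
      finally show "(1 - exp (- L\<^sup>2 * (s - a))) / L\<^sup>2 \<le> 1 / (real K)\<^sup>2"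
        using L by (simp add: field_simps)
      have "(1 - exp (- L\<^sup>2 * (s - a))) / L\<^sup>2 \<le> 1 / L\<^sup>2"
        using L by (intro divide_right_mono) auto
      also have "\<dots> \<le> 1 / (real n)\<^sup>2"
        using L n by (intro divide_left_mono power_mono mult_pos_pos) auto
      finally show "(1 - exp (- L\<^sup>2 * (s - a))) / L\<^sup>2 \<le> 1 / (real n)\<^sup>2" .
    qed auto
    finally show ?thesis using zip[OF s] by simp
  qed
  have "ip (z m) (z m) \<le> 2 * (2 * (M * R)\<^sup>2 * (2 / real K))"
  proof (rule fourier_coefficients_bound)
    show "continuous_on circ (z m)" by (rule cz[OF m(1)])
    show "z m (- (1/2)) = z m (1/2)"
      using periodic1_ends[OF burgers_slice(1)[OF v I0[OF m(1)]]] periodic1_ends[OF burgers_slice(1)[OF w I0[OF m(1)]]]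
      by (simp add: z_def)
    show "ip (z m) (cs 0) = 0" using burgers_mean_zero[OF v w I0[OF m(1)]] by (simp add: z_def)
    fix N
    have "(\<Sum>n = 1..N. (ip (z m) (cs (int n)))\<^sup>2 + (ip (z m) (sn (int n)))\<^sup>2)
      \<le> (\<Sum>n = 1..N. 2 * (M * R)\<^sup>2 * min (1 / (real K)\<^sup>2) (1 / (real n)\<^sup>2))"
      by (rule sum_mono) (use mode[OF m(1)] in auto)
    also have "\<dots> = 2 * (M * R)\<^sup>2 * (\<Sum>n = 1..N. min (1 / (real K)\<^sup>2) (1 / (real n)\<^sup>2))"
      by (rule sum_distrib_left[symmetric])
    also have "\<dots> \<le> 2 * (M * R)\<^sup>2 * (2 / real K)"
      by (rule mult_left_mono[OF sum_min_inverse_squares[OF K(1)]]) simp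
    finally show "(\<Sum>n = 1..N. (ip (z m) (cs (int n)))\<^sup>2 + (ip (z m) (sn (int n)))\<^sup>2)
      \<le> 2 * (M * R)\<^sup>2 * (2 / real K)" .
  qed
  \<comment> \<open>Because 16 M^2 \<le> K, the right-hand side is at most R^2 / 2, which forces R =
    0.\<close>
  then have "R\<^sup>2 \<le> 8 * M\<^sup>2 * R\<^sup>2 / real K" by (simp add: R_def nrm_power2 power_mult_distrib)
  then have "R\<^sup>2 * real K \<le> 8 * M\<^sup>2 * R\<^sup>2" using K by (simp add: field_simps)
  moreover have "16 * M\<^sup>2 * R\<^sup>2 \<le> real K * R\<^sup>2" using K(2) by (rule mult_right_mono) simp
  ultimately have "R\<^sup>2 * real K \<le> 0" by (simp add: algebra_simps)
  then have "R = 0" using K(1) by (simp add: mult_le_0_iff)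
  then have "nrm (z t) = 0" using m(2)[of t] t nrm_nonneg[of "z t"] by (simp add: R_def I_def)
  then have "ip (z t) (z t) = 0" using nrm_power2[of "z t"] by simp
  then show ?thesis using ip_self_zero_imp[OF cz _ x, of t] t by (simp add: z_def I_def)
qed

text \<open>Only a bound on v + w limits the step length, and this norm is bounded on the compact
  interval up to t + 1, so finitely many steps of one fixed length reach t. The extra 1 leaves room
  for the last step to overshoot.\<close>

theorem burgers_solution_unique:
  assumes v: "burgers_solution u0 v" and w: "burgers_solution u0 w" and "t \<ge> 0"
  shows "v x t = w x t"
proof -
  have "compact {0..t + 1}" by simp
  moreover have "continuous_on {0..t + 1} (\<lambda>t. nrm (\<lambda>x. v x t + w x t))"
    using continuous_on_subset[OF burgers_nrm_continuous[OF v w, of 1], of "{0..t+1}"] by auto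
  moreover have "{0..t + 1} \<noteq> {}" using \<open>t \<ge> 0\<close> by simp
  ultimately obtain m where "\<forall>s\<in>{0..t + 1}. nrm (\<lambda>x. v x s + w x s) \<le> nrm (\<lambda>x. v x m + w x m)"
    using continuous_attains_sup by blast
  then obtain M where M: "\<And>s. s \<in> {0..t + 1} \<Longrightarrow> nrm (\<lambda>x. v x s + w x s) \<le> M" by blast
  \<comment> \<open>The \<open>+ 1\<close> keeps K positive even if M = 0.\<close>
  define K where "K = nat \<lceil>16 * M\<^sup>2\<rceil> + 1"
  have K: "K \<ge> 1" "16 * M\<^sup>2 \<le> real K" unfolding K_def by (simp, linarith)
  define h where "h = 1 / (real K)\<^sup>2"
  have h: "h > 0" "h \<le> 1" using K(1) unfolding h_def by (auto simp: field_simps one_le_power)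
  have step: "\<forall>s y. 0 \<le> s \<longrightarrow> s \<le> t \<longrightarrow> s \<le> real m * h \<longrightarrow> y \<in> circ \<longrightarrow> v y s = w y s" for m
  proof (induction m)
    case 0
    show ?case using v w by (auto simp: burgers_solution_def)
  next
    case (Suc m)
    show ?case
    proof (intro allI impI)
      fix s y assume s: "0 \<le> s" "s \<le> t" "s \<le> real (Suc m) * h" and y: "y \<in> circ"
      show "v y s = w y s"
      proof (cases "s \<le> real m * h")
        case True
        then show ?thesis using Suc s y by blast
      next
        case False
        have mh: "0 \<le> real m * h" "real m * h \<le> t" using h False s by auto
        show ?thesis
        proof (rule burgers_unique_step[OF v w, of "real m * h" K M])
          show "v x (real m * h) = w x (real m * h)" if "x \<in> circ" for x
            using Suc mh that by blast
          show "nrm (\<lambda>x. v x r + w x r) \<le> M" if "r \<in> {real m * h..real m * h + 1 / (real K)\<^sup>2}" for r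
          proof (rule M)
            have r: "real m * h \<le> r" "r \<le> real m * h + h" using that by (simp_all add: h_def)
            have "0 \<le> r" by (rule order_trans[OF mh(1) r(1)])
            moreover have "r \<le> t + 1" using r(2) mh(2) h(2) by linarith
            ultimately show "r \<in> {0..t + 1}" by (rule atLeastAtMost_iff[THEN iffD2, OF conjI])
          qed
          show "s \<in> {real m * h..real m * h + 1 / (real K)\<^sup>2}"
            using False s by (auto simp: h_def[symmetric] algebra_simps)
        qed (use mh K y in auto)
      qed
    qed
  qed
  obtain m where "t < real m * h" using reals_Archimedean3[OF h(1)] by blast
  then have circ: "v y t = w y t" if "y \<in> circ" for y
    using step[of m] \<open>t \<ge> 0\<close> that by auto
  obtain y where "y \<in> circ" "v x t = v y t" "\<And>g. periodic1 g \<Longrightarrow> g x = g y"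
    using periodic1_reduce[OF burgers_slice(1)[OF v \<open>t \<ge> 0\<close>], of x] by metis
  then show ?thesis using circ[of y] burgers_slice(1)[OF w \<open>t \<ge> 0\<close>] by metis
qed

subsection \<open>Uniqueness of weak derivatives\<close>

text \<open>Integrands on the circle are carried as functions on the line vanishing outside
  \<open>circ\<close>, so only the bounded values of \<open>\<phi>\<close> on \<open>circ\<close>
  matter.\<close>

lemma integrable_mult_continuous_on_circ:
  fixes d \<phi> :: "real \<Rightarrow> real"
  assumes d: "integrable lborel d" "\<And>x. x \<notin> circ \<Longrightarrow> d x = 0" and \<phi>: "continuous_on circ \<phi>"
  shows "integrable lborel (\<lambda>x. d x * \<phi> x)"
proof -
  have eq: "(\<lambda>x. d x * \<phi> x) = (\<lambda>x. d x * (indicator circ x *\<^sub>R \<phi> x))"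
  proof
    fix x show "d x * \<phi> x = d x * (indicator circ x *\<^sub>R \<phi> x)"
      by (cases "x \<in> circ") (simp_all add: d(2))
  qed
  have "bounded (\<phi> ` circ)"
    by (intro compact_imp_bounded compact_continuous_image \<phi> circ_facts)
  then obtain B where B: "\<And>x. x \<in> circ \<Longrightarrow> \<bar>\<phi> x\<bar> \<le> B" by (auto simp: bounded_iff)
  have "(\<lambda>x. indicator circ x *\<^sub>R \<phi> x) \<in> borel_measurable lborel"
    using continuous_on_circ_set_integrable[OF \<phi>] unfolding set_integrable_def by (rule borel_measurable_integrable)
  then have m: "(\<lambda>x. d x * \<phi> x) \<in> borel_measurable lborel"
    unfolding eq by (intro borel_measurable_times borel_measurable_integrable[OF d(1)])
  show ?thesis
  proof (rule Bochner_Integration.integrable_bound[OF _ m])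
    show "integrable lborel (\<lambda>x. \<bar>B\<bar> * d x)" using d(1) by simp
    show "AE x in lborel. norm (d x * \<phi> x) \<le> norm (\<bar>B\<bar> * d x)"
    proof (rule AE_I2)
      fix x show "norm (d x * \<phi> x) \<le> norm (\<bar>B\<bar> * d x)"
      proof (cases "x \<in> circ")
        case True
        then have "\<bar>\<phi> x\<bar> \<le> \<bar>B\<bar>" using B by fastforce
        then have "\<bar>d x\<bar> * \<bar>\<phi> x\<bar> \<le> \<bar>d x\<bar> * \<bar>B\<bar>" by (rule mult_left_mono) simp
        then show ?thesis by (simp add: abs_mult mult.commute)
      qed (simp add: d(2))
    qed
  qed
qed

text \<open>Replacing \<open>\<phi>\<close> by a uniformly close trigonometric polynomial changes
  the integral by at most the error times the L^1 norm \<open>J\<close> of d.\<close>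

lemma orthogonal_trig_imp_continuous:
  fixes d \<phi> :: "real \<Rightarrow> real"
  assumes d: "integrable lborel d" "\<And>x. x \<notin> circ \<Longrightarrow> d x = 0"
    and orth: "\<And>p. trig p \<Longrightarrow> (LINT x|lborel. d x * p x) = 0"
    and \<phi>: "continuous_on circ \<phi>" "\<phi> (- (1/2)) = \<phi> (1/2)"
  shows "(LINT x|lborel. d x * \<phi> x) = 0"
proof (rule ccontr)
  define J where "J = (LINT x|lborel. \<bar>d x\<bar>)"
  have J: "J \<ge> 0" unfolding J_def by (rule Bochner_Integration.integral_nonneg) simp
  assume "(LINT x|lborel. d x * \<phi> x) \<noteq> 0"
  then have pos: "\<bar>LINT x|lborel. d x * \<phi> x\<bar> > 0" by simp
  \<comment> \<open>Small enough that e * J stays below the value assumed to be nonzero;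
    \<open>J + 1\<close> avoids a division by 0.\<close>
  define e where "e = \<bar>LINT x|lborel. d x * \<phi> x\<bar> / (2 * (J + 1))"
  have e: "e > 0" using pos J by (simp add: e_def)
  obtain p where p: "trig p" "\<And>x. x \<in> circ \<Longrightarrow> \<bar>\<phi> x - p x\<bar> < e"
    using trig_dense[OF \<phi> e] by metis
  note i = integrable_mult_continuous_on_circ[OF d \<phi>(1)] integrable_mult_continuous_on_circ[OF d trig_continuous[OF p(1)]]
  have "(LINT x|lborel. d x * \<phi> x) = (LINT x|lborel. d x * \<phi> x - d x * p x)"
    using i orth[OF p(1)] by simp
  also have "\<bar>\<dots>\<bar> \<le> (LINT x|lborel. e * \<bar>d x\<bar>)"
  proof (rule order_trans[OF integral_abs_bound integral_mono])
    show "integrable lborel (\<lambda>x. \<bar>d x * \<phi> x - d x * p x\<bar>)" using i by auto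
    show "integrable lborel (\<lambda>x. e * \<bar>d x\<bar>)" using d(1) by auto
    fix x show "\<bar>d x * \<phi> x - d x * p x\<bar> \<le> e * \<bar>d x\<bar>"
    proof (cases "x \<in> circ")
      case True
      have "\<bar>d x\<bar> * \<bar>\<phi> x - p x\<bar> \<le> \<bar>d x\<bar> * e"
        using p(2)[OF True] by (intro mult_left_mono) auto
      then show ?thesis by (simp add: abs_mult[symmetric] right_diff_distrib mult.commute)
    qed (simp add: d(2))
  qed
  also have "\<dots> = e * J" by (simp add: J_def)
  also have "\<dots> < \<bar>LINT x|lborel. d x * \<phi> x\<bar>"
  proof -
    have "\<bar>LINT x|lborel. d x * \<phi> x\<bar> = e * (2 * (J + 1))" using J by (simp add: e_def)
    moreover have "e * J < e * (2 * (J + 1))" using e J by simp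
    ultimately show ?thesis by simp
  qed
  finally show False by simp
qed

text \<open>The indicator is the pointwise limit of continuous trapezoidal functions. They vanish
  outside the open interval, hence at both ends of \<open>circ\<close>, and so have the equal end
  values that the approximation requires.\<close>

lemma orthogonal_trig_imp_interval:
  fixes d :: "real \<Rightarrow> real"
  assumes d: "integrable lborel d" "\<And>x. x \<notin> circ \<Longrightarrow> d x = 0"
    and orth: "\<And>p. trig p \<Longrightarrow> (LINT x|lborel. d x * p x) = 0"
    and ab: "a \<in> circ" "b \<in> circ"
  shows "(LINT x|lborel. d x * indicator {a<..<b} x) = 0"
proof -
  define \<phi> where "\<phi> = (\<lambda>m::nat. \<lambda>x::real. max 0 (min 1 (real m * min (x - a) (b - x))))"
  have dm: "d \<in> borel_measurable lborel" using d(1) by (rule borel_measurable_integrable)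
  have \<phi>_out: "\<phi> m x = 0" if "x \<notin> {a<..<b}" for m x
  proof -
    have "min (x - a) (b - x) \<le> 0" using that by auto
    then have "real m * min (x - a) (b - x) \<le> 0" by (simp add: mult_nonneg_nonpos)
    then show ?thesis unfolding \<phi>_def by simp
  qed
  have cont: "continuous_on S (\<phi> m)" for S m
    unfolding \<phi>_def by (intro continuous_intros)
  have lim: "(\<lambda>m. \<phi> m x) \<longlonglongrightarrow> indicator {a<..<b} x" for x
  proof (cases "x \<in> {a<..<b}")
    case True
    then have c: "min (x - a) (b - x) > 0" by auto
    obtain m0 :: nat where m0: "1 < real m0 * min (x - a) (b - x)" using reals_Archimedean3[OF c] by blast
    have "\<phi> m x = 1" if "m \<ge> m0" for m
    proof -
      have "real m0 * min (x - a) (b - x) \<le> real m * min (x - a) (b - x)"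
        by (rule mult_right_mono) (use that c in auto)
      then have "1 < real m * min (x - a) (b - x)" using m0 by linarith
      then show ?thesis by (simp add: \<phi>_def)
    qed
    then have "eventually (\<lambda>m. \<phi> m x = 1) sequentially" by (auto simp: eventually_sequentially)
    then show ?thesis using True by (simp add: tendsto_eventually)
  qed (simp add: \<phi>_out)
  have zero: "(LINT x|lborel. d x * \<phi> m x) = 0" for m
  proof (rule orthogonal_trig_imp_continuous[OF d orth cont])
    show "\<phi> m (- (1/2)) = \<phi> m (1/2)" using ab \<phi>_out by (simp add: circ_def)
  qed
  have "(\<lambda>m. LINT x|lborel. d x * \<phi> m x) \<longlonglongrightarrow> (LINT x|lborel. d x * indicator {a<..<b} x)"
  proof (rule integral_dominated_convergence[where w="\<lambda>x. \<bar>d x\<bar>"])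
    show "(\<lambda>x. d x * \<phi> m x) \<in> borel_measurable lborel" for m
      using dm borel_measurable_continuous_onI[OF cont[of UNIV m]] by auto
    show "AE x in lborel. norm (d x * \<phi> m x) \<le> \<bar>d x\<bar>" for m
    proof (rule AE_I2)
      fix x
      have "\<bar>\<phi> m x\<bar> \<le> 1" by (auto simp: \<phi>_def)
      then show "norm (d x * \<phi> m x) \<le> \<bar>d x\<bar>" by (simp add: abs_mult mult_left_le)
    qed
  qed (use dm d(1) lim in \<open>auto intro!: tendsto_mult\<close>)
  then show ?thesis using zero by (simp add: LIMSEQ_const_iff)
qed

text \<open>The positive and the negative part of d, read as densities, define finite measures that
  agree on all half-lines and hence are equal. Then the densities agree almost everywhere, which is
  possible only where d = 0.\<close>

lemma orthogonal_trig_imp_AE_zero: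
  fixes d :: "real \<Rightarrow> real"
  assumes d: "integrable lborel d" "\<And>x. x \<notin> circ \<Longrightarrow> d x = 0"
    and orth: "\<And>p. trig p \<Longrightarrow> (LINT x|lborel. d x * p x) = 0"
  shows "AE x in lborel. d x = 0"
proof -
  have dm [measurable]: "d \<in> borel_measurable lborel" using d(1) by (rule borel_measurable_integrable)
  have half: "(LINT x|lborel. d x * indicator {y<..} x) = 0" for y
  proof (cases "y < 1/2")
    case False
    have "(\<lambda>x. d x * indicator {y<..} x) = (\<lambda>x. 0)"
    proof
      fix x show "d x * indicator {y<..} x = 0"
        using d(2)[of x] False by (auto simp: circ_def indicator_def)
    qed
    then show ?thesis by simp
  next
    case True
    define a where "a = max y (- (1/2))"
    \<comment> \<open>The open interval used below misses the end points of \<open>circ\<close>,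
      which form a null set.\<close>
    have "AE x in lborel. x \<noteq> (1/2) \<and> x \<noteq> - (1/2)"
      using AE_lborel_singleton[of "1/2"] AE_lborel_singleton[of "- (1/2)"] by eventually_elim auto
    then have "AE x in lborel. d x * indicator {y<..} x = d x * indicator {a<..<1/2} x"
    proof eventually_elim
      case (elim x)
      then show ?case using d(2)[of x] by (auto simp: circ_def indicator_def a_def)
    qed
    then have "(LINT x|lborel. d x * indicator {y<..} x) = (LINT x|lborel. d x * indicator {a<..<1/2} x)"
      by (intro integral_cong_AE) auto
    also have "\<dots> = 0"
      by (rule orthogonal_trig_imp_interval[OF d orth]) (use True in \<open>auto simp: a_def circ_def\<close>)
    finally show ?thesis .
  qed
  let ?p = "\<lambda>x. max 0 (d x)" and ?m = "\<lambda>x. max 0 (- d x)"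
  have ip: "integrable lborel ?p" and im: "integrable lborel ?m" using d(1) by auto
  have em: "emeasure (density lborel (\<lambda>x. ennreal (g x))) {y<..} = ennreal (LINT x|lborel. g x * indicator {y<..} x)"
    if "integrable lborel g" "\<And>x. g x \<ge> 0" for g :: "real \<Rightarrow> real" and y
  proof -
    have [measurable]: "g \<in> borel_measurable lborel" using that(1) by (rule borel_measurable_integrable)
    have "emeasure (density lborel (\<lambda>x. ennreal (g x))) {y<..} = (\<integral>\<^sup>+x. ennreal (g x) * indicator {y<..} x \<partial>lborel)"
      by (rule emeasure_density) auto
    also have "\<dots> = (\<integral>\<^sup>+x. ennreal (g x * indicator {y<..} x) \<partial>lborel)"
      by (rule nn_integral_cong) (auto simp: indicator_def)
    also have "\<dots> = ennreal (LINT x|lborel. g x * indicator {y<..} x)"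
      by (rule nn_integral_eq_integral) (use that in \<open>auto intro!: integrable_real_mult_indicator\<close>)
    finally show ?thesis .
  qed
  have "density lborel (\<lambda>x. ennreal (?p x)) = density lborel (\<lambda>x. ennreal (?m x))"
  proof (rule measure_eqI_lessThan)
    fix y
    show "emeasure (density lborel (\<lambda>x. ennreal (?p x))) {y<..} < \<infinity>"
      unfolding em[OF ip max.cobounded1] by simp
    have "(LINT x|lborel. ?p x * indicator {y<..} x) - (LINT x|lborel. ?m x * indicator {y<..} x)
      = (LINT x|lborel. ?p x * indicator {y<..} x - ?m x * indicator {y<..} x)"
      using ip im by (intro Bochner_Integration.integral_diff[symmetric] integrable_real_mult_indicator) auto
    also have "\<dots> = (LINT x|lborel. d x * indicator {y<..} x)"
      by (rule Bochner_Integration.integral_cong) (auto simp: max_def indicator_def)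
    finally show "emeasure (density lborel (\<lambda>x. ennreal (?p x))) {y<..}
        = emeasure (density lborel (\<lambda>x. ennreal (?m x))) {y<..}"
      unfolding em[OF ip max.cobounded1] em[OF im max.cobounded1] using half[of y] by simp
  qed simp_all
  then have "AE x in lborel. ennreal (?p x) = ennreal (?m x)"
    by (subst (asm) sigma_finite_measure.density_unique_iff[OF sigma_finite_lborel]) auto
  then show ?thesis
    by eventually_elim (auto simp: max_def split: if_splits)
qed

text \<open>The circle has finite measure, so |g| \<le> 1 + g^2 is an integrable bound.\<close>

lemma L2_per_integrable:
  assumes "L2_per g" shows "integrable lborel (\<lambda>x. indicator circ x * g x)"
proof -
  have m: "(\<lambda>x. indicator circ x * g x) \<in> borel_measurable lborel"
    using assms by (simp add: L2_per_def set_borel_measurable_def)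
  have sq: "integrable lborel (\<lambda>x. indicator circ x * (g x)\<^sup>2)"
    using assms by (simp add: L2_per_def set_integrable_def)
  have one: "integrable lborel (indicator circ :: real \<Rightarrow> real)"
    by (rule integrable_real_indicator) (auto simp: circ_def)
  show ?thesis
  proof (rule Bochner_Integration.integrable_bound[OF Bochner_Integration.integrable_add[OF one sq] m], rule AE_I2)
    fix x
    have "\<bar>g x\<bar> \<le> 1 + (g x)\<^sup>2"
      using zero_le_power2[of "\<bar>g x\<bar> - 1"] abs_ge_zero[of "g x"] by (simp add: power2_eq_square algebra_simps)
    then show "norm (indicator circ x * g x) \<le> norm (indicator circ x + indicator circ x * (g x)\<^sup>2)"
      by (auto simp: indicator_def)
  qed
qed

text \<open>Both functions have the same pairing with every test function. Single sines and cosines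
  are test functions, and induction over \<open>trig\<close> extends the orthogonality by
  linearity.\<close>

lemma weak_deriv_per_orthogonal_diff:
  assumes g1: "weak_deriv_per v g1" and g2: "weak_deriv_per v g2" and p: "trig p"
  shows "(LINT x|lborel. (indicator circ x * (g1 x - g2 x)) * p x) = 0"
proof -
  define d where "d = (\<lambda>x. indicator circ x * (g1 x - g2 x))"
  note i1 = L2_per_integrable[of g1] and i2 = L2_per_integrable[of g2]
  have L: "L2_per g1" "L2_per g2" using g1 g2 by (auto simp: weak_deriv_per_def)
  have di: "integrable lborel d"
    using Bochner_Integration.integrable_diff[OF i1[OF L(1)] i2[OF L(2)]] by (simp add: d_def right_diff_distrib)
  have d0: "d x = 0" if "x \<notin> circ" for x using that by (simp add: d_def)
  have base: "(LINT x|lborel. d x * \<phi> x) = 0" if \<phi>: "test_per \<phi>" "continuous_on circ \<phi>" for \<phi>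
  proof -
    have "(LINT x:circ|lborel. v x * deriv \<phi> x) = - (LINT x:circ|lborel. g x * \<phi> x)"
      if "weak_deriv_per v g" for g
      using that \<phi>(1) unfolding weak_deriv_per_def by blast
    from this[OF g1] this[OF g2]
    have "(LINT x:circ|lborel. g1 x * \<phi> x) = (LINT x:circ|lborel. g2 x * \<phi> x)" by linarith
    moreover have "integrable lborel (\<lambda>x. indicator circ x * g x * \<phi> x)" if "L2_per g" for g
      by (rule integrable_mult_continuous_on_circ[OF L2_per_integrable[OF that] _ \<phi>(2)]) simp
    ultimately show ?thesis
      using L unfolding d_def set_lebesgue_integral_def right_diff_distrib left_diff_distrib
      by (subst Bochner_Integration.integral_diff) (simp_all add: mult.assoc)
  qed
  have "(LINT x|lborel. d x * p x) = 0" using p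
  proof induction
    case (trig_add p q)
    then show ?case
      using integrable_mult_continuous_on_circ[OF di d0 trig_continuous[OF trig_add.hyps(1)]]
        integrable_mult_continuous_on_circ[OF di d0 trig_continuous[OF trig_add.hyps(2)]]
      by (simp add: distrib_left)
  next
    case (trig_scale p c)
    have "(\<lambda>x. d x * (c * p x)) = (\<lambda>x. c * (d x * p x))" by (simp add: mult.left_commute)
    then show ?case using trig_scale by simp
  qed (auto intro!: base test_per_cs test_per_sn)
  then show ?thesis by (simp add: d_def)
qed

text \<open>\<open>H1_norm\<close> depends on the selected weak derivative only through this
  integral, so for a C^1 function the classical derivative may be used instead.\<close>

lemma weak_deriv_per_square_integral_unique:
  assumes g1: "weak_deriv_per v g1" and g2: "weak_deriv_per v g2"
  shows "(LINT x:circ|lborel. (g1 x)\<^sup>2) = (LINT x:circ|lborel. (g2 x)\<^sup>2)"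
proof -
  have L: "L2_per g1" "L2_per g2" using g1 g2 by (auto simp: weak_deriv_per_def)
  have "integrable lborel (\<lambda>x. indicator circ x * (g1 x - g2 x))"
    using Bochner_Integration.integrable_diff[OF L2_per_integrable[OF L(1)] L2_per_integrable[OF L(2)]]
    by (simp add: right_diff_distrib)
  then have "AE x in lborel. indicator circ x * (g1 x - g2 x) = 0"
    by (rule orthogonal_trig_imp_AE_zero)
       (use weak_deriv_per_orthogonal_diff[OF g1 g2] in auto)
  then have "AE x in lborel. indicator circ x *\<^sub>R (g1 x)\<^sup>2 = indicator circ x *\<^sub>R (g2 x)\<^sup>2"
    by eventually_elim (auto simp: indicator_def split: if_splits)
  then show ?thesis
    unfolding set_lebesgue_integral_def
    by (intro integral_cong_AE) (use L in \<open>auto simp: L2_per_def set_integrable_def\<close>)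
qed

section \<open>The Sobolev norm of periodic C^1 functions\<close>

lemma test_per_deriv:
  assumes "test_per \<phi>"
  shows "(\<phi> has_real_derivative deriv \<phi> x) (at x)"
    and "(deriv \<phi> has_real_derivative deriv (deriv \<phi>) x) (at x)"
    and "continuous_on S \<phi>" "continuous_on S (deriv \<phi>)" "continuous_on S (deriv (deriv \<phi>))"
    and "\<phi> (x + 1) = \<phi> x" "deriv \<phi> (x + 1) = deriv \<phi> x"
proof -
  have D: "(deriv ^^ n) \<phi> differentiable at y" for n y
    using assms unfolding test_per_def differentiable_on_def by simp
  have D': "((deriv ^^ n) \<phi> has_real_derivative deriv ((deriv ^^ n) \<phi>) y) (at y)" for n y
    using D[of n y] DERIV_imp_deriv unfolding real_differentiable_def by blast
  show d0: "(\<phi> has_real_derivative deriv \<phi> x) (at x)" for x using D'[of 0] by simp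
  show d1: "(deriv \<phi> has_real_derivative deriv (deriv \<phi>) x) (at x)" for x using D'[of 1] by simp
  show "continuous_on S \<phi>" "continuous_on S (deriv \<phi>)"
    by (rule DERIV_everywhere_continuous_on, rule d0 d1)+
  show "continuous_on S (deriv (deriv \<phi>))"
    using DERIV_everywhere_continuous_on[OF D'[of 2]] by (simp add: numeral_2_eq_2)
  show p: "\<phi> (x + 1) = \<phi> x" for x using assms unfolding test_per_def periodic1_def by blast
  have "((\<lambda>x. \<phi> (x + 1)) has_real_derivative deriv \<phi> (x + 1)) (at x)"
    using d0 by (simp add: DERIV_shift[symmetric])
  then show "deriv \<phi> (x + 1) = deriv \<phi> x" unfolding p using d0 DERIV_unique by blast
qed

lemma C1_periodic_weak_deriv:
  assumes per: "periodic1 v" and D: "\<And>x. (v has_real_derivative v' x) (at x)"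
    and cont: "continuous_on UNIV v'"
  shows "weak_deriv_per v v'"
  unfolding weak_deriv_per_def
proof (intro conjI allI impI)
  note c' = continuous_on_subset[OF cont subset_UNIV]
  note c = DERIV_everywhere_continuous_on[OF D]
  show "L2_per v'"
  proof -
    have "v' \<in> borel_measurable lborel" using borel_measurable_continuous_onI[OF cont] by simp
    then have "(\<lambda>x. indicator circ x *\<^sub>R v' x) \<in> borel_measurable lborel"
      by (intro borel_measurable_scaleR borel_measurable_indicator) auto
    moreover have "set_integrable lborel circ (\<lambda>x. (v' x)\<^sup>2)"
      by (intro continuous_on_circ_set_integrable continuous_intros c')
    ultimately show ?thesis unfolding L2_per_def set_borel_measurable_def by blast
  qed
  fix \<phi> assume "test_per \<phi>"
  note t = test_per_deriv[OF this]
  have "integral circ (\<lambda>x. v x * deriv \<phi> x) = - integral circ (\<lambda>x. v' x * \<phi> x)"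
    by (rule circ_integral_by_parts[OF D t(1) c' t(4)])
       (use periodic1_ends[OF per] t(6)[of "- (1/2)"] in simp)
  then show "(LINT x:circ|lborel. v x * deriv \<phi> x) = - (LINT x:circ|lborel. v' x * \<phi> x)"
    unfolding circ_LINT[OF continuous_on_mult[OF c t(4)]] circ_LINT[OF continuous_on_mult[OF c' t(3)]] .
qed

lemma H1_norm_C1:
  assumes per: "periodic1 v" and D: "\<And>x. (v has_real_derivative v' x) (at x)"
    and cont: "continuous_on UNIV v'"
  shows "H1_norm v = sqrt (ip v v + ip v' v')"
proof -
  note w = C1_periodic_weak_deriv[OF assms]
  have "weak_deriv_per v (SOME g. weak_deriv_per v g)" by (rule someI[of "weak_deriv_per v"]) (rule w)
  then have "(LINT x:circ|lborel. ((SOME g. weak_deriv_per v g) x)\<^sup>2) = (LINT x:circ|lborel. (v' x)\<^sup>2)"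
    using w by (rule weak_deriv_per_square_integral_unique)
  moreover have "(LINT x:circ|lborel. (h x)\<^sup>2) = ip h h" if "continuous_on circ h" for h
    unfolding ip_def by (subst circ_LINT) (use that in \<open>auto intro!: continuous_intros simp: power2_eq_square\<close>)
  ultimately show ?thesis
    unfolding H1_norm_def using DERIV_everywhere_continuous_on[OF D] continuous_on_subset[OF cont subset_UNIV]
    by simp
qed

subsection \<open>Gaussian averages\<close>

text \<open>The mean value inequality bounds every difference quotient by the dominating function
  \<open>w\<close>, so dominated convergence applies along each sequence tending to 0.\<close>

lemma has_real_derivative_integral:
  fixes F F' :: "real \<Rightarrow> 'a \<Rightarrow> real"
  assumes D: "\<And>a z. ((\<lambda>a. F a z) has_real_derivative F' a z) (at a)"
    and F: "\<And>a. integrable M (F a)" and F': "F' a0 \<in> borel_measurable M"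
    and w: "integrable M w" "\<And>a z. \<bar>F' a z\<bar> \<le> w z"
  shows "((\<lambda>a. LINT z|M. F a z) has_real_derivative (LINT z|M. F' a0 z)) (at a0)"
  unfolding DERIV_def tendsto_at_iff_sequentially
proof (intro allI impI)
  fix X :: "nat \<Rightarrow> real" assume X: "\<forall>i. X i \<in> UNIV - {0}" "X \<longlonglongrightarrow> 0"
  have q: "(\<lambda>i. LINT z|M. (F (a0 + X i) z - F a0 z) / X i) \<longlonglongrightarrow> (LINT z|M. F' a0 z)"
  proof (rule integral_dominated_convergence[where w=w])
    show "(\<lambda>z. (F (a0 + X i) z - F a0 z) / X i) \<in> borel_measurable M" for i
      using F by (intro borel_measurable_divide borel_measurable_diff borel_measurable_integrable borel_measurable_const)
    show "AE z in M. (\<lambda>i. (F (a0 + X i) z - F a0 z) / X i) \<longlonglongrightarrow> F' a0 z"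
    proof (rule AE_I2)
      fix z
      have "((\<lambda>h. (F (a0 + h) z - F a0 z) / h) \<longlongrightarrow> F' a0 z) (at 0)"
        using D[where a=a0 and z=z] by (simp add: DERIV_def)
      then show "(\<lambda>i. (F (a0 + X i) z - F a0 z) / X i) \<longlonglongrightarrow> F' a0 z"
        using X unfolding tendsto_at_iff_sequentially by (auto simp: o_def)
    qed
    show "AE z in M. norm ((F (a0 + X i) z - F a0 z) / X i) \<le> w z" for i
    proof (rule AE_I2)
      fix z
      have "norm (F (a0 + X i) z - F a0 z) \<le> w z * norm (a0 + X i - a0)"
        by (rule field_differentiable_bound[of UNIV _ "\<lambda>a. F' a z"]) (use D w(2) in auto)
      then show "norm ((F (a0 + X i) z - F a0 z) / X i) \<le> w z"
        using X by (simp add: norm_divide divide_le_eq)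
    qed
  qed (use F' w in auto)
  have "(LINT z|M. (F (a0 + X i) z - F a0 z) / X i)
    = ((LINT z|M. F (a0 + X i) z) - (LINT z|M. F a0 z)) / X i" for i
    using F by simp
  then show "((\<lambda>h. ((LINT z|M. F (a0 + h) z) - (LINT z|M. F a0 z)) / h) \<circ> X) \<longlonglongrightarrow> (LINT z|M. F' a0 z)"
    using q by (simp only: o_def)
qed

text \<open>The expectation of Z^j g(x + s Z) for a standard normal Z. Each derivative in s brings
  down a factor Z, which is the reason for j; j = 0 and s = sqrt (2 t) give the heat
  semigroup.\<close>

definition gauss :: "nat \<Rightarrow> (real \<Rightarrow> real) \<Rightarrow> real \<Rightarrow> real \<Rightarrow> real" where
  "gauss j g x s = (LINT z|lborel. std_normal_density z * (z ^ j * g (x + s * z)))"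

lemma gauss_integrand_bound:
  assumes "\<And>y. \<bar>g y\<bar> \<le> B"
  shows "\<bar>std_normal_density z * (z ^ j * g y)\<bar> \<le> B * (std_normal_density z * \<bar>z\<bar> ^ j)"
proof -
  have "std_normal_density z * (\<bar>z\<bar> ^ j * \<bar>g y\<bar>) \<le> std_normal_density z * (\<bar>z\<bar> ^ j * B)"
    by (intro mult_left_mono assms) auto
  then show ?thesis by (simp add: abs_mult power_abs algebra_simps)
qed

lemma gauss_integrand_measurable:
  assumes "continuous_on UNIV g"
  shows "(\<lambda>z. std_normal_density z * (z ^ j * g (x + s * z))) \<in> borel_measurable lborel"
proof -
  have "continuous_on UNIV (\<lambda>z. g (x + s * z))"
    by (rule continuous_on_compose2[OF assms]) (auto intro!: continuous_intros)
  then show ?thesis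
    using borel_measurable_continuous_onI[of "\<lambda>z. g (x + s * z)"] by measurable
qed

lemma gauss_integrable:
  assumes "continuous_on UNIV g" "\<And>y. \<bar>g y\<bar> \<le> B"
  shows "integrable lborel (\<lambda>z. std_normal_density z * (z ^ j * g (x + s * z)))"
proof (rule Bochner_Integration.integrable_bound[OF _ gauss_integrand_measurable[OF assms(1)]])
  show "integrable lborel (\<lambda>z. B * (std_normal_density z * \<bar>z\<bar> ^ j))"
    by (intro integrable_mult_right integrable_std_normal_moment_abs)
  show "AE z in lborel. norm (std_normal_density z * (z ^ j * g (x + s * z))) \<le> norm (B * (std_normal_density z * \<bar>z\<bar> ^ j))"
    unfolding real_norm_def by (intro AE_I2 order_trans[OF gauss_integrand_bound[where B=B]] assms abs_ge_self)
qed

text \<open>The parameters occur only in the argument of the bounded function g, so one dominating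
  function serves for all of them, including s = 0, where the heat kernel would degenerate.\<close>

lemma gauss_continuous:
  assumes g: "continuous_on UNIV g" "\<And>y. \<bar>g y\<bar> \<le> B"
  shows "continuous_on UNIV (\<lambda>(x, s). gauss j g x s)"
  unfolding continuous_on_sequentially
proof (intro allI ballI impI)
  fix X :: "nat \<Rightarrow> real \<times> real" and a assume "(\<forall>n. X n \<in> UNIV) \<and> X \<longlonglongrightarrow> a"
  then have X: "X \<longlonglongrightarrow> a" by simp
  have "(\<lambda>n. gauss j g (fst (X n)) (snd (X n))) \<longlonglongrightarrow> gauss j g (fst a) (snd a)"
    unfolding gauss_def
  proof (rule integral_dominated_convergence[where w="\<lambda>z. B * (std_normal_density z * \<bar>z\<bar> ^ j)"])
    show "integrable lborel (\<lambda>z. B * (std_normal_density z * \<bar>z\<bar> ^ j))"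
      by (intro integrable_mult_right integrable_std_normal_moment_abs)
    show "AE z in lborel. (\<lambda>n. std_normal_density z * (z ^ j * g (fst (X n) + snd (X n) * z)))
        \<longlonglongrightarrow> std_normal_density z * (z ^ j * g (fst a + snd a * z))"
      by (intro AE_I2 tendsto_mult tendsto_const isCont_tendsto_compose[of _ g] tendsto_add tendsto_fst tendsto_snd X)
         (use g(1) in \<open>simp add: continuous_on_eq_continuous_at\<close>)
    show "AE z in lborel. norm (std_normal_density z * (z ^ j * g (fst (X n) + snd (X n) * z)))
        \<le> B * (std_normal_density z * \<bar>z\<bar> ^ j)" for n
      unfolding real_norm_def by (intro AE_I2 gauss_integrand_bound g)
  qed (rule gauss_integrand_measurable[OF g(1)])+
  then show "((\<lambda>(x, s). gauss j g x s) \<circ> X) \<longlonglongrightarrow> (case a of (x, s) \<Rightarrow> gauss j g x s)"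
    by (simp add: o_def case_prod_beta)
qed

lemma gauss_deriv_x:
  assumes H: "\<And>y. (H has_real_derivative h y) (at y)" "\<And>y. \<bar>H y\<bar> \<le> B"
    and h: "continuous_on UNIV h" "\<And>y. \<bar>h y\<bar> \<le> C"
  shows "((\<lambda>x. gauss j H x s) has_real_derivative gauss j h x s) (at x)"
  unfolding gauss_def
proof (rule has_real_derivative_integral[where w="\<lambda>z. C * (std_normal_density z * \<bar>z\<bar> ^ j)"])
  fix a z
  have "((\<lambda>a. H (a + s * z)) has_real_derivative h (a + s * z)) (at a)"
    using H(1) by (simp add: DERIV_shift[symmetric])
  then show "((\<lambda>a. std_normal_density z * (z ^ j * H (a + s * z))) has_real_derivative
      std_normal_density z * (z ^ j * h (a + s * z))) (at a)"
    by (intro DERIV_cmult)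
  show "\<bar>std_normal_density z * (z ^ j * h (a + s * z))\<bar> \<le> C * (std_normal_density z * \<bar>z\<bar> ^ j)"
    by (rule gauss_integrand_bound) (rule h)
next
  show "integrable lborel (\<lambda>z. C * (std_normal_density z * \<bar>z\<bar> ^ j))"
    by (intro integrable_mult_right integrable_std_normal_moment_abs)
  show "(\<lambda>z. std_normal_density z * (z ^ j * h (x + s * z))) \<in> borel_measurable lborel"
    by (rule gauss_integrand_measurable) (rule h)
qed (rule gauss_integrable[OF DERIV_everywhere_continuous_on[OF H(1)] H(2)])

lemma gauss_deriv_s:
  assumes H: "\<And>y. (H has_real_derivative h y) (at y)" "\<And>y. \<bar>H y\<bar> \<le> B"
    and h: "continuous_on UNIV h" "\<And>y. \<bar>h y\<bar> \<le> C"
  shows "((\<lambda>s. gauss j H x s) has_real_derivative gauss (Suc j) h x s) (at s)"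
  unfolding gauss_def
proof (rule has_real_derivative_integral[where w="\<lambda>z. C * (std_normal_density z * \<bar>z\<bar> ^ Suc j)"])
  fix a z
  have "((\<lambda>a. H (x + a * z)) has_real_derivative h (x + a * z) * z) (at a)"
    by (rule DERIV_chain2[OF H(1)]) (auto intro!: derivative_eq_intros)
  then have "((\<lambda>a. std_normal_density z * (z ^ j * H (x + a * z))) has_real_derivative
      std_normal_density z * (z ^ j * (h (x + a * z) * z))) (at a)"
    by (intro DERIV_cmult)
  then show "((\<lambda>a. std_normal_density z * (z ^ j * H (x + a * z))) has_real_derivative
      std_normal_density z * (z ^ Suc j * h (x + a * z))) (at a)"
    by (simp add: mult_ac)
  show "\<bar>std_normal_density z * (z ^ Suc j * h (x + a * z))\<bar> \<le> C * (std_normal_density z * \<bar>z\<bar> ^ Suc j)"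
    by (rule gauss_integrand_bound) (rule h)
next
  show "integrable lborel (\<lambda>z. C * (std_normal_density z * \<bar>z\<bar> ^ Suc j))"
    by (intro integrable_mult_right integrable_std_normal_moment_abs)
  show "(\<lambda>z. std_normal_density z * (z ^ Suc j * h (x + s * z))) \<in> borel_measurable lborel"
    by (rule gauss_integrand_measurable) (rule h)
qed (rule gauss_integrable[OF DERIV_everywhere_continuous_on[OF H(1)] H(2)])

lemma std_normal_density_deriv:
  "(std_normal_density has_real_derivative - z * std_normal_density z) (at z)"
proof -
  have "((\<lambda>z. exp (- z\<^sup>2 / 2)) has_real_derivative - z * exp (- z\<^sup>2 / 2)) (at z)"
    by (auto intro!: derivative_eq_intros)
  from DERIV_cmult[OF this, of "1 / sqrt (2 * pi)"] show ?thesis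
    by (simp add: std_normal_density_def[abs_def] mult_ac)
qed

lemma std_normal_density_tendsto:
  "(std_normal_density \<longlongrightarrow> 0) at_top" "(std_normal_density \<longlongrightarrow> 0) at_bot"
proof -
  have "filterlim (\<lambda>z::real. (1 / 2) * z\<^sup>2) at_top at_top"
    by (rule filterlim_tendsto_pos_mult_at_top[OF tendsto_const])
       (simp_all add: filterlim_pow_at_top filterlim_ident)
  then have top: "filterlim (\<lambda>z::real. z\<^sup>2 / 2) at_top at_top" by simp
  have "((\<lambda>z::real. exp (- (z\<^sup>2 / 2))) \<longlongrightarrow> 0) at_top"
    by (rule filterlim_compose[OF exp_at_bot]) (simp add: filterlim_uminus_at_bot top)
  then have "((\<lambda>z::real. 1 / sqrt (2 * pi) * exp (- (z\<^sup>2 / 2))) \<longlongrightarrow> 1 / sqrt (2 * pi) * 0) at_top"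
    by (intro tendsto_mult tendsto_const)
  then show t: "(std_normal_density \<longlongrightarrow> 0) at_top"
    by (simp add: std_normal_density_def[abs_def])
  show "(std_normal_density \<longlongrightarrow> 0) at_bot"
    using t unfolding at_bot_mirror filterlim_filtermap by (simp add: std_normal_density_def[abs_def])
qed

text \<open>Stein's identity: - z times the density is the derivative of the density, and the total
  derivative of density times H integrates to 0. It trades the factor Z from an s derivative for a
  further x derivative, which is how the heat equation arises.\<close>

lemma gauss_integration_by_parts:
  assumes H: "\<And>y. (H has_real_derivative h y) (at y)" "\<And>y. \<bar>H y\<bar> \<le> B"
    and h: "continuous_on UNIV h" "\<And>y. \<bar>h y\<bar> \<le> C"
  shows "gauss (Suc 0) H x s = s * gauss 0 h x s"
proof -
  note Hc = DERIV_everywhere_continuous_on[OF H(1)]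
  define F where "F = (\<lambda>z. std_normal_density z * H (x + s * z))"
  define f where "f = (\<lambda>z. s * (std_normal_density z * (z ^ 0 * h (x + s * z))) - std_normal_density z * (z ^ Suc 0 * H (x + s * z)))"
  have FD: "(F has_real_derivative f z) (at z)" for z
  proof -
    have "((\<lambda>z. H (x + s * z)) has_real_derivative h (x + s * z) * s) (at z)"
      by (rule DERIV_chain2[OF H(1)]) (auto intro!: derivative_eq_intros)
    then have "((\<lambda>z. std_normal_density z * H (x + s * z)) has_real_derivative
      (- z * std_normal_density z) * H (x + s * z) + (h (x + s * z) * s) * std_normal_density z) (at z)"
      by (rule DERIV_mult[OF std_normal_density_deriv])
    then show ?thesis by (simp add: F_def f_def algebra_simps)
  qed
  have cont: "continuous_on UNIV f"
  proof -
    have "continuous_on UNIV (\<lambda>z. h (x + s * z))" "continuous_on UNIV (\<lambda>z. H (x + s * z))"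
      by (rule continuous_on_compose2[OF h(1)] continuous_on_compose2[OF Hc[of UNIV]];
          auto intro!: continuous_intros)+
    moreover have "continuous_on UNIV std_normal_density"
      by (rule DERIV_everywhere_continuous_on[OF std_normal_density_deriv])
    ultimately show ?thesis unfolding f_def by (intro continuous_intros)
  qed
  have int: "integrable lborel f"
    unfolding f_def
    by (intro Bochner_Integration.integrable_diff integrable_mult_right
         gauss_integrable[OF h] gauss_integrable[OF Hc H(2)])
  have lim: "(F \<longlongrightarrow> 0) G" if "(std_normal_density \<longlongrightarrow> 0) G" for G
  proof (rule Lim_null_comparison)
    show "((\<lambda>z. B * std_normal_density z) \<longlongrightarrow> 0) G"
      using tendsto_mult_right_zero[OF that] .
    show "eventually (\<lambda>z. norm (F z) \<le> B * std_normal_density z) G"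
      using gauss_integrand_bound[where j=0 and g=H, OF H(2)] by (simp add: F_def)
  qed
  have "(LBINT z=-\<infinity>..\<infinity>. f z) = 0 - 0"
  proof (rule interval_integral_FTC_integrable[where F=F])
    show "(F has_vector_derivative f z) (at z)" for z
      using FD by (simp add: has_real_derivative_iff_has_vector_derivative)
    show "isCont f z" for z using cont by (simp add: continuous_on_eq_continuous_at)
    show "set_integrable lborel (einterval (-\<infinity>) \<infinity>) f"
      using int by (simp add: set_integrable_def einterval_def)
    show "((F \<circ> real_of_ereal) \<longlongrightarrow> 0) (at_right (-\<infinity>))" "((F \<circ> real_of_ereal) \<longlongrightarrow> 0) (at_left \<infinity>)"
      unfolding ereal_tendsto_simps1 by (intro lim std_normal_density_tendsto)+
  qed simp
  then have "(LINT z|lborel. f z) = 0"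
    by (simp add: interval_lebesgue_integral_def set_lebesgue_integral_def einterval_def)
  moreover have "(LINT z|lborel. f z) = s * gauss 0 h x s - gauss (Suc 0) H x s"
    unfolding f_def gauss_def
    by (subst Bochner_Integration.integral_diff)
       (intro integrable_mult_right gauss_integrable[OF h] gauss_integrable[OF Hc H(2)] | simp)+
  ultimately show ?thesis by simp
qed

text \<open>The density has total mass 1. This keeps the heat solution away from 0, so that
  Cole-Hopf can divide by it.\<close>

lemma gauss_lower_bound:
  assumes g: "continuous_on UNIV g" "\<And>y. \<bar>g y\<bar> \<le> B" and c: "\<And>y. c \<le> g y"
  shows "c \<le> gauss 0 g x s"
proof -
  have "c = (LINT z|lborel. std_normal_density z * c)"
    using integral_std_normal_moment_even[of 0] by simp
  also have "\<dots> \<le> gauss 0 g x s"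
    unfolding gauss_def
  proof (rule integral_mono)
    show "integrable lborel (\<lambda>z. std_normal_density z * c)"
      using integrable_std_normal_moment[of 0] by simp
    show "integrable lborel (\<lambda>z. std_normal_density z * (z ^ 0 * g (x + s * z)))"
      by (rule gauss_integrable[OF g])
  qed (use c in \<open>auto intro!: mult_left_mono\<close>)
  finally show ?thesis .
qed

lemma gauss_0_0: "gauss 0 g x 0 = g x"
  using integral_std_normal_moment_even[of 0] by (simp add: gauss_def)

lemma gauss_periodic: "(\<And>y. g (y + 1) = g y) \<Longrightarrow> gauss j g (x + 1) s = gauss j g x s"
proof -
  assume g: "\<And>y. g (y + 1) = g y"
  have "g (x + 1 + s * z) = g (x + s * z)" for z
    using g[of "x + s * z"] by (simp add: algebra_simps)
  then show ?thesis by (simp add: gauss_def)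
qed

text \<open>The density is even, so z may be replaced by - z. The factor c is 1 for even and - 1 for
  odd data.\<close>

lemma gauss_reflect:
  assumes "\<And>y. g (- y) = c * g y"
  shows "gauss 0 g (- x) s = c * gauss 0 g x s"
proof -
  have g: "g (- x - s * z) = c * g (x + s * z)" for z
    using assms[of "x + s * z"] by (simp add: algebra_simps)
  have "gauss 0 g (- x) s = (LINT z|lborel. std_normal_density (- z) * g (- x + s * (- z)))"
    unfolding gauss_def
    using lborel_integral_real_affine[of "- 1" "\<lambda>z. std_normal_density z * g (- x + s * z)" 0] by simp
  also have "\<dots> = (LINT z|lborel. c * (std_normal_density z * g (x + s * z)))"
    by (simp add: g std_normal_density_def mult.left_commute)
  finally show ?thesis by (simp add: gauss_def)
qed

subsection \<open>The Cole--Hopf solution\<close>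

lemma periodic_continuous_bounded:
  fixes g :: "real \<Rightarrow> real"
  assumes "\<And>y. g (y + 1) = g y" "continuous_on UNIV g"
  obtains B where "\<And>y. \<bar>g y\<bar> \<le> B"
proof -
  have p: "periodic1 g" using assms(1) by (simp add: periodic1_def)
  have "bounded (g ` circ)"
    by (intro compact_imp_bounded compact_continuous_image continuous_on_subset[OF assms(2)] circ_facts) simp
  then obtain B where B: "\<And>x. x \<in> circ \<Longrightarrow> \<bar>g x\<bar> \<le> B" by (auto simp: bounded_iff)
  show ?thesis
  proof (rule that)
    fix y
    obtain x where "x \<in> circ" "g y = g x" by (rule periodic1_reduce[OF p])
    then show "\<bar>g y\<bar> \<le> B" using B by simp
  qed
qed

lemma periodic_continuous_pos_bounded_below:
  fixes g :: "real \<Rightarrow> real"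
  assumes "\<And>y. g (y + 1) = g y" "continuous_on UNIV g" "\<And>y. g y > 0"
  obtains c where "c > 0" "\<And>y. c \<le> g y"
proof -
  have p: "periodic1 g" using assms(1) by (simp add: periodic1_def)
  have "continuous_on circ g" by (rule continuous_on_subset[OF assms(2)]) simp
  then obtain m where m: "\<forall>x\<in>circ. g m \<le> g x"
    using continuous_attains_inf[of circ g] by auto
  show ?thesis
  proof (rule that[of "g m"])
    fix y
    obtain x where "x \<in> circ" "g y = g x" by (rule periodic1_reduce[OF p])
    then show "g m \<le> g y" using m by simp
  qed (rule assms)
qed

lemma periodic_deriv_periodic:
  fixes g :: "real \<Rightarrow> real"
  assumes "\<And>y. g (y + c) = g y" "\<And>y. (g has_real_derivative g' y) (at y)"
  shows "g' (y + c) = g' y"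
proof -
  have "((\<lambda>y. g (y + c)) has_real_derivative g' (y + c)) (at y)"
    using assms(2) by (simp add: DERIV_shift[symmetric])
  then show ?thesis unfolding assms(1) using assms(2) DERIV_unique by blast
qed

text \<open>By the fundamental theorem, which asks for derivatives in the interior only, F differs
  from the integral of F' by a constant, and that integral is differentiable at the left
  end.\<close>

lemma one_sided_derivative_at_0:
  fixes F F' :: "real \<Rightarrow> real"
  assumes F: "continuous_on {0..} F" and D: "\<And>t. t > 0 \<Longrightarrow> (F has_real_derivative F' t) (at t)"
    and F': "continuous_on {0..} F'"
  shows "(F has_real_derivative F' 0) (at 0 within {0..})"
proof -
  have F'1: "continuous_on {0..1} F'" by (rule continuous_on_subset[OF F']) auto
  have eq: "integral {0..t} F' + F 0 = F t" if "t \<in> {0..1}" for t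
  proof -
    have "(F' has_integral (F t - F 0)) {0..t}"
    proof (rule fundamental_theorem_of_calculus_interior)
      show "continuous_on {0..t} F" by (rule continuous_on_subset[OF F]) auto
      show "(F has_vector_derivative F' x) (at x)" if "x \<in> {0<..<t}" for x
        using D[of x] that by (simp add: has_real_derivative_iff_has_vector_derivative)
    qed (use that in auto)
    then show ?thesis by (simp add: integral_unique)
  qed
  have "((\<lambda>t. integral {0..t} F' + F 0) has_real_derivative F' 0 + 0) (at 0 within {0..1})"
    by (intro DERIV_add DERIV_const integral_has_real_derivative[OF F'1]) auto
  then have "(F has_real_derivative F' 0 + 0) (at 0 within {0..1})"
    by (rule has_field_derivative_transform_within[where d=1]) (use eq in auto)
  then show ?thesis
    by (simp add: at_within_Icc_at_right at_within_Ici_at_right)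
qed

lemma gauss_continuous_compose:
  assumes g: "continuous_on UNIV g" "\<And>y. \<bar>g y\<bar> \<le> B" and ab: "continuous_on S a" "continuous_on S b"
  shows "continuous_on S (\<lambda>z. gauss j g (a z) (b z))"
proof -
  have "continuous_on S (\<lambda>z. (\<lambda>(x, s). gauss j g x s) (a z, b z))"
    by (rule continuous_on_compose2[OF gauss_continuous[OF g]]) (auto intro!: continuous_intros ab)
  then show ?thesis by simp
qed

text \<open>An initial value for the heat equation with its first two derivatives. Two derivatives
  are what a C^1 initial value of the Burgers equation provides; evenness will make u odd.\<close>

locale heat_data =
  fixes P0 P1 P2 :: "real \<Rightarrow> real"
  assumes D0: "\<And>y. (P0 has_real_derivative P1 y) (at y)"
    and D1: "\<And>y. (P1 has_real_derivative P2 y) (at y)"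
    and c2: "continuous_on UNIV P2"
    and pos: "\<And>y. P0 y > 0"
    and per0: "\<And>y. P0 (y + 1) = P0 y"
    and even0: "\<And>y. P0 (- y) = P0 y"
begin

lemma per1: "P1 (y + 1) = P1 y" and per2: "P2 (y + 1) = P2 y"
proof -
  show p1: "P1 (y + 1) = P1 y" for y by (rule periodic_deriv_periodic[OF per0 D0])
  show "P2 (y + 1) = P2 y" by (rule periodic_deriv_periodic[OF p1 D1])
qed

lemma odd1: "P1 (- y) = (- 1) * P1 y"
proof -
  have "((\<lambda>y. P0 (- y)) has_real_derivative P1 (- y) * (- 1)) (at y)"
    by (rule DERIV_chain2[OF D0]) (auto intro!: derivative_eq_intros)
  then have "P1 (- y) * (- 1) = P1 y" unfolding even0 using D0 DERIV_unique by blast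
  then show ?thesis by simp
qed

lemma c0: "continuous_on S P0" and c1: "continuous_on S P1"
  by (rule DERIV_everywhere_continuous_on[OF D0]) (rule DERIV_everywhere_continuous_on[OF D1])

definition "\<psi> x t = gauss 0 P0 x (sqrt (2 * t))"
definition "\<psi>x x t = gauss 0 P1 x (sqrt (2 * t))"
definition "\<psi>xx x t = gauss 0 P2 x (sqrt (2 * t))"
text \<open>No third derivative of the datum is at hand. Stein's identity writes the second
  derivative as the expectation of Z P1(x + s Z) divided by s = sqrt (2 t), and differentiating this
  in x gives the formula, meaningful for t > 0.\<close>

definition "\<psi>xxx x t = gauss 1 P2 x (sqrt (2 * t)) / sqrt (2 * t)"

lemma \<psi>_pos: "\<psi> x t > 0"
proof -
  obtain B where B: "\<And>y. \<bar>P0 y\<bar> \<le> B" using periodic_continuous_bounded[of P0] per0 c0 by metis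
  obtain c where c: "c > 0" "\<And>y. c \<le> P0 y"
    using periodic_continuous_pos_bounded_below[of P0] per0 c0 pos by metis
  have "c \<le> \<psi> x t" unfolding \<psi>_def by (rule gauss_lower_bound[OF c0 B c(2)])
  then show ?thesis using c(1) by simp
qed

lemma \<psi>_continuous:
  assumes "continuous_on S a" "continuous_on S b"
  shows "continuous_on S (\<lambda>z. \<psi> (a z) (b z))" "continuous_on S (\<lambda>z. \<psi>x (a z) (b z))"
    "continuous_on S (\<lambda>z. \<psi>xx (a z) (b z))"
    "(\<And>z. z \<in> S \<Longrightarrow> b z > 0) \<Longrightarrow> continuous_on S (\<lambda>z. \<psi>xxx (a z) (b z))"
proof -
  obtain B0 where B0: "\<And>y. \<bar>P0 y\<bar> \<le> B0" using periodic_continuous_bounded[of P0] per0 c0 by metis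
  obtain B1 where B1: "\<And>y. \<bar>P1 y\<bar> \<le> B1" using periodic_continuous_bounded[of P1] per1 c1 by metis
  obtain B2 where B2: "\<And>y. \<bar>P2 y\<bar> \<le> B2" using periodic_continuous_bounded[of P2] per2 c2 by metis
  have s: "continuous_on S (\<lambda>z. sqrt (2 * b z))" by (intro continuous_intros assms)
  show "continuous_on S (\<lambda>z. \<psi> (a z) (b z))" "continuous_on S (\<lambda>z. \<psi>x (a z) (b z))"
    "continuous_on S (\<lambda>z. \<psi>xx (a z) (b z))"
    unfolding \<psi>_def \<psi>x_def \<psi>xx_def
    by (rule gauss_continuous_compose[OF c0 B0 assms(1) s] gauss_continuous_compose[OF c1 B1 assms(1) s]
        gauss_continuous_compose[OF c2 B2 assms(1) s])+
  show "continuous_on S (\<lambda>z. \<psi>xxx (a z) (b z))" if "\<And>z. z \<in> S \<Longrightarrow> b z > 0"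
    unfolding \<psi>xxx_def
    by (rule continuous_on_divide[OF gauss_continuous_compose[OF c2 B2 assms(1) s] s]) (use that in force)
qed

text \<open>The time derivative of s = sqrt (2 t) is 1/s. It cancels the factor s in Stein's
  identity, so that \<psi>_t = \<psi>_xx; applied to \<open>\<psi>x\<close> the chain rule yields
  the formula for \<open>\<psi>xxx\<close> at once.\<close>

lemma \<psi>_derivs:
  shows "((\<lambda>x. \<psi> x t) has_real_derivative \<psi>x x t) (at x)"
    and "((\<lambda>x. \<psi>x x t) has_real_derivative \<psi>xx x t) (at x)"
    and "t > 0 \<Longrightarrow> ((\<lambda>x. \<psi>xx x t) has_real_derivative \<psi>xxx x t) (at x)"
    and "t > 0 \<Longrightarrow> ((\<lambda>t. \<psi> x t) has_real_derivative \<psi>xx x t) (at t)"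
    and "t > 0 \<Longrightarrow> ((\<lambda>t. \<psi>x x t) has_real_derivative \<psi>xxx x t) (at t)"
proof -
  obtain B0 where B0: "\<And>y. \<bar>P0 y\<bar> \<le> B0" using periodic_continuous_bounded[of P0] per0 c0 by metis
  obtain B1 where B1: "\<And>y. \<bar>P1 y\<bar> \<le> B1" using periodic_continuous_bounded[of P1] per1 c1 by metis
  obtain B2 where B2: "\<And>y. \<bar>P2 y\<bar> \<le> B2" using periodic_continuous_bounded[of P2] per2 c2 by metis
  show "((\<lambda>x. \<psi> x t) has_real_derivative \<psi>x x t) (at x)"
    unfolding \<psi>_def \<psi>x_def by (rule gauss_deriv_x[OF D0 B0 c1 B1])
  show "((\<lambda>x. \<psi>x x t) has_real_derivative \<psi>xx x t) (at x)"
    unfolding \<psi>x_def \<psi>xx_def by (rule gauss_deriv_x[OF D1 B1 c2 B2])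
  assume t: "t > 0"
  define s where "s = sqrt (2 * t)"
  have s: "s > 0" using t by (simp add: s_def)
  have sD: "((\<lambda>t. sqrt (2 * t)) has_real_derivative 1 / s) (at t)"
    using t by (auto intro!: derivative_eq_intros simp: s_def field_simps)
  have ibp: "gauss 0 P2 y s = gauss (Suc 0) P1 y s / s" for y
    using gauss_integration_by_parts[OF D1 B1 c2 B2, of y s] s by simp
  show "((\<lambda>x. \<psi>xx x t) has_real_derivative \<psi>xxx x t) (at x)"
    unfolding \<psi>xx_def \<psi>xxx_def s_def[symmetric] ibp
    using DERIV_cdivide[OF gauss_deriv_x[OF D1 B1 c2 B2, of "Suc 0" s x], of s] by simp
  show "((\<lambda>t. \<psi> x t) has_real_derivative \<psi>xx x t) (at t)"
    using DERIV_chain2[OF gauss_deriv_s[OF D0 B0 c1 B1, of 0 x "sqrt (2 * t)"] sD]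
    unfolding \<psi>_def \<psi>xx_def s_def[symmetric] ibp by simp
  show "((\<lambda>t. \<psi>x x t) has_real_derivative \<psi>xxx x t) (at t)"
    using DERIV_chain2[OF gauss_deriv_s[OF D1 B1 c2 B2, of 0 x "sqrt (2 * t)"] sD]
    unfolding \<psi>x_def \<psi>xxx_def s_def[symmetric] by simp
qed

text \<open>The chain rule through sqrt (2 t) fails at t = 0; there the derivative is obtained from
  its continuity up to the end point.\<close>

lemma \<psi>_deriv_t_within:
  assumes "t \<ge> 0" shows "((\<lambda>t. \<psi> x t) has_real_derivative \<psi>xx x t) (at t within {0..})"
proof (cases "t = 0")
  case True
  have "continuous_on {0..} (\<lambda>t. \<psi> x t)" "continuous_on {0..} (\<lambda>t. \<psi>xx x t)"
    by (rule \<psi>_continuous(1)[OF continuous_on_const continuous_on_id]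
             \<psi>_continuous(3)[OF continuous_on_const continuous_on_id])+
  then show ?thesis unfolding True
    by (intro one_sided_derivative_at_0[of "\<lambda>t. \<psi> x t" "\<lambda>t. \<psi>xx x t"] \<psi>_derivs(4))
next
  case False
  then have "t > 0" using assms by simp
  then show ?thesis by (rule has_field_derivative_at_within[OF \<psi>_derivs(4)])
qed

section \<open>The Burgers solution obtained from the heat solution\<close>

definition "u x t = - \<psi>x x t / \<psi> x t"
definition "ux x t = (u x t)\<^sup>2 - \<psi>xx x t / \<psi> x t"
definition "ut x t = - \<psi>xxx x t / \<psi> x t + \<psi>x x t * \<psi>xx x t / (\<psi> x t)\<^sup>2"
text \<open>Read off from the Burgers equation; that it is the x derivative of \<open>ux\<close> is
  part of \<open>u_deriv\<close> and expresses that u solves the equation for t > 0.\<close>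

definition "uxx x t = ut x t + 2 * u x t * ux x t"

lemma u_deriv:
  shows "((\<lambda>x. u x t) has_real_derivative ux x t) (at x)"
    and "t > 0 \<Longrightarrow> ((\<lambda>x. ux x t) has_real_derivative uxx x t) (at x)"
    and "t > 0 \<Longrightarrow> ((\<lambda>t. u x t) has_real_derivative ut x t) (at t)"
proof -
  have nz: "\<psi> x t \<noteq> 0" for x t using \<psi>_pos[of x t] by simp
  show 1: "((\<lambda>x. u x t) has_real_derivative ux x t) (at x)" for x
    unfolding u_def
    by (rule derivative_eq_intros \<psi>_derivs refl nz)+
       (use nz[of x t] in \<open>simp add: ux_def u_def field_simps power2_eq_square\<close>)
  assume t: "t > 0"
  show "((\<lambda>x. ux x t) has_real_derivative uxx x t) (at x)"
    unfolding ux_def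
    by (rule derivative_eq_intros \<psi>_derivs(1) \<psi>_derivs(3)[OF t] 1 refl nz)+
       (use nz[of x t] in \<open>simp add: uxx_def ut_def field_simps power2_eq_square\<close>)
  show "((\<lambda>t. u x t) has_real_derivative ut x t) (at t)"
    unfolding u_def
    by (rule derivative_eq_intros \<psi>_derivs(4)[OF t] \<psi>_derivs(5)[OF t] refl nz)+
       (use nz[of x t] in \<open>simp add: ut_def field_simps power2_eq_square\<close>)
qed

lemma u_continuous:
  assumes "continuous_on S a" "continuous_on S b"
  shows "continuous_on S (\<lambda>z. u (a z) (b z))" "continuous_on S (\<lambda>z. ux (a z) (b z))"
    "(\<And>z. z \<in> S \<Longrightarrow> b z > 0) \<Longrightarrow> continuous_on S (\<lambda>z. ut (a z) (b z))"
    "(\<And>z. z \<in> S \<Longrightarrow> b z > 0) \<Longrightarrow> continuous_on S (\<lambda>z. uxx (a z) (b z))"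
proof -
  have nz: "\<psi> x t \<noteq> 0" for x t using \<psi>_pos[of x t] by simp
  note c = \<psi>_continuous[OF assms]
  show 1: "continuous_on S (\<lambda>z. u (a z) (b z))" unfolding u_def
    by (intro continuous_intros c) (simp add: nz)
  show 2: "continuous_on S (\<lambda>z. ux (a z) (b z))" unfolding ux_def
    by (intro continuous_intros c 1) (simp add: nz)
  show 3: "continuous_on S (\<lambda>z. ut (a z) (b z))" if "\<And>z. z \<in> S \<Longrightarrow> b z > 0" unfolding ut_def
    by (intro continuous_intros c that) (simp_all add: nz)
  show "continuous_on S (\<lambda>z. uxx (a z) (b z))" if "\<And>z. z \<in> S \<Longrightarrow> b z > 0" unfolding uxx_def
    by (intro continuous_intros 1 2 3 that)
qed

lemma u_periodic: "periodic1 (\<lambda>x. u x t)"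
  by (simp add: periodic1_def u_def \<psi>_def \<psi>x_def gauss_periodic per0 per1)

lemma u_odd: "u (- x) t = - u x t"
  using gauss_reflect[of P0 1 x "sqrt (2 * t)"] gauss_reflect[of P1 "- 1" x "sqrt (2 * t)"] even0 odd1
  by (simp add: u_def \<psi>_def \<psi>x_def)

text \<open>An odd 1-periodic function vanishes at 1/2. In the new variables these zeros become the
  boundary values of w.\<close>

lemma u_half: "u (1/2) t = 0" "u (- (1/2)) t = 0"
  using periodic1_ends[OF u_periodic[of t]] u_odd[of "1/2" t] by simp_all

lemma u_initial: "u x 0 = - P1 x / P0 x"
  by (simp add: u_def \<psi>_def \<psi>x_def gauss_0_0)

lemma u_C_Rplus_H1: "C_Rplus_H1 u"
  unfolding C_Rplus_H1_def
proof (intro conjI allI impI)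
  fix t :: real assume t: "t \<ge> 0"
  show "(\<lambda>x. u x t) \<in> H1_per"
  proof -
    have "weak_deriv_per (\<lambda>x. u x t) (\<lambda>x. ux x t)"
      by (rule C1_periodic_weak_deriv[OF u_periodic u_deriv(1)]) (intro u_continuous continuous_intros)
    moreover have "continuous_on UNIV (\<lambda>x. u x t)" by (intro u_continuous continuous_intros)
    ultimately show ?thesis unfolding H1_per_def using u_periodic by blast
  qed
  have H: "H1_norm (\<lambda>x. u x s - u x t) = sqrt (ip (\<lambda>x. u x s - u x t) (\<lambda>x. u x s - u x t)
      + ip (\<lambda>x. ux x s - ux x t) (\<lambda>x. ux x s - ux x t))" for s
  proof (rule H1_norm_C1)
    show "periodic1 (\<lambda>x. u x s - u x t)"
      using u_periodic[of s] u_periodic[of t] by (simp add: periodic1_def)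
    show "((\<lambda>x. u x s - u x t) has_real_derivative ux x s - ux x t) (at x)" for x
      by (intro DERIV_diff u_deriv)
    show "continuous_on UNIV (\<lambda>x. ux x s - ux x t)"
      by (intro continuous_intros u_continuous)
  qed
  \<comment> \<open>Formulated for any jointly continuous g, so as to serve both \<open>u\<close>
    and \<open>ux\<close>.\<close>
  have c: "continuous_on UNIV (\<lambda>s. ip (\<lambda>x. g x s - g x t) (\<lambda>x. g x s - g x t))"
    if g: "\<And>S (a :: real \<times> real \<Rightarrow> real) b. continuous_on S a \<Longrightarrow> continuous_on S b \<Longrightarrow> continuous_on S (\<lambda>z. g (a z) (b z))"
    for g :: "real \<Rightarrow> real \<Rightarrow> real"
    unfolding ip_def circ_def cbox_interval[symmetric]
    by (rule integral_continuous_on_param) (auto simp: case_prod_beta intro!: continuous_intros g)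
  \<comment> \<open>Negative times are included because \<open>sqrt\<close> is extended to negative
    arguments as an odd continuous function.\<close>
  have "continuous_on UNIV (\<lambda>s. H1_norm (\<lambda>x. u x s - u x t))"
    unfolding H by (intro continuous_intros c u_continuous)
  then have "((\<lambda>s. H1_norm (\<lambda>x. u x s - u x t)) \<longlongrightarrow> H1_norm (\<lambda>x. u x t - u x t)) (at t)"
    unfolding continuous_on_def by blast
  moreover have "H1_norm (\<lambda>x. u x t - u x t) = 0" unfolding H ip_def by simp
  ultimately have "((\<lambda>s. H1_norm (\<lambda>x. u x s - u x t)) \<longlongrightarrow> 0) (at t)" by (simp only:)
  then show "((\<lambda>s. H1_norm (\<lambda>x. u x s - u x t)) \<longlongrightarrow> 0) (at t within {0..})"
    by (rule tendsto_within_subset) simp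
qed

text \<open>Since \<open>u = - (ln \<psi>)\<^sub>x\<close>, pairing \<open>u\<close> with \<open>\<phi>\<close> is pairing \<open>ln \<psi>\<close> with \<open>\<phi>'\<close>, and
  \<open>ln \<psi>\<close> is differentiable in time up to \<open>t = 0\<close> with derivative \<open>\<psi>\<^sub>x\<^sub>x / \<psi> = u\<^sup>2 - u\<^sub>x\<close>.\<close>

lemma u_weak_equation:
  assumes \<phi>: "test_per \<phi>" and t: "t \<ge> 0"
  shows "((\<lambda>s. LINT x:circ|lborel. u x s * \<phi> x) has_real_derivative
          (LINT x:circ|lborel. u x t * deriv (deriv \<phi>) x + (u x t)\<^sup>2 * deriv \<phi> x)) (at t within {0..})"
proof -
  note T = test_per_deriv[OF \<phi>]
  have nz: "\<psi> x t \<noteq> 0" for x t using \<psi>_pos[of x t] by simp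
  have per: "h (1/2) = h (- (1/2))" if "\<And>x. h (x + 1) = h x" for h :: "real \<Rightarrow> real"
    using that[of "- (1/2)"] by simp
  have cu: "continuous_on circ (\<lambda>x. u x s)" "continuous_on circ (\<lambda>x. ux x s)" for s
    by (intro u_continuous continuous_intros)+
  have lnD: "((\<lambda>x. - ln (\<psi> x s)) has_real_derivative u x s) (at x)" for x s
    by (rule derivative_eq_intros \<psi>_derivs \<psi>_pos refl)+ (simp add: u_def)
  have A: "(LINT x:circ|lborel. u x s * \<phi> x) = integral circ (\<lambda>x. ln (\<psi> x s) * deriv \<phi> x)" for s
  proof -
    have "\<psi> (1/2) s = \<psi> (- (1/2)) s"
      by (rule per[of "\<lambda>x. \<psi> x s"]) (simp add: \<psi>_def gauss_periodic per0)
    then have "integral circ (\<lambda>x. - ln (\<psi> x s) * deriv \<phi> x) = - integral circ (\<lambda>x. u x s * \<phi> x)"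
      by (intro circ_integral_by_parts lnD T(1) T(4) cu) (simp add: per[of \<phi>, OF T(6)])
    then show ?thesis
      by (subst circ_LINT) (auto intro!: continuous_intros cu T(3))
  qed
  have B: "integral circ (\<lambda>x. \<psi>xx x t / \<psi> x t * deriv \<phi> x)
     = (LINT x:circ|lborel. u x t * deriv (deriv \<phi>) x + (u x t)\<^sup>2 * deriv \<phi> x)"
  proof -
    have "integral circ (\<lambda>x. u x t * deriv (deriv \<phi>) x) = - integral circ (\<lambda>x. ux x t * deriv \<phi> x)"
      by (intro circ_integral_by_parts u_deriv T(2) T(5) cu) (simp add: u_half)
    moreover have "integral circ (\<lambda>x. \<psi>xx x t / \<psi> x t * deriv \<phi> x)
      = integral circ (\<lambda>x. (- 1) * (ux x t * deriv \<phi> x) + 1 * ((u x t)\<^sup>2 * deriv \<phi> x))"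
      by (rule integral_cong) (simp add: ux_def algebra_simps)
    moreover have "\<dots> = (- 1) * integral circ (\<lambda>x. ux x t * deriv \<phi> x) + 1 * integral circ (\<lambda>x. (u x t)\<^sup>2 * deriv \<phi> x)"
      by (rule integral_lin2) (intro continuous_intros cu T(4))+
    moreover have "(LINT x:circ|lborel. u x t * deriv (deriv \<phi>) x + (u x t)\<^sup>2 * deriv \<phi> x)
      = integral circ (\<lambda>x. u x t * deriv (deriv \<phi>) x) + integral circ (\<lambda>x. (u x t)\<^sup>2 * deriv \<phi> x)"
      by (subst circ_LINT, intro continuous_intros cu T(4) T(5),
          intro integral_add continuous_on_circ_integrable continuous_intros cu T(4) T(5))
    ultimately show ?thesis by simp
  qed
  \<comment> \<open>Differentiating under the integral over the convex parameter set {0..} covers t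
    = 0 together with t > 0.\<close>
  have "((\<lambda>s. integral (cbox (- (1/2)) (1/2)) (\<lambda>x. ln (\<psi> x s) * deriv \<phi> x)) has_real_derivative
     integral (cbox (- (1/2)) (1/2)) (\<lambda>x. \<psi>xx x t / \<psi> x t * deriv \<phi> x)) (at t within {0..})"
  proof (rule leibniz_rule_field_derivative[where U="{0..}" and f="\<lambda>s x. ln (\<psi> x s) * deriv \<phi> x"
        and fx="\<lambda>s x. \<psi>xx x s / \<psi> x s * deriv \<phi> x"])
    show "((\<lambda>s. ln (\<psi> x s) * deriv \<phi> x) has_real_derivative \<psi>xx x s / \<psi> x s * deriv \<phi> x) (at s within {0..})"
      if "s \<in> {0..}" for s x
      by (rule derivative_eq_intros \<psi>_deriv_t_within \<psi>_pos refl)+ (use that in auto)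
    show "(\<lambda>x. ln (\<psi> x s) * deriv \<phi> x) integrable_on cbox (- (1/2)) (1/2)" for s
      by (intro integrable_continuous continuous_intros \<psi>_continuous T(4)) (simp add: nz)
    show "continuous_on ({0..} \<times> cbox (- (1/2)) (1/2)) (\<lambda>(s, x). \<psi>xx x s / \<psi> x s * deriv \<phi> x)"
      unfolding case_prod_beta
      by (intro continuous_intros \<psi>_continuous continuous_on_compose2[OF T(4)[of UNIV]]) (auto simp: nz)
  qed (use t in auto)
  then show ?thesis unfolding A B[symmetric] by (simp add: circ_def)
qed

theorem u_burgers:
  assumes "\<And>x. x \<in> circ \<Longrightarrow> u\<^sub>0 x = - P1 x / P0 x"
  shows "burgers_solution u\<^sub>0 u"
  unfolding burgers_solution_def using u_C_Rplus_H1 u_weak_equation u_initial assms by auto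

end

subsection \<open>Initial data\<close>

lemma continuous_antiderivative:
  fixes h :: "real \<Rightarrow> real"
  assumes "continuous_on UNIV h"
  obtains H where "\<And>x. (H has_real_derivative h x) (at x)" "H 0 = 0"
proof -
  have "\<exists>F. \<forall>x::real. -\<infinity> < ereal x \<longrightarrow> ereal x < \<infinity> \<longrightarrow> (F has_vector_derivative h x) (at x)"
    by (rule einterval_antiderivative) (use assms in \<open>auto simp: continuous_on_eq_continuous_at\<close>)
  then obtain F where F: "\<And>x. (F has_real_derivative h x) (at x)"
    by (auto simp: has_real_derivative_iff_has_vector_derivative)
  show ?thesis
    by (rule that[of "\<lambda>x. F x - F 0"]) (auto intro!: derivative_eq_intros F)
qed

lemma DERIV_reflect:
  assumes "\<And>x. (F has_real_derivative f x) (at x)"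
  shows "((\<lambda>x. F (- x)) has_real_derivative - f (- x)) (at x)"
proof -
  have "((\<lambda>x. F (- x)) has_real_derivative f (- x) * (- 1)) (at x)"
    by (rule DERIV_chain2[OF assms]) (auto intro!: derivative_eq_intros)
  then show ?thesis by simp
qed

text \<open>The derivative is extended instead of the function: composed with \<open>tri\<close> it
  is continuous, even and periodic without any matching at the ends. Integrating twice gives the
  extension U of u_0 and a potential V, and P0 = exp (- V) inverts u = - \<psi>_x / \<psi>.\<close>

lemma cole_hopf_initial_data:
  assumes k: "k > 0" and f: "C1_on f {- (1/2)..1/2}" and odd: "\<forall>x\<in>{- (1/2)..1/2}. f (- x) = - f x"
    and f1: "f (1/2) = 1"
  obtains P0 P1 P2 where "heat_data P0 P1 P2" "\<And>x. x \<in> circ \<Longrightarrow> 4 * k * (2 * x - f x) = - P1 x / P0 x"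
proof -
  obtain f' where f': "\<And>x. x \<in> {- (1/2)..1/2} \<Longrightarrow> (f has_real_derivative f' x) (at x within {- (1/2)..1/2})"
    and f'c: "continuous_on {- (1/2)..1/2} f'" using f unfolding C1_on_def by blast
  \<comment> \<open>the distance to the nearest integer, through which the even function \<open>f'\<close> extends periodically\<close>
  define tri where "tri = (\<lambda>x. arccos (cos (2 * pi * x)) / (2 * pi))"
  have tri_range: "tri x \<in> {- (1/2)..1/2}" for x
    using arccos_lbound[of "cos (2 * pi * x)"] arccos_ubound[of "cos (2 * pi * x)"]
    by (auto simp: tri_def field_simps intro: order_trans[of _ 0])
  have tri_id: "tri x = x" if "x \<in> {0..1/2}" for x
    using that by (simp add: tri_def arccos_cos)
  have tri_per: "tri (x + 1) = tri x" for x by (simp add: tri_def distrib_left)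
  have tri_even: "tri (- x) = tri x" for x by (simp add: tri_def)
  have tri_cont: "continuous_on UNIV tri"
    unfolding tri_def by (intro continuous_intros) auto
  define h where "h = (\<lambda>x. 4 * k * (2 - f' (tri x)))"
  have hc: "continuous_on UNIV h" unfolding h_def
    by (intro continuous_intros continuous_on_compose2[OF f'c tri_cont]) (use tri_range in auto)
  obtain U where U: "\<And>x. (U has_real_derivative h x) (at x)" and U0: "U 0 = 0"
    using continuous_antiderivative[OF hc] by metis
  have U_odd: "U (- x) = - U x" for x
  proof -
    have "\<forall>x. ((\<lambda>x. U (- x) + U x) has_real_derivative 0) (at x)"
      using DERIV_add[OF DERIV_reflect[OF U] U] by (simp add: h_def tri_even)
    from DERIV_isconst_all[OF this, of x 0] show ?thesis by (simp add: U0)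
  qed
  have f0: "f 0 = 0" using bspec[OF odd, of 0] by simp
  \<comment> \<open>Compared on the right half only, where \<open>tri\<close> is the identity;
    oddness of f and U takes care of the left half.\<close>
  have U_right: "U x = 4 * k * (2 * x - f x)" if x: "x \<in> {0..1/2}" for x
  proof -
    have "((\<lambda>x. U x - 4 * k * (2 * x - f x)) has_real_derivative 0) (at y within {0..1/2})"
      if y: "y \<in> {0..1/2}" for y
    proof -
      have "(f has_real_derivative f' y) (at y within {0..1/2})"
        by (rule DERIV_subset[OF f']) (use y in auto)
      then show ?thesis
        by (auto intro!: derivative_eq_intros has_field_derivative_at_within[OF U] simp: h_def tri_id[OF y])
    qed
    then obtain c where c: "\<forall>y\<in>{0..1/2}. U y - 4 * k * (2 * y - f y) = c"
      using has_field_derivative_zero_constant[of "{0..1/2}" "\<lambda>x. U x - 4 * k * (2 * x - f x)"] by auto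
    show ?thesis using bspec[OF c x] bspec[OF c, of 0] by (simp add: U0 f0)
  qed
  have U_circ: "U x = 4 * k * (2 * x - f x)" if x: "x \<in> circ" for x
  proof (cases "x \<ge> 0")
    case True
    then show ?thesis using U_right x by (simp add: circ_def)
  next
    case False
    then have "U (- x) = 4 * k * (2 * (- x) - f (- x))" using x by (intro U_right) (simp add: circ_def)
    moreover have "f (- x) = - f x" using odd x by (simp add: circ_def)
    ultimately show ?thesis using U_odd[of x] by (simp add: algebra_simps)
  qed
  have U_per: "U (x + 1) = U x" for x
  proof -
    have "\<forall>x. ((\<lambda>x. U (x + 1) - U x) has_real_derivative 0) (at x)"
    proof
      fix x
      have "((\<lambda>x. U (x + 1)) has_real_derivative h (x + 1)) (at x)" using U by (simp add: DERIV_shift[symmetric])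
      from DERIV_diff[OF this U] show "((\<lambda>x. U (x + 1) - U x) has_real_derivative 0) (at x)"
        by (simp add: h_def tri_per)
    qed
    \<comment> \<open>The constant is U(1/2) - U(- 1/2) = 2 U(1/2) = 8 k (1 - f(1/2)), and this is
      where f(1/2) = 1 enters.\<close>
    from DERIV_isconst_all[OF this, of x "- (1/2)"] show ?thesis
      using U_odd[of "1/2"] U_right[of "1/2"] f1 by simp
  qed
  obtain V where V: "\<And>x. (V has_real_derivative U x) (at x)"
    using continuous_antiderivative[OF DERIV_everywhere_continuous_on[OF U]] by blast
  have V_even: "V (- x) = V x" for x
  proof -
    have "\<forall>x. ((\<lambda>x. V (- x) - V x) has_real_derivative 0) (at x)"
      using DERIV_diff[OF DERIV_reflect[OF V] V] by (simp add: U_odd)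
    from DERIV_isconst_all[OF this, of x 0] show ?thesis by simp
  qed
  have V_per: "V (x + 1) = V x" for x
  proof -
    have "\<forall>x. ((\<lambda>x. V (x + 1) - V x) has_real_derivative 0) (at x)"
    proof
      fix x
      have "((\<lambda>x. V (x + 1)) has_real_derivative U (x + 1)) (at x)" using V by (simp add: DERIV_shift[symmetric])
      from DERIV_diff[OF this V] show "((\<lambda>x. V (x + 1) - V x) has_real_derivative 0) (at x)"
        by (simp add: U_per)
    qed
    from DERIV_isconst_all[OF this, of x "- (1/2)"] show ?thesis
      using V_even[of "1/2"] by simp
  qed
  show ?thesis
  proof (rule that[of "\<lambda>x. exp (- V x)" "\<lambda>x. - U x * exp (- V x)" "\<lambda>x. ((U x)\<^sup>2 - h x) * exp (- V x)"])
    show "heat_data (\<lambda>x. exp (- V x)) (\<lambda>x. - U x * exp (- V x)) (\<lambda>x. ((U x)\<^sup>2 - h x) * exp (- V x))"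
    proof
      fix y
      show "((\<lambda>x. exp (- V x)) has_real_derivative - U y * exp (- V y)) (at y)"
        by (auto intro!: derivative_eq_intros V)
      show "((\<lambda>x. - U x * exp (- V x)) has_real_derivative ((U y)\<^sup>2 - h y) * exp (- V y)) (at y)"
        by (auto intro!: derivative_eq_intros V U simp: power2_eq_square algebra_simps)
      show "continuous_on UNIV (\<lambda>x. ((U x)\<^sup>2 - h x) * exp (- V x))"
        by (intro continuous_intros hc DERIV_everywhere_continuous_on[OF U] DERIV_everywhere_continuous_on[OF V])
    qed (simp_all add: V_per V_even)
    show "4 * k * (2 * x - f x) = - (- U x * exp (- V x)) / exp (- V x)" if "x \<in> circ" for x
      using U_circ[OF that] by simp
  qed
qed

subsection \<open>The equation on the shrinking domain\<close>

text \<open>The closed domain cut off at time T. For T < k it is compact and avoids the tip, so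
  continuous functions on the parabolic closure attain their maxima on it.\<close>

definition trapezoid :: "real \<Rightarrow> real \<Rightarrow> (real \<times> real) set" where
  "trapezoid k T = {(\<xi>, \<tau>). 0 \<le> \<tau> \<and> \<tau> \<le> T \<and> \<bar>\<xi>\<bar> \<le> 2 * (k - \<tau>)}"

lemma compact_trapezoid: "compact (trapezoid k T)"
proof -
  have "closed {q::real \<times> real. 0 \<le> snd q \<and> snd q \<le> T \<and> \<bar>fst q\<bar> \<le> 2 * (k - snd q)}"
    by (intro closed_Collect_conj closed_Collect_le continuous_intros)
  moreover have "trapezoid k T = {q. 0 \<le> snd q \<and> snd q \<le> T \<and> \<bar>fst q\<bar> \<le> 2 * (k - snd q)}"
    by (auto simp: trapezoid_def)
  moreover have "bounded (trapezoid k T)"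
    by (rule bounded_subset[of "{- (2 * k)..2 * k} \<times> {0..T}"])
       (auto simp: trapezoid_def bounded_Times)
  ultimately show ?thesis by (simp add: compact_eq_bounded_closed)
qed

text \<open>If D were positive, g' would be positive just to the right of its zero a, and the mean
  value theorem would make g larger there.\<close>

lemma second_derivative_at_max:
  fixes g g' :: "real \<Rightarrow> real"
  assumes g: "\<And>y. \<bar>y - a\<bar> < r \<Longrightarrow> (g has_real_derivative g' y) (at y)" and "r > 0"
    and D: "(g' has_real_derivative D) (at a)" and m: "\<And>y. \<bar>y - a\<bar> < r \<Longrightarrow> g y \<le> g a"
  shows "g' a = 0" "D \<le> 0"
proof -
  show z: "g' a = 0"
    by (rule DERIV_local_max[OF g[of a] \<open>r > 0\<close>]) (use m \<open>r > 0\<close> in \<open>auto simp: abs_minus_commute\<close>)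
  show "D \<le> 0"
  proof (rule ccontr)
    assume "\<not> D \<le> 0"
    then obtain d where d: "d > 0" "\<And>h. h > 0 \<Longrightarrow> h < d \<Longrightarrow> g' a < g' (a + h)"
      using DERIV_pos_inc_right[OF D] by auto
    define e where "e = min d r / 2"
    have e: "e > 0" "e < d" "e < r" using d(1) \<open>r > 0\<close> by (auto simp: e_def min_def)
    have "\<exists>z. a < z \<and> z < a + e \<and> g (a + e) - g a = (a + e - a) * g' z"
      by (rule MVT2) (use e in \<open>auto intro!: g\<close>)
    then obtain z where z': "a < z" "z < a + e" "g (a + e) - g a = e * g' z" by auto
    have "g' z > 0" using d(2)[of "z - a"] z' e z by simp
    then have "g (a + e) > g a" using z' e by (simp add: algebra_simps)
    then show False using m[of "a + e"] e by simp
  qed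
qed

text \<open>The maximum may lie on the top line \<tau> = T, so only earlier times can be compared
  and the sign of the derivative is all that follows.\<close>

lemma left_derivative_at_max:
  fixes F :: "real \<Rightarrow> real"
  assumes D: "(F has_real_derivative D) (at b)" and "b > 0" and m: "\<And>t. t \<in> {0..b} \<Longrightarrow> F t \<le> F b"
  shows "D \<ge> 0"
proof (rule ccontr)
  assume "\<not> D \<ge> 0"
  then obtain d where d: "d > 0" "\<And>h. h > 0 \<Longrightarrow> h < d \<Longrightarrow> F b < F (b - h)"
    using DERIV_neg_dec_left[OF D] by auto
  define h where "h = min d b / 2"
  have "h > 0" "h < d" "h < b" using d(1) \<open>b > 0\<close> by (auto simp: h_def min_def)
  then show False using d(2)[of h] m[of "b - h"] by auto
qed

lemma shrinking_burgers_solution_derivs: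
  assumes "shrinking_burgers_solution k f v"
  obtains vt vx vxx where "\<And>\<xi> \<tau>. (\<xi>, \<tau>) \<in> shrinking_dom k \<Longrightarrow>
       ((\<lambda>s. v \<xi> s) has_real_derivative vt \<xi> \<tau>) (at \<tau>) \<and>
       ((\<lambda>y. v y \<tau>) has_real_derivative vx \<xi> \<tau>) (at \<xi>) \<and>
       ((\<lambda>y. vx y \<tau>) has_real_derivative vxx \<xi> \<tau>) (at \<xi>) \<and>
       vt \<xi> \<tau> = 2 * v \<xi> \<tau> * vx \<xi> \<tau> + vxx \<xi> \<tau>"
proof -
  from assms obtain vt vx vxx where "\<forall>(\<xi>, \<tau>) \<in> shrinking_dom k.
       ((\<lambda>s. v \<xi> s) has_real_derivative vt \<xi> \<tau>) (at \<tau>) \<and>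
       ((\<lambda>y. v y \<tau>) has_real_derivative vx \<xi> \<tau>) (at \<xi>) \<and>
       ((\<lambda>y. vx y \<tau>) has_real_derivative vxx \<xi> \<tau>) (at \<xi>) \<and>
       vt \<xi> \<tau> = 2 * v \<xi> \<tau> * vx \<xi> \<tau> + vxx \<xi> \<tau>"
    unfolding shrinking_burgers_solution_def by (elim conjE exE) (rule that)
  then show ?thesis by (intro that) (drule (1) bspec, simp only: prod.case)
qed

text \<open>Maximum principle: the difference \<open>z = v - w\<close> satisfies
  \<open>z\<^sub>\<tau> = z\<^sub>\<xi>\<^sub>\<xi> + 2 v z\<^sub>\<xi> + 2 w\<^sub>\<xi> z\<close>, so \<open>\<sigma> z exp (- (2 C + 1) \<tau>)\<close> has no positive interior maximum when
  \<open>w\<^sub>\<xi> \<le> C\<close>.\<close>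

lemma shrinking_burgers_comparison:
  assumes v: "shrinking_burgers_solution k f v" and w: "shrinking_burgers_solution k f w"
    and C: "\<And>\<xi> \<tau> d. (\<xi>, \<tau>) \<in> shrinking_dom k \<Longrightarrow> \<tau> \<le> T \<Longrightarrow>
      ((\<lambda>y. w y \<tau>) has_real_derivative d) (at \<xi>) \<Longrightarrow> d \<le> C"
    and T: "T < k" and \<sigma>: "\<sigma> \<in> {1, - 1}" and p: "(y, s) \<in> trapezoid k T"
  shows "\<sigma> * (v y s - w y s) \<le> 0"
proof (rule ccontr)
  assume neg: "\<not> \<sigma> * (v y s - w y s) \<le> 0"
  \<comment> \<open>At a positive maximum L z \<le> z_\<tau> \<le> 2 w_\<xi> z \<le> 2 C z for z =
    \<sigma> (v - w); any L above 2 C contradicts this.\<close>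
  define L where "L = 2 * C + 1"
  define G where "G = (\<lambda>(\<xi>, \<tau>). exp (- L * \<tau>) * (\<sigma> * (v \<xi> \<tau> - w \<xi> \<tau>)))"
  have sub: "trapezoid k T \<subseteq> shrinking_dom_closed k"
    using T by (auto simp: trapezoid_def shrinking_dom_closed_def)
  have cv: "continuous_on (trapezoid k T) (\<lambda>(\<xi>, \<tau>). v \<xi> \<tau>)" "continuous_on (trapezoid k T) (\<lambda>(\<xi>, \<tau>). w \<xi> \<tau>)"
    using v w continuous_on_subset[OF _ sub] by (auto simp: shrinking_burgers_solution_def)
  have "continuous_on (trapezoid k T) G"
    using cv unfolding G_def case_prod_beta by (intro continuous_intros)
  then obtain m where m: "m \<in> trapezoid k T" "\<And>q. q \<in> trapezoid k T \<Longrightarrow> G q \<le> G m"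
    using continuous_attains_sup[OF compact_trapezoid, of k T G] p by blast
  obtain a b where ab: "m = (a, b)" by (cases m)
  note mt = m(1)[unfolded ab]
  have G_pos: "G (a, b) > 0"
  proof -
    have "G (y, s) > 0" using neg by (simp add: G_def)
    then show ?thesis using m(2)[OF p] by (simp add: ab)
  qed
  then have z_pos: "\<sigma> * (v a b - w a b) > 0" by (simp add: G_def zero_less_mult_iff)
  \<comment> \<open>On the initial line and on the lateral boundary both solutions have the same
    prescribed values, so the positive maximum lies inside or on the top line.\<close>
  have "b \<noteq> 0"
  proof
    assume "b = 0"
    then have "v a b = w a b" using mt v w by (auto simp: trapezoid_def shrinking_burgers_solution_def)
    then show False using z_pos by simp
  qed
  then have b: "0 < b" "b \<le> T" "b < k" using mt T by (auto simp: trapezoid_def)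
  have "\<bar>a\<bar> \<noteq> 2 * (k - b)"
  proof
    assume "\<bar>a\<bar> = 2 * (k - b)"
    then have "a = 2 * (k - b) \<or> a = - (2 * (k - b))" by linarith
    then have "v a b = w a b" using b v w by (auto simp: shrinking_burgers_solution_def)
    then show False using z_pos by simp
  qed
  then have a: "\<bar>a\<bar> < 2 * (k - b)" using mt by (auto simp: trapezoid_def)
  have dom: "(\<xi>, b) \<in> shrinking_dom k" if "\<bar>\<xi>\<bar> < 2 * (k - b)" for \<xi>
    using that b by (simp add: shrinking_dom_def)
  obtain vt vx vxx where V: "\<And>\<xi> \<tau>. (\<xi>, \<tau>) \<in> shrinking_dom k \<Longrightarrow>
       ((\<lambda>s. v \<xi> s) has_real_derivative vt \<xi> \<tau>) (at \<tau>) \<and>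
       ((\<lambda>y. v y \<tau>) has_real_derivative vx \<xi> \<tau>) (at \<xi>) \<and>
       ((\<lambda>y. vx y \<tau>) has_real_derivative vxx \<xi> \<tau>) (at \<xi>) \<and>
       vt \<xi> \<tau> = 2 * v \<xi> \<tau> * vx \<xi> \<tau> + vxx \<xi> \<tau>"
    by (rule shrinking_burgers_solution_derivs[OF v]) (rule that)
  obtain wt wx wxx where W: "\<And>\<xi> \<tau>. (\<xi>, \<tau>) \<in> shrinking_dom k \<Longrightarrow>
       ((\<lambda>s. w \<xi> s) has_real_derivative wt \<xi> \<tau>) (at \<tau>) \<and>
       ((\<lambda>y. w y \<tau>) has_real_derivative wx \<xi> \<tau>) (at \<xi>) \<and>
       ((\<lambda>y. wx y \<tau>) has_real_derivative wxx \<xi> \<tau>) (at \<xi>) \<and>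
       wt \<xi> \<tau> = 2 * w \<xi> \<tau> * wx \<xi> \<tau> + wxx \<xi> \<tau>"
    by (rule shrinking_burgers_solution_derivs[OF w]) (rule that)
  define r where "r = 2 * (k - b) - \<bar>a\<bar>"
  have r: "r > 0" using a by (simp add: r_def)
  have in_r: "\<bar>\<xi>\<bar> < 2 * (k - b)" if "\<bar>\<xi> - a\<bar> < r" for \<xi> using that by (simp add: r_def)
  have max_x: "\<sigma> * (v \<xi> b - w \<xi> b) \<le> \<sigma> * (v a b - w a b)" if "\<bar>\<xi> - a\<bar> < r" for \<xi>
  proof -
    have "(\<xi>, b) \<in> trapezoid k T" using in_r[OF that] b by (auto simp: trapezoid_def)
    from m(2)[OF this] show ?thesis by (simp add: G_def ab)
  qed
  have Dx: "((\<lambda>\<xi>. \<sigma> * (v \<xi> b - w \<xi> b)) has_real_derivative \<sigma> * (vx \<xi> b - wx \<xi> b)) (at \<xi>)"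
    if "\<bar>\<xi> - a\<bar> < r" for \<xi>
    using V[OF dom[OF in_r[OF that]]] W[OF dom[OF in_r[OF that]]] by (intro DERIV_cmult DERIV_diff) auto
  have Dxx: "((\<lambda>\<xi>. \<sigma> * (vx \<xi> b - wx \<xi> b)) has_real_derivative \<sigma> * (vxx a b - wxx a b)) (at a)"
    using V[OF dom[OF a]] W[OF dom[OF a]] by (intro DERIV_cmult DERIV_diff) auto
  note sp = second_derivative_at_max[OF Dx r Dxx max_x]
  have Dt: "((\<lambda>\<tau>. exp (- L * \<tau>) * (\<sigma> * (v a \<tau> - w a \<tau>))) has_real_derivative
      - L * exp (- L * b) * (\<sigma> * (v a b - w a b)) + (\<sigma> * (vt a b - wt a b)) * exp (- L * b)) (at b)"
  proof (rule DERIV_mult)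
    show "((\<lambda>\<tau>. exp (- L * \<tau>)) has_real_derivative - L * exp (- L * b)) (at b)"
      by (auto intro!: derivative_eq_intros)
    show "((\<lambda>\<tau>. \<sigma> * (v a \<tau> - w a \<tau>)) has_real_derivative \<sigma> * (vt a b - wt a b)) (at b)"
      using V[OF dom[OF a]] W[OF dom[OF a]] by (intro DERIV_cmult DERIV_diff) auto
  qed
  have "0 \<le> - L * exp (- L * b) * (\<sigma> * (v a b - w a b)) + (\<sigma> * (vt a b - wt a b)) * exp (- L * b)"
  proof (rule left_derivative_at_max[OF Dt b(1)])
    fix t assume t: "t \<in> {0..b}"
    have "(a, t) \<in> trapezoid k T" using t a b by (auto simp: trapezoid_def)
    from m(2)[OF this] show "exp (- L * t) * (\<sigma> * (v a t - w a t)) \<le> exp (- L * b) * (\<sigma> * (v a b - w a b))"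
      by (simp add: G_def ab)
  qed
  then have "0 \<le> exp (- L * b) * (\<sigma> * (vt a b - wt a b) - L * (\<sigma> * (v a b - w a b)))"
    by (simp add: algebra_simps)
  then have t: "L * (\<sigma> * (v a b - w a b)) \<le> \<sigma> * (vt a b - wt a b)"
    by (simp add: zero_le_mult_iff)
  \<comment> \<open>The first-order term 2 v z_\<xi> drops out at the maximum, which is why no bound
    on v occurs.\<close>
  have "vx a b = wx a b" using sp(1) \<sigma> by auto
  then have "\<sigma> * (vt a b - wt a b) = \<sigma> * (vxx a b - wxx a b) + 2 * wx a b * (\<sigma> * (v a b - w a b))"
    using V[OF dom[OF a]] W[OF dom[OF a]] by (simp add: algebra_simps)
  moreover have "wx a b * (\<sigma> * (v a b - w a b)) \<le> C * (\<sigma> * (v a b - w a b))"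
    using C[OF dom[OF a] b(2)] W[OF dom[OF a]] z_pos by (intro mult_right_mono) auto
  ultimately show False using t sp(2) z_pos by (simp add: L_def algebra_simps)
qed

text \<open>The bound is stated for every derivative value d because the derivative functions in the
  definition of a solution are existentially quantified. It may depend on T, as compactness is
  available only below the tip; a given point needs just T = s.\<close>

lemma shrinking_burgers_unique:
  assumes v: "shrinking_burgers_solution k f v" and w: "shrinking_burgers_solution k f w"
    and C: "\<And>T. T < k \<Longrightarrow> \<exists>C. \<forall>\<xi> \<tau> d. (\<xi>, \<tau>) \<in> shrinking_dom k \<longrightarrow> \<tau> \<le> T \<longrightarrow>
      ((\<lambda>y. w y \<tau>) has_real_derivative d) (at \<xi>) \<longrightarrow> d \<le> C"
    and p: "(y, s) \<in> shrinking_dom_closed k"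
  shows "v y s = w y s"
proof -
  have s: "s < k" "(y, s) \<in> trapezoid k s" using p by (auto simp: shrinking_dom_closed_def trapezoid_def)
  obtain C where C: "\<And>\<xi> \<tau> d. (\<xi>, \<tau>) \<in> shrinking_dom k \<Longrightarrow> \<tau> \<le> s \<Longrightarrow>
      ((\<lambda>y. w y \<tau>) has_real_derivative d) (at \<xi>) \<Longrightarrow> d \<le> C" using C[OF s(1)] by blast
  have "\<sigma> * (v y s - w y s) \<le> 0" if "\<sigma> \<in> {1, - 1}" for \<sigma>
    by (rule shrinking_burgers_comparison[OF v w _ s(1) that s(2)]) (rule C)
  from this[of 1] this[of "- 1"] show ?thesis by simp
qed

text \<open>Joint continuity is asked of the x derivative alone, which for \<open>u\<close> holds on
  the whole plane. The time derivative, available for t > 0 only, enters at the single point of the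
  curve.\<close>

lemma DERIV_along_curve:
  fixes g gx gt :: "real \<Rightarrow> real \<Rightarrow> real"
  assumes gx: "\<And>x t. ((\<lambda>x. g x t) has_real_derivative gx x t) (at x)"
    and gt: "((\<lambda>t. g (X s) t) has_real_derivative gt (X s) (\<theta> s)) (at (\<theta> s))"
    and cont: "continuous_on UNIV (\<lambda>(t, x). gx x t)"
    and X: "(X has_real_derivative X') (at s)" and \<theta>: "(\<theta> has_real_derivative \<theta>') (at s)"
  shows "((\<lambda>s. g (X s) (\<theta> s)) has_real_derivative gx (X s) (\<theta> s) * X' + gt (X s) (\<theta> s) * \<theta>') (at s)"
proof -
  have D: "((\<lambda>(t, x). g x t) has_derivative
      (\<lambda>(dt, dx). gt (X s) (\<theta> s) * dt + blinfun_scaleR_left (gx (X s) (\<theta> s)) dx)) (at (\<theta> s, X s) within UNIV \<times> UNIV)"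
  proof (rule has_derivative_partialsI[where fy="\<lambda>t x. blinfun_scaleR_left (gx x t)"])
    show "((\<lambda>t. g (X s) t) has_derivative (\<lambda>dt. gt (X s) (\<theta> s) * dt)) (at (\<theta> s) within UNIV)"
      using gt by (simp add: has_field_derivative_def)
    show "((\<lambda>x. g x t) has_derivative blinfun_apply (blinfun_scaleR_left (gx x t))) (at x within UNIV)" for x t
    proof -
      have "blinfun_apply (blinfun_scaleR_left (gx x t)) = (*) (gx x t)" by (rule ext) simp
      then show ?thesis using gx[where x=x and t=t] by (simp add: has_field_derivative_def)
    qed
    have "isCont (\<lambda>p. gx (snd p) (fst p)) (\<theta> s, X s)"
      using cont by (simp add: continuous_on_eq_continuous_at case_prod_beta)
    from bounded_linear.isCont[OF bounded_linear_blinfun_scaleR_left this]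
    show "continuous (at (\<theta> s, X s) within UNIV \<times> UNIV) (\<lambda>(t, x). blinfun_scaleR_left (gx x t))"
      by (simp add: case_prod_beta')
  qed auto
  have P: "((\<lambda>s. (\<theta> s, X s)) has_derivative (\<lambda>h. (\<theta>' * h, X' * h))) (at s)"
    using X \<theta> by (intro has_derivative_Pair) (simp_all add: has_field_derivative_def)
  have "((\<lambda>s. (\<lambda>(t, x). g x t) (\<theta> s, X s)) has_derivative
     (\<lambda>h. (\<lambda>(dt, dx). gt (X s) (\<theta> s) * dt + blinfun_scaleR_left (gx (X s) (\<theta> s)) dx) (\<theta>' * h, X' * h))) (at s)"
    by (rule has_derivative_compose[OF P D[unfolded UNIV_Times_UNIV]])
  then show ?thesis
    by (simp add: has_field_derivative_def) (rule has_derivative_eq_rhs, assumption, auto simp: algebra_simps)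
qed

section \<open>The change of variables between the circle and the shrinking domain\<close>

context heat_data
begin

text \<open>The relation u = p (2 x - w) solved for w. As k - \<tau> = k / (1 + 16 k t), the old
  quantities are p = 4 (k - \<tau>), x = \<xi> / p and t = \<tau> / (16 k (k - \<tau>)).\<close>

definition shrunk :: "real \<Rightarrow> real \<Rightarrow> real \<Rightarrow> real" where
  "shrunk k \<xi> \<tau> = 2 * \<xi> / (4 * (k - \<tau>)) - u (\<xi> / (4 * (k - \<tau>))) (\<tau> / (16 * k * (k - \<tau>))) / (4 * (k - \<tau>))"

definition shrunk_x :: "real \<Rightarrow> real \<Rightarrow> real \<Rightarrow> real" where
  "shrunk_x k \<xi> \<tau> = (2 - ux (\<xi> / (4 * (k - \<tau>))) (\<tau> / (16 * k * (k - \<tau>))) / (4 * (k - \<tau>))) / (4 * (k - \<tau>))"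

definition shrunk_xx :: "real \<Rightarrow> real \<Rightarrow> real \<Rightarrow> real" where
  "shrunk_xx k \<xi> \<tau> = - uxx (\<xi> / (4 * (k - \<tau>))) (\<tau> / (16 * k * (k - \<tau>))) / (4 * (k - \<tau>)) ^ 3"

text \<open>Prescribed by the equation for w; that it is the time derivative of
  \<open>shrunk\<close> is the content of \<open>shrunk_deriv_t\<close>.\<close>

definition shrunk_t :: "real \<Rightarrow> real \<Rightarrow> real \<Rightarrow> real" where
  "shrunk_t k \<xi> \<tau> = 2 * shrunk k \<xi> \<tau> * shrunk_x k \<xi> \<tau> + shrunk_xx k \<xi> \<tau>"

lemma shrunk_deriv_x:
  assumes "\<tau> < k"
  shows "((\<lambda>y. shrunk k y \<tau>) has_real_derivative shrunk_x k \<xi> \<tau>) (at \<xi>)"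
    and "0 < \<tau> \<Longrightarrow> ((\<lambda>y. shrunk_x k y \<tau>) has_real_derivative shrunk_xx k \<xi> \<tau>) (at \<xi>)"
proof -
  define q where "q = 4 * (k - \<tau>)"
  define \<theta> where "\<theta> = \<tau> / (16 * k * (k - \<tau>))"
  have q: "q \<noteq> 0" using assms by (simp add: q_def)
  have s: "((\<lambda>y. y / q) has_real_derivative 1 / q) (at \<xi>)" using q by (auto intro!: derivative_eq_intros)
  have 1: "((\<lambda>y. u (y / q) \<theta>) has_real_derivative ux (\<xi> / q) \<theta> * (1 / q)) (at \<xi>)"
    by (rule DERIV_chain2[OF u_deriv(1) s])
  show "((\<lambda>y. shrunk k y \<tau>) has_real_derivative shrunk_x k \<xi> \<tau>) (at \<xi>)"
    unfolding shrunk_def shrunk_x_def q_def[symmetric] \<theta>_def[symmetric]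
    by (rule derivative_eq_intros 1 refl q)+ (use q in \<open>simp add: field_simps\<close>)
  assume "0 < \<tau>"
  then have "\<theta> > 0" using assms by (simp add: \<theta>_def)
  then have 2: "((\<lambda>y. ux (y / q) \<theta>) has_real_derivative uxx (\<xi> / q) \<theta> * (1 / q)) (at \<xi>)"
    by (intro DERIV_chain2[OF u_deriv(2) s])
  show "((\<lambda>y. shrunk_x k y \<tau>) has_real_derivative shrunk_xx k \<xi> \<tau>) (at \<xi>)"
    unfolding shrunk_x_def shrunk_xx_def q_def[symmetric] \<theta>_def[symmetric]
    by (rule derivative_eq_intros 2 refl q)+ (use q in \<open>simp add: field_simps power3_eq_cube\<close>)
qed

text \<open>With q = 4 (k - \<tau>), the old variables x and t have \<tau> derivatives 4 x / q and 1
  / q^2. The transport term caused by the first matches the product of the linear part 2 x of w with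
  u_x in 2 w w_\<xi>, and \<open>uxx_def\<close> absorbs the remaining u u_x.\<close>

lemma shrunk_deriv_t:
  assumes \<tau>: "0 < \<tau>" "\<tau> < k"
  shows "((\<lambda>s. shrunk k \<xi> s) has_real_derivative shrunk_t k \<xi> \<tau>) (at \<tau>)"
proof -
  define q where "q = 4 * (k - \<tau>)"
  define X where "X = (\<lambda>s. \<xi> / (4 * (k - s)))"
  define \<theta> where "\<theta> = (\<lambda>s. s / (16 * k * (k - s)))"
  have q: "q > 0" using \<tau> by (simp add: q_def)
  have \<theta>0: "\<theta> \<tau> > 0" using \<tau> by (simp add: \<theta>_def)
  have X': "(X has_real_derivative 4 * X \<tau> / q) (at \<tau>)"
    unfolding X_def using \<tau> by (auto intro!: derivative_eq_intros simp: q_def field_simps)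
  have \<theta>': "(\<theta> has_real_derivative 1 / q\<^sup>2) (at \<tau>)"
  proof -
    have "(\<theta> has_real_derivative (1 * (16 * k * (k - \<tau>)) - \<tau> * (16 * k * (0 - 1))) / ((16 * k * (k - \<tau>)) * (16 * k * (k - \<tau>)))) (at \<tau>)"
      unfolding \<theta>_def using \<tau> by (intro DERIV_divide DERIV_cmult DERIV_diff DERIV_const DERIV_ident) auto
    moreover have "(1 * (16 * k * (k - \<tau>)) - \<tau> * (16 * k * (0 - 1))) / ((16 * k * (k - \<tau>)) * (16 * k * (k - \<tau>))) = 1 / q\<^sup>2"
      using \<tau> by (simp add: q_def divide_simps power2_eq_square) (simp add: algebra_simps)
    ultimately show ?thesis by simp
  qed
  have U: "((\<lambda>s. u (X s) (\<theta> s)) has_real_derivative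
      ux (X \<tau>) (\<theta> \<tau>) * (4 * X \<tau> / q) + ut (X \<tau>) (\<theta> \<tau>) * (1 / q\<^sup>2)) (at \<tau>)"
  proof (rule DERIV_along_curve[where g=u and gx=ux and gt=ut and X=X and \<theta>=\<theta> and s=\<tau>])
    show "continuous_on UNIV (\<lambda>(t, x). ux x t)"
      unfolding case_prod_beta by (intro u_continuous continuous_intros)
  qed (rule u_deriv(1) u_deriv(3)[OF \<theta>0] X' \<theta>')+
  have Q: "((\<lambda>s. 1 / (4 * (k - s))) has_real_derivative 4 / q\<^sup>2) (at \<tau>)"
    using \<tau> by (auto intro!: derivative_eq_intros simp: q_def power2_eq_square)
  have "((\<lambda>s. 2 * X s - u (X s) (\<theta> s) * (1 / (4 * (k - s)))) has_real_derivative
     2 * (4 * X \<tau> / q) - ((ux (X \<tau>) (\<theta> \<tau>) * (4 * X \<tau> / q) + ut (X \<tau>) (\<theta> \<tau>) * (1 / q\<^sup>2)) * (1 / (4 * (k - \<tau>)))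
       + 4 / q\<^sup>2 * u (X \<tau>) (\<theta> \<tau>))) (at \<tau>)"
    by (intro DERIV_diff DERIV_cmult X' DERIV_mult U Q)
  moreover have "2 * (4 * X \<tau> / q) - ((ux (X \<tau>) (\<theta> \<tau>) * (4 * X \<tau> / q) + ut (X \<tau>) (\<theta> \<tau>) * (1 / q\<^sup>2)) * (1 / (4 * (k - \<tau>)))
       + 4 / q\<^sup>2 * u (X \<tau>) (\<theta> \<tau>)) = shrunk_t k \<xi> \<tau>"
  proof -
    have t: "shrunk_t k \<xi> \<tau> = 2 * (2 * X \<tau> - u (X \<tau>) (\<theta> \<tau>) / q) * ((2 - ux (X \<tau>) (\<theta> \<tau>) / q) / q)
        - uxx (X \<tau>) (\<theta> \<tau>) / q ^ 3"
      unfolding shrunk_t_def shrunk_def shrunk_x_def shrunk_xx_def by (simp add: X_def \<theta>_def q_def)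
    show ?thesis unfolding t uxx_def q_def[symmetric] using q
      by (simp add: field_simps power2_eq_square power3_eq_cube)
  qed
  moreover have "(\<lambda>s. shrunk k \<xi> s) = (\<lambda>s. 2 * X s - u (X s) (\<theta> s) * (1 / (4 * (k - s))))"
    by (rule ext) (simp add: shrunk_def X_def \<theta>_def)
  ultimately show ?thesis by simp
qed

lemma shrunk_continuous:
  assumes "k > 0" and S: "\<And>\<xi> \<tau>. (\<xi>, \<tau>) \<in> S \<Longrightarrow> \<tau> < k"
  shows "continuous_on S (\<lambda>(\<xi>, \<tau>). shrunk k \<xi> \<tau>)" "continuous_on S (\<lambda>(\<xi>, \<tau>). shrunk_x k \<xi> \<tau>)"
    "(\<And>\<xi> \<tau>. (\<xi>, \<tau>) \<in> S \<Longrightarrow> 0 < \<tau>) \<Longrightarrow> continuous_on S (\<lambda>(\<xi>, \<tau>). shrunk_xx k \<xi> \<tau>)"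
proof -
  have nz: "4 * (k - snd z) \<noteq> 0" "16 * k * (k - snd z) \<noteq> 0" if "z \<in> S" for z
    using S[of "fst z" "snd z"] that \<open>k > 0\<close> by auto
  have q: "continuous_on S (\<lambda>z. 4 * (k - snd z))" by (intro continuous_intros)
  have X: "continuous_on S (\<lambda>z. fst z / (4 * (k - snd z)))"
    by (intro continuous_intros) (use nz in auto)
  have \<theta>: "continuous_on S (\<lambda>z. snd z / (16 * k * (k - snd z)))"
    by (intro continuous_intros) (use nz in auto)
  show "continuous_on S (\<lambda>(\<xi>, \<tau>). shrunk k \<xi> \<tau>)" unfolding case_prod_beta shrunk_def
    by (intro continuous_on_diff continuous_on_divide continuous_on_mult continuous_on_const continuous_on_fst
        continuous_on_id q u_continuous X \<theta>) (use nz in auto)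
  show "continuous_on S (\<lambda>(\<xi>, \<tau>). shrunk_x k \<xi> \<tau>)" unfolding case_prod_beta shrunk_x_def
    by (intro continuous_on_diff continuous_on_divide continuous_on_const q u_continuous X \<theta>) (use nz in auto)
  assume pos: "\<And>\<xi> \<tau>. (\<xi>, \<tau>) \<in> S \<Longrightarrow> 0 < \<tau>"
  have \<theta>0: "0 < snd z / (16 * k * (k - snd z))" if "z \<in> S" for z
    using S[of "fst z" "snd z"] pos[of "fst z" "snd z"] that \<open>k > 0\<close> by simp
  show "continuous_on S (\<lambda>(\<xi>, \<tau>). shrunk_xx k \<xi> \<tau>)" unfolding case_prod_beta shrunk_xx_def
    by (intro continuous_on_divide continuous_on_minus continuous_on_power q u_continuous X \<theta> \<theta>0) (use nz in auto)
qed

lemma shrunk_solution: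
  assumes k: "k > 0" and init: "\<And>x. x \<in> circ \<Longrightarrow> 4 * k * (2 * x - f x) = u x 0"
  shows "shrinking_burgers_solution k f (shrunk k)"
proof -
  have sub: "(\<xi>, \<tau>) \<in> shrinking_dom_closed k \<Longrightarrow> \<tau> < k" "(\<xi>, \<tau>) \<in> shrinking_dom k \<Longrightarrow> \<tau> < k"
    "(\<xi>, \<tau>) \<in> shrinking_dom k \<Longrightarrow> 0 < \<tau>" for \<xi> \<tau>
    by (auto simp: shrinking_dom_closed_def shrinking_dom_def)
  have cw: "continuous_on (shrinking_dom_closed k) (\<lambda>(\<xi>, \<tau>). shrunk k \<xi> \<tau>)"
    by (rule shrunk_continuous(1)[OF k sub(1)])
  have x: "continuous_on (shrinking_dom k) (\<lambda>(\<xi>, \<tau>). shrunk_x k \<xi> \<tau>)"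
    by (rule shrunk_continuous(2)[OF k sub(2)])
  have xx: "continuous_on (shrinking_dom k) (\<lambda>(\<xi>, \<tau>). shrunk_xx k \<xi> \<tau>)"
    by (rule shrunk_continuous(3)[OF k sub(2) sub(3)])
  have ct: "continuous_on (shrinking_dom k) (\<lambda>(\<xi>, \<tau>). shrunk_t k \<xi> \<tau>)"
    using x xx shrunk_continuous(1)[OF k sub(2)] unfolding shrunk_t_def case_prod_beta
    by (intro continuous_intros)
  have eq: "\<forall>(\<xi>, \<tau>) \<in> shrinking_dom k.
           ((\<lambda>s. shrunk k \<xi> s) has_real_derivative shrunk_t k \<xi> \<tau>) (at \<tau>) \<and>
           ((\<lambda>y. shrunk k y \<tau>) has_real_derivative shrunk_x k \<xi> \<tau>) (at \<xi>) \<and>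
           ((\<lambda>y. shrunk_x k y \<tau>) has_real_derivative shrunk_xx k \<xi> \<tau>) (at \<xi>) \<and>
           shrunk_t k \<xi> \<tau> = 2 * shrunk k \<xi> \<tau> * shrunk_x k \<xi> \<tau> + shrunk_xx k \<xi> \<tau>"
    using shrunk_deriv_x shrunk_deriv_t by (auto simp: shrinking_dom_def shrunk_t_def)
  have odd: "\<forall>(\<xi>, \<tau>) \<in> shrinking_dom_closed k. shrunk k (- \<xi>) \<tau> = - shrunk k \<xi> \<tau>"
    by (auto simp: shrunk_def u_odd)
  have init0: "\<forall>\<xi>. \<bar>\<xi>\<bar> \<le> 2 * k \<longrightarrow> shrunk k \<xi> 0 = f (\<xi> / (4 * k))"
  proof (intro allI impI)
    fix \<xi> assume "\<bar>\<xi>\<bar> \<le> 2 * k"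
    then have "\<xi> / (4 * k) \<in> circ" using k by (auto simp: circ_def field_simps abs_le_iff)
    from init[OF this] show "shrunk k \<xi> 0 = f (\<xi> / (4 * k))"
      using k by (simp add: shrunk_def field_simps)
  qed
  \<comment> \<open>The lateral boundary corresponds to the ends of the circle, where u vanishes and
    only the linear part 2 x = 1 or - 1 is left.\<close>
  have bd: "\<forall>\<tau>. 0 < \<tau> \<and> \<tau> < k \<longrightarrow> shrunk k (2 * (k - \<tau>)) \<tau> = 1 \<and> shrunk k (- (2 * (k - \<tau>))) \<tau> = - 1"
  proof (intro allI impI)
    fix \<tau> assume "0 < \<tau> \<and> \<tau> < k"
    then have nz: "k - \<tau> \<noteq> 0" by simp
    have "2 * (2 * (k - \<tau>)) / (4 * (k - \<tau>)) = 1" "2 * (k - \<tau>) / (4 * (k - \<tau>)) = 1/2"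
      "2 * (- (2 * (k - \<tau>))) / (4 * (k - \<tau>)) = - 1" "- (2 * (k - \<tau>)) / (4 * (k - \<tau>)) = - (1/2)"
      using nz by (simp_all add: divide_simps)
    then show "shrunk k (2 * (k - \<tau>)) \<tau> = 1 \<and> shrunk k (- (2 * (k - \<tau>))) \<tau> = - 1"
      unfolding shrunk_def by (simp only: u_half) simp
  qed
  show ?thesis
    unfolding shrinking_burgers_solution_def
    by (intro conjI cw odd init0 bd, rule exI[of _ "shrunk_t k"], rule exI[of _ "shrunk_x k"],
        rule exI[of _ "shrunk_xx k"], intro conjI ct x xx eq)
qed

text \<open>Since \<open>ux\<close> is continuous down to t = 0, a consequence of the C^1 datum,
  \<open>shrunk_x\<close> is continuous on the compact trapezoid including its initial line.\<close>

lemma shrunk_deriv_x_bounded: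
  assumes "k > 0" "T < k"
  shows "\<exists>C. \<forall>\<xi> \<tau> d. (\<xi>, \<tau>) \<in> shrinking_dom k \<longrightarrow> \<tau> \<le> T \<longrightarrow>
      ((\<lambda>y. shrunk k y \<tau>) has_real_derivative d) (at \<xi>) \<longrightarrow> d \<le> C"
proof -
  have "continuous_on (trapezoid k T) (\<lambda>(\<xi>, \<tau>). shrunk_x k \<xi> \<tau>)"
    by (rule shrunk_continuous(2)) (use assms in \<open>auto simp: trapezoid_def\<close>)
  then have "bounded ((\<lambda>(\<xi>, \<tau>). shrunk_x k \<xi> \<tau>) ` trapezoid k T)"
    by (intro compact_imp_bounded compact_continuous_image compact_trapezoid)
  then obtain C where C: "\<And>\<xi> \<tau>. (\<xi>, \<tau>) \<in> trapezoid k T \<Longrightarrow> \<bar>shrunk_x k \<xi> \<tau>\<bar> \<le> C"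
    unfolding bounded_iff by fastforce
  show ?thesis
  proof (intro exI allI impI)
    fix \<xi> \<tau> d
    assume dom: "(\<xi>, \<tau>) \<in> shrinking_dom k" "\<tau> \<le> T" and d: "((\<lambda>y. shrunk k y \<tau>) has_real_derivative d) (at \<xi>)"
    have "\<tau> < k" "(\<xi>, \<tau>) \<in> trapezoid k T" using dom by (auto simp: shrinking_dom_def trapezoid_def)
    then show "d \<le> C" using DERIV_unique[OF d shrunk_deriv_x(1)] C by fastforce
  qed
qed

lemma u_eq_shrunk:
  assumes k: "k > 0" and t: "t \<ge> 0"
  shows "u x t = 4 * k / (1 + 16 * k * t) *
    (2 * x - shrunk k (4 * k * x / (1 + 16 * k * t)) (16 * k\<^sup>2 * t / (1 + 16 * k * t)))"
proof -
  define m where "m = 1 + 16 * k * t"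
  have m: "m > 0" using k t by (simp add: m_def add_pos_nonneg)
  \<comment> \<open>The identity k - \<tau> = k / (1 + 16 k t), from which the two changes of
    variables are seen to be inverse to each other.\<close>
  have d: "k - 16 * k\<^sup>2 * t / m = k / m"
    using m by (simp add: field_simps) (simp add: m_def power2_eq_square algebra_simps)
  have x: "2 * (4 * k * x / m) / (4 * (k / m)) = 2 * x" "(4 * k * x / m) / (4 * (k / m)) = x" "(16 * k\<^sup>2 * t / m) / (16 * k * (k / m)) = t"
    using m k by (simp_all add: power2_eq_square)
  have "shrunk k (4 * k * x / m) (16 * k\<^sup>2 * t / m) = 2 * x - u x t / (4 * (k / m))"
    unfolding shrunk_def d x ..
  then show ?thesis using m k by (simp add: m_def[symmetric])
qed

end

theorem lemma3:
  fixes k :: real and f :: "real \<Rightarrow> real"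
  assumes "k > 0"
    and "C1_on f {- (1/2) .. 1/2}"
    and "\<forall>x\<in>{- (1/2) .. 1/2}. f (- x) = - f x"
    and "f (1/2) = 1"
  shows "let u\<^sub>0 = (\<lambda>x. 4 * k * (2 * x - f x));
             p = (\<lambda>t. 4 * k / (1 + 16 * k * t));
             \<xi> = (\<lambda>x t. 4 * k * x / (1 + 16 * k * t));
             \<tau> = (\<lambda>t. 16 * k\<^sup>2 * t / (1 + 16 * k * t))
         in \<exists>u w.
              burgers_solution u\<^sub>0 u \<and>
              (\<forall>v. burgers_solution u\<^sub>0 v \<longrightarrow> (\<forall>x. \<forall>t\<ge>0. v x t = u x t)) \<and>
              shrinking_burgers_solution k f w \<and>
              (\<forall>v. shrinking_burgers_solution k f v \<longrightarrow>
                   (\<forall>(y, s) \<in> shrinking_dom_closed k. v y s = w y s)) \<and>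
              (\<forall>x\<in>circ. \<forall>t\<ge>0. u x t = p t * (2 * x - w (\<xi> x t) (\<tau> t)))"
proof -
  obtain P0 P1 P2 where H: "heat_data P0 P1 P2"
    and init: "\<And>x. x \<in> circ \<Longrightarrow> 4 * k * (2 * x - f x) = - P1 x / P0 x"
    using cole_hopf_initial_data[OF assms] by metis
  interpret heat_data P0 P1 P2 by fact
  have u: "burgers_solution (\<lambda>x. 4 * k * (2 * x - f x)) u"
    using init by (rule u_burgers)
  have w: "shrinking_burgers_solution k f (shrunk k)"
    by (rule shrunk_solution[OF assms(1)]) (simp only: u_initial init)
  show ?thesis
    unfolding Let_def
  proof (intro exI conjI)
    show "burgers_solution (\<lambda>x. 4 * k * (2 * x - f x)) u" by (rule u)
    show "\<forall>v. burgers_solution (\<lambda>x. 4 * k * (2 * x - f x)) v \<longrightarrow> (\<forall>x. \<forall>t\<ge>0. v x t = u x t)"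
      using burgers_solution_unique[OF _ u] by blast
    show "shrinking_burgers_solution k f (shrunk k)" by (rule w)
    show "\<forall>v. shrinking_burgers_solution k f v \<longrightarrow>
                   (\<forall>(y, s) \<in> shrinking_dom_closed k. v y s = shrunk k y s)"
      using shrinking_burgers_unique[OF _ w shrunk_deriv_x_bounded[OF assms(1)]] by blast
    show "\<forall>x\<in>circ. \<forall>t\<ge>0. u x t = 4 * k / (1 + 16 * k * t) *
        (2 * x - shrunk k (4 * k * x / (1 + 16 * k * t)) (16 * k\<^sup>2 * t / (1 + 16 * k * t)))"
      using u_eq_shrunk[OF assms(1)] by blast
  qed
qed

end
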